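(* Let $\Gamma$ be a discrete group, $\Lambda\le\Gamma$ a subgroup, $\pi$ a unitary representation of $\Gamma$, and $\sigma$ a unitary representation of $\Lambda$ such that $\pi\prec\mathrm{ind}_\Lambda^\Gamma(\pi|_\Lambda)$ and $\pi|_\Lambda\prec\sigma\otimes\tau$ for some unitary representation $\tau$ of $\Lambda$. Then there is a $\Gamma$-map $\mathcal{B}_{\mathrm{ind}_\Lambda^\Gamma\sigma}\to\mathcal{B}_\pi$.
   Context: For a unitary representation $\pi:\Gamma\to\mathcal{U}(\mathcal{H}_\pi)$, $\Gamma$ acts on $B(\mathcal{H}_\pi)$ by $g\cdot x=\pi(g)x\pi(g^{-1})$. A $\Gamma$-map between operator systems carrying $\Gamma$-actions is a unital completely positive $\Gamma$-equivariant linear map. Furstenberg--Hamana (FH) boundary: on the set $\mathcal{G}$ of all $\Gamma$-maps $\phi:B(\mathcal{H}_\pi)\to B(\mathcal{H}_\pi)$ put the preorder $\phi\le\psi$ iff $\|\phi(x)\|\le\|\psi(x)\|$ for all $x$. Then $\mathcal{G}$ has minimal elements, every minimal element is idempotent, and its image is unique up to bijective completely isometric $\Gamma$-maps. $\mathcal{B}_\pi$ is the image of a minimal $\phi\in\mathcal{G}$, with the Choi--Effros product $a\cdot b=\phi(ab)$ and the restricted $\Gamma$-action; it is a $\Gamma$-$C^*$-algebra. $C^*_\pi(\Gamma)\subseteq B(\mathcal{H}_\pi)$ is the norm-closed span of $\pi(\Gamma)$; weak containment $\pi\prec\sigma$ of representations of the same group means that $\sigma(g)\mapsto\pi(g)$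 extends to a $*$-homomorphism $C^*_\sigma(\Gamma)\to C^*_\pi(\Gamma)$. $\mathrm{ind}_\Lambda^\Gamma$ denotes the (unitarily) induced representation. *)

theory Defs
  imports "HOL-Analysis.Analysis" "HOL-Algebra.Left_Coset"
begin

section \<open>Complex Hilbert spaces\<close>

class scaleC = scaleR +
  fixes scaleC :: "complex \<Rightarrow> 'a \<Rightarrow> 'a"  (infixr \<open>*\<^sub>C\<close> 75)

text \<open>The norm, metric and real inner product are those of the class \<^class>\<open>real_inner\<close>; the
  complex inner product is linear in its second argument and has the real one as real part.\<close>

class chilbert_space = real_inner + complete_space + scaleC +
  fixes cinner :: "'a \<Rightarrow> 'a \<Rightarrow> complex"
  assumes scaleC_add_right: "a *\<^sub>C (x + y) = a *\<^sub>C x + a *\<^sub>C y"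
    and scaleC_add_left: "(a + b) *\<^sub>C x = a *\<^sub>C x + b *\<^sub>C x"
    and scaleC_scaleC: "a *\<^sub>C b *\<^sub>C x = (a * b) *\<^sub>C x"
    and scaleR_scaleC: "r *\<^sub>R x = complex_of_real r *\<^sub>C x"
    and cinner_commute: "cinner x y = cnj (cinner y x)"
    and cinner_add_right: "cinner x (y + z) = cinner x y + cinner x z"
    and cinner_scaleC_right: "cinner x (a *\<^sub>C y) = a * cinner x y"
    and Re_cinner: "Re (cinner x y) = inner x y"

lemma scaleC_one [simp]: "1 *\<^sub>C x = (x :: 'a::chilbert_space)"
  using scaleR_scaleC[of 1 x] by simp

lemma cinner_add_left: "cinner (x + y) z = cinner x z + cinner y (z :: 'a::chilbert_space)"
  by (metis cinner_add_right cinner_commute complex_cnj_add)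

lemma cinner_scaleC_left: "cinner (a *\<^sub>C x) y = cnj a * cinner x (y :: 'a::chilbert_space)"
  by (metis cinner_scaleC_right cinner_commute complex_cnj_mult)

lemma cinner_same: "cinner x x = complex_of_real ((norm x)\<^sup>2)" for x :: "'a::chilbert_space"
proof -
  have "Im (cinner x x) = 0"
    using arg_cong[OF cinner_commute[of x x], of Im] by simp
  then show ?thesis
    by (simp add: complex_eq_iff Re_cinner power2_norm_eq_inner)
qed

lemma norm_scaleC [simp]: "norm (a *\<^sub>C x) = cmod a * norm (x :: 'a::chilbert_space)"
proof -
  have "complex_of_real ((norm (a *\<^sub>C x))\<^sup>2) = cnj a * a * complex_of_real ((norm x)\<^sup>2)"
    unfolding cinner_same[symmetric] by (simp add: cinner_scaleC_left cinner_scaleC_right)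
  also have "\<dots> = complex_of_real ((cmod a * norm x)\<^sup>2)"
    by (simp only: power_mult_distrib of_real_mult) (metis complex_norm_square mult.commute)
  finally have "(norm (a *\<^sub>C x))\<^sup>2 = (cmod a * norm x)\<^sup>2"
    by (simp only: of_real_eq_iff)
  then show ?thesis
    by (simp add: power2_eq_iff_nonneg)
qed

instantiation complex :: chilbert_space
begin
definition scaleC_complex :: "complex \<Rightarrow> complex \<Rightarrow> complex" where "scaleC_complex a x = a * x"
definition cinner_complex :: "complex \<Rightarrow> complex \<Rightarrow> complex" where "cinner_complex x y = cnj x * y"
instance
  by standard (auto simp: scaleC_complex_def cinner_complex_def inner_complex_def algebra_simps
      scaleR_conv_of_real)
end

instantiation blinfun :: (real_normed_vector, chilbert_space) scaleC
begin
definition scaleC_blinfun :: "complex \<Rightarrow> ('a \<Rightarrow>\<^sub>L 'b) \<Rightarrow> 'a \<Rightarrow>\<^sub>L 'b"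
  where "scaleC_blinfun a T = Blinfun (\<lambda>x. a *\<^sub>C blinfun_apply T x)"
instance ..
end

lemma bounded_linear_scaleC: "bounded_linear (\<lambda>x :: 'a::chilbert_space. a *\<^sub>C x)"
proof (rule bounded_linear_intro[where K = "cmod a"])
  show "a *\<^sub>C (r *\<^sub>R x) = r *\<^sub>R (a *\<^sub>C x)" for r and x :: 'a
    by (simp add: scaleR_scaleC scaleC_scaleC mult.commute)
qed (simp_all add: scaleC_add_right mult.commute)

lemma scaleC_blinfun_apply [simp]: "blinfun_apply (a *\<^sub>C T) x = a *\<^sub>C blinfun_apply T x"
  unfolding scaleC_blinfun_def
  by (intro bounded_linear_Blinfun_apply[THEN fun_cong, THEN trans]
      bounded_linear_compose[OF bounded_linear_scaleC] blinfun.bounded_linear_right refl)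

text \<open>The complex linear span is the real span of all complex multiples.\<close>

definition cspan :: "'a::{real_vector,scaleC} set \<Rightarrow> 'a set" where
  "cspan S = span {a *\<^sub>C x | a x. x \<in> S}"

text \<open>Hilbert spaces are the closed complex subspaces of the types in class
  \<^class>\<open>chilbert_space\<close>; \<^const>\<open>UNIV\<close> is the type itself. Subspaces are needed because the
  spaces of induced representations and of tensor products depend on terms.\<close>

definition hilbert :: "'a::chilbert_space set \<Rightarrow> bool" where
  "hilbert V \<longleftrightarrow> subspace V \<and> (\<forall>a. \<forall>x\<in>V. a *\<^sub>C x \<in> V) \<and> closed V"


section \<open>Hilbert sums\<close>

typedef (overloaded) ('i, 'a) ell2 =
    "{f :: 'i \<Rightarrow> 'a::chilbert_space. (\<lambda>i. (norm (f i))\<^sup>2) summable_on UNIV}"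
  morphisms ell2_apply Abs_ell2
  by (rule exI[of _ "\<lambda>_. 0"]) simp

setup_lifting type_definition_ell2

lemma ell2_eqI: "(\<And>i. ell2_apply f i = ell2_apply g i) \<Longrightarrow> f = g"
  by (simp add: ell2_apply_inject[symmetric] fun_eq_iff)

lemma ell2_summable: "(\<lambda>i. (norm (ell2_apply f i))\<^sup>2) summable_on UNIV"
  using ell2_apply[of f] by simp

lemma square_summable_add:
  fixes f g :: "'i \<Rightarrow> 'a::chilbert_space"
  assumes "(\<lambda>i. (norm (f i))\<^sup>2) summable_on UNIV" "(\<lambda>i. (norm (g i))\<^sup>2) summable_on UNIV"
  shows "(\<lambda>i. (norm (f i + g i))\<^sup>2) summable_on UNIV"
proof (rule summable_on_comparison_test)
  show "(\<lambda>i. 2 * (norm (f i))\<^sup>2 + 2 * (norm (g i))\<^sup>2) summable_on UNIV"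
    by (intro summable_on_add summable_on_cmult_right assms)
  fix i
  have "(norm (f i + g i))\<^sup>2 \<le> (norm (f i) + norm (g i))\<^sup>2"
    by (simp add: norm_triangle_ineq power_mono)
  also have "\<dots> \<le> 2 * (norm (f i))\<^sup>2 + 2 * (norm (g i))\<^sup>2"
    using sum_squares_bound[of "norm (f i)" "norm (g i)"] by (simp add: power2_sum)
  finally show "(norm (f i + g i))\<^sup>2 \<le> 2 * (norm (f i))\<^sup>2 + 2 * (norm (g i))\<^sup>2" .
qed auto

lemma square_summable_scaleC:
  fixes f :: "'i \<Rightarrow> 'a::chilbert_space"
  assumes "(\<lambda>i. (norm (f i))\<^sup>2) summable_on UNIV"
  shows "(\<lambda>i. (norm (a *\<^sub>C f i))\<^sup>2) summable_on UNIV"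
  using summable_on_cmult_right[OF assms, of "(cmod a)\<^sup>2"] by (simp add: power_mult_distrib)

lemma square_summable_scaleR:
  fixes f :: "'i \<Rightarrow> 'a::chilbert_space"
  assumes "(\<lambda>i. (norm (f i))\<^sup>2) summable_on UNIV"
  shows "(\<lambda>i. (norm (a *\<^sub>R f i))\<^sup>2) summable_on UNIV"
  unfolding scaleR_scaleC by (rule square_summable_scaleC[OF assms])

lemma cmod_cinner_le: "cmod (cinner x y) \<le> norm x * norm (y :: 'a::chilbert_space)"
proof (cases "cinner x y = 0")
  case False
  define u where "u = cnj (cinner x y) / cmod (cinner x y)"
  have u: "cmod u = 1" using False by (simp add: u_def norm_divide)
  have "complex_of_real (cmod (cinner x y)) = u * cinner x y"
    using False by (simp add: u_def complex_norm_square[symmetric] power2_eq_square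
        mult.commute[of "cnj _"])
  also have "\<dots> = cinner x (u *\<^sub>C y)" by (simp add: cinner_scaleC_right)
  finally have "cmod (cinner x y) = Re (cinner x (u *\<^sub>C y))" by (metis Re_complex_of_real)
  also have "\<dots> \<le> norm x * norm (u *\<^sub>C y)" by (simp only: Re_cinner norm_cauchy_schwarz)
  finally show ?thesis by (simp add: u)
qed simp

lemma square_summable_cinner:
  fixes f g :: "'i \<Rightarrow> 'a::chilbert_space"
  assumes "(\<lambda>i. (norm (f i))\<^sup>2) summable_on UNIV" "(\<lambda>i. (norm (g i))\<^sup>2) summable_on UNIV"
  shows "(\<lambda>i. cinner (f i) (g i)) summable_on UNIV"
proof -
  have "(\<lambda>i. cmod (cinner (f i) (g i))) summable_on UNIV"
  proof (rule summable_on_comparison_test)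
    show "(\<lambda>i. (norm (f i))\<^sup>2 + (norm (g i))\<^sup>2) summable_on UNIV"
      by (intro summable_on_add assms)
    fix i
    have "cmod (cinner (f i) (g i)) \<le> norm (f i) * norm (g i)" by (rule cmod_cinner_le)
    also have "\<dots> \<le> 2 * norm (f i) * norm (g i)" by (simp add: mult_nonneg_nonneg)
    also have "\<dots> \<le> (norm (f i))\<^sup>2 + (norm (g i))\<^sup>2" by (rule sum_squares_bound)
    finally show "cmod (cinner (f i) (g i)) \<le> (norm (f i))\<^sup>2 + (norm (g i))\<^sup>2" .
  qed auto
  then show ?thesis by (rule abs_summable_summable)
qed

instantiation ell2 :: (type, chilbert_space) real_vector
begin

lift_definition zero_ell2 :: "('a, 'b) ell2" is "\<lambda>_. 0" by simp
lift_definition plus_ell2 :: "('a, 'b) ell2 \<Rightarrow> ('a, 'b) ell2 \<Rightarrow> ('a, 'b) ell2"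
  is "\<lambda>f g i. f i + g i" by (rule square_summable_add)
lift_definition uminus_ell2 :: "('a, 'b) ell2 \<Rightarrow> ('a, 'b) ell2" is "\<lambda>f i. - f i" by simp
lift_definition scaleR_ell2 :: "real \<Rightarrow> ('a, 'b) ell2 \<Rightarrow> ('a, 'b) ell2"
  is "\<lambda>r f i. r *\<^sub>R f i" by (rule square_summable_scaleR)
definition minus_ell2 :: "('a, 'b) ell2 \<Rightarrow> ('a, 'b) ell2 \<Rightarrow> ('a, 'b) ell2"
  where "minus_ell2 f g = f + - g"

instance
proof
  fix f g h :: "('a, 'b) ell2" and r s :: real
  show "f + g + h = f + (g + h)" by transfer (simp add: add.assoc)
  show "f + g = g + f" by transfer (simp add: add.commute)
  show "0 + f = f" by transfer simp
  show "- f + f = 0" by transfer simp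
  show "f - g = f + - g" by (rule minus_ell2_def)
  show "r *\<^sub>R (f + g) = r *\<^sub>R f + r *\<^sub>R g" by transfer (simp add: scaleR_add_right)
  show "(r + s) *\<^sub>R f = r *\<^sub>R f + s *\<^sub>R f" by transfer (simp add: scaleR_add_left)
  show "r *\<^sub>R s *\<^sub>R f = (r * s) *\<^sub>R f" by transfer simp
  show "1 *\<^sub>R f = f" by transfer simp
qed

end

instantiation ell2 :: (type, chilbert_space) real_inner
begin

definition inner_ell2 :: "('a, 'b) ell2 \<Rightarrow> ('a, 'b) ell2 \<Rightarrow> real"
  where "inner_ell2 f g = (\<Sum>\<^sub>\<infinity>i. inner (ell2_apply f i) (ell2_apply g i))"
definition norm_ell2 :: "('a, 'b) ell2 \<Rightarrow> real"
  where "norm_ell2 f = sqrt (inner f f)"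
definition sgn_ell2 :: "('a, 'b) ell2 \<Rightarrow> ('a, 'b) ell2"
  where "sgn_ell2 f = scaleR (inverse (norm f)) f"
definition dist_ell2 :: "('a, 'b) ell2 \<Rightarrow> ('a, 'b) ell2 \<Rightarrow> real"
  where "dist_ell2 f g = norm (f - g)"
definition uniformity_ell2 :: "(('a, 'b) ell2 \<times> ('a, 'b) ell2) filter"
  where "uniformity_ell2 = (INF e\<in>{0<..}. principal {(f, g). dist f g < e})"
definition open_ell2 :: "('a, 'b) ell2 set \<Rightarrow> bool"
  where "open_ell2 U = (\<forall>x\<in>U. eventually (\<lambda>(x', y). x' = x \<longrightarrow> y \<in> U) uniformity)"

lemma inner_summable_ell2:
  "(\<lambda>i. inner (ell2_apply f i) (ell2_apply g i)) summable_on UNIV" for f g :: "('a, 'b) ell2"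
  using summable_on_Re[OF square_summable_cinner[OF ell2_summable[of f] ell2_summable[of g]]]
  by (simp add: Re_cinner)

instance
proof
  fix f g h :: "('a, 'b) ell2" and r s :: real
  show "sgn f = f /\<^sub>R norm f" by (rule sgn_ell2_def)
  show "dist f g = norm (f - g)" by (rule dist_ell2_def)
  show "uniformity = (INF e\<in>{0<..}. principal {(f :: ('a, 'b) ell2, g). dist f g < e})"
    by (rule uniformity_ell2_def)
  show "open U = (\<forall>x\<in>U. eventually (\<lambda>(x', y). x' = x \<longrightarrow> y \<in> U) uniformity)"
    for U :: "('a, 'b) ell2 set" by (rule open_ell2_def)
  show "inner f g = inner g f" by (simp add: inner_ell2_def inner_commute)
  show "inner (f + g) h = inner f h + inner g h"
    by (simp add: inner_ell2_def plus_ell2.rep_eq inner_add_left infsum_add inner_summable_ell2)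
  show "inner (r *\<^sub>R f) g = r * inner f g"
    by (simp add: inner_ell2_def scaleR_ell2.rep_eq infsum_cmult_right inner_summable_ell2)
  show "0 \<le> inner f f" by (simp add: inner_ell2_def infsum_nonneg)
  show "(inner f f = 0) = (f = 0)"
  proof
    assume 0: "inner f f = 0"
    have "inner (ell2_apply f i) (ell2_apply f i) = 0" for i
    proof (rule nonneg_infsum_le_0D[of "\<lambda>i. inner (ell2_apply f i) (ell2_apply f i)" UNIV])
      show "(\<Sum>\<^sub>\<infinity>i. inner (ell2_apply f i) (ell2_apply f i)) \<le> 0"
        using 0 by (simp add: inner_ell2_def)
    qed (auto simp: inner_summable_ell2)
    then show "f = 0" by (intro ell2_eqI) (simp add: zero_ell2.rep_eq)
  qed (simp add: inner_ell2_def zero_ell2.rep_eq)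
  show "norm f = sqrt (inner f f)" by (rule norm_ell2_def)
qed

end

lemma minus_ell2_apply: "ell2_apply (f - g) i = ell2_apply f i - ell2_apply g i"
  unfolding minus_ell2_def plus_ell2.rep_eq uminus_ell2.rep_eq by simp

lemma norm_ell2_power2: "(norm f)\<^sup>2 = (\<Sum>\<^sub>\<infinity>i. (norm (ell2_apply f i))\<^sup>2)"
  unfolding power2_norm_eq_inner by (simp add: inner_ell2_def)

lemma sum_le_norm_ell2: "finite F \<Longrightarrow> (\<Sum>i\<in>F. (norm (ell2_apply f i))\<^sup>2) \<le> (norm f)\<^sup>2"
  unfolding norm_ell2_power2 by (rule finite_sum_le_infsum) (auto simp: ell2_summable)

lemma norm_ell2_apply_le: "norm (ell2_apply f i) \<le> norm f"
proof (rule power2_le_imp_le)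
  show "(norm (ell2_apply f i))\<^sup>2 \<le> (norm f)\<^sup>2"
    using sum_le_norm_ell2[of "{i}" f] by simp
qed simp

instance ell2 :: (type, chilbert_space) complete_space
proof
  fix X :: "nat \<Rightarrow> ('a, 'b) ell2"
  assume X: "Cauchy X"
  have "Cauchy (\<lambda>n. ell2_apply (X n) i)" for i
  proof (rule CauchyI)
    fix e :: real assume "0 < e"
    then obtain M where "\<forall>m\<ge>M. \<forall>n\<ge>M. norm (X m - X n) < e" using CauchyD[OF X] by blast
    then show "\<exists>M. \<forall>m\<ge>M. \<forall>n\<ge>M. norm (ell2_apply (X m) i - ell2_apply (X n) i) < e"
      by (metis minus_ell2_apply norm_ell2_apply_le order_le_less_trans)
  qed
  then have "convergent (\<lambda>n. ell2_apply (X n) i)" for i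
    by (simp add: Cauchy_convergent_iff)
  then obtain L where L: "\<And>i. (\<lambda>n. ell2_apply (X n) i) \<longlonglongrightarrow> L i"
    unfolding convergent_def by metis
  have fin: "(\<Sum>i\<in>F. (norm (ell2_apply (X m) i - L i))\<^sup>2) \<le> e\<^sup>2"
    if M: "\<forall>m\<ge>M. \<forall>n\<ge>M. norm (X m - X n) < e" and "m \<ge> M" and F: "finite F" for e M m F
  proof (rule LIMSEQ_le_const2)
    show "(\<lambda>n. \<Sum>i\<in>F. (norm (ell2_apply (X m) i - ell2_apply (X n) i))\<^sup>2)
        \<longlonglongrightarrow> (\<Sum>i\<in>F. (norm (ell2_apply (X m) i - L i))\<^sup>2)"
      by (intro tendsto_intros L)
    have "(\<Sum>i\<in>F. (norm (ell2_apply (X m) i - ell2_apply (X n) i))\<^sup>2) \<le> e\<^sup>2" if "n \<ge> M" for n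
    proof -
      have "(\<Sum>i\<in>F. (norm (ell2_apply (X m - X n) i))\<^sup>2) \<le> (norm (X m - X n))\<^sup>2"
        by (rule sum_le_norm_ell2[OF F])
      also have "\<dots> \<le> e\<^sup>2"
        using M \<open>m \<ge> M\<close> \<open>n \<ge> M\<close> by (simp add: power_mono less_imp_le)
      finally show ?thesis by (simp add: minus_ell2_apply)
    qed
    then show "\<exists>N. \<forall>n\<ge>N. (\<Sum>i\<in>F. (norm (ell2_apply (X m) i - ell2_apply (X n) i))\<^sup>2) \<le> e\<^sup>2"
      by blast
  qed
  have summable: "(\<lambda>i. (norm (ell2_apply (X m) i - L i))\<^sup>2) summable_on UNIV"
    if "\<forall>m\<ge>M. \<forall>n\<ge>M. norm (X m - X n) < e" "m \<ge> M" for e M m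
    by (rule nonneg_bdd_above_summable_on) (auto intro!: bdd_aboveI2[of _ _ "e\<^sup>2"] fin[OF that])
  obtain M where M: "\<forall>m\<ge>M. \<forall>n\<ge>M. norm (X m - X n) < 1"
    using CauchyD[OF X, of 1] by auto
  have "(\<lambda>i. (norm (- (ell2_apply (X M) i - L i) + ell2_apply (X M) i))\<^sup>2) summable_on UNIV"
    by (rule square_summable_add) (simp_all only: norm_minus_cancel summable[OF M order_refl] ell2_summable)
  then have L2: "(\<lambda>i. (norm (L i))\<^sup>2) summable_on UNIV" by simp
  have "X \<longlonglongrightarrow> Abs_ell2 L"
  proof (rule LIMSEQ_I)
    fix e :: real assume "0 < e"
    then obtain N where N: "\<forall>m\<ge>N. \<forall>n\<ge>N. norm (X m - X n) < e / 2"
      using CauchyD[OF X, of "e / 2"] by auto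
    have "norm (X n - Abs_ell2 L) < e" if "n \<ge> N" for n
    proof -
      have "(norm (X n - Abs_ell2 L))\<^sup>2 = (\<Sum>\<^sub>\<infinity>i. (norm (ell2_apply (X n) i - L i))\<^sup>2)"
        by (simp add: norm_ell2_power2 minus_ell2_apply Abs_ell2_inverse L2)
      also have "\<dots> \<le> (e / 2)\<^sup>2"
        by (rule infsum_le_finite_sums[OF summable[OF N that]]) (rule fin[OF N that])
      finally show ?thesis using \<open>0 < e\<close> by (smt (verit) power2_le_imp_le field_sum_of_halves)
    qed
    then show "\<exists>N. \<forall>n\<ge>N. norm (X n - Abs_ell2 L) < e" by blast
  qed
  then show "convergent X" by (rule convergentI)
qed

instantiation ell2 :: (type, chilbert_space) chilbert_space
begin

lift_definition scaleC_ell2 :: "complex \<Rightarrow> ('a, 'b) ell2 \<Rightarrow> ('a, 'b) ell2"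
  is "\<lambda>a f i. a *\<^sub>C f i" by (rule square_summable_scaleC)
definition cinner_ell2 :: "('a, 'b) ell2 \<Rightarrow> ('a, 'b) ell2 \<Rightarrow> complex"
  where "cinner_ell2 f g = (\<Sum>\<^sub>\<infinity>i. cinner (ell2_apply f i) (ell2_apply g i))"

instance
proof
  fix f g h :: "('a, 'b) ell2" and a b :: complex and r :: real
  have s: "(\<lambda>i. cinner (ell2_apply f i) (ell2_apply g i)) summable_on UNIV" for f g :: "('a, 'b) ell2"
    by (intro square_summable_cinner ell2_summable)
  show "a *\<^sub>C (f + g) = a *\<^sub>C f + a *\<^sub>C g" by transfer (simp add: scaleC_add_right)
  show "(a + b) *\<^sub>C f = a *\<^sub>C f + b *\<^sub>C f" by transfer (simp add: scaleC_add_left)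
  show "a *\<^sub>C b *\<^sub>C f = (a * b) *\<^sub>C f" by transfer (simp add: scaleC_scaleC)
  show "r *\<^sub>R f = complex_of_real r *\<^sub>C f" by transfer (simp add: scaleR_scaleC)
  show "cinner f g = cnj (cinner g f)"
    unfolding cinner_ell2_def infsum_cnj[symmetric] by (simp add: cinner_commute[symmetric])
  show "cinner f (g + h) = cinner f g + cinner f h"
    by (simp add: cinner_ell2_def plus_ell2.rep_eq cinner_add_right infsum_add s)
  show "cinner f (a *\<^sub>C g) = a * cinner f g"
    by (simp add: cinner_ell2_def scaleC_ell2.rep_eq cinner_scaleC_right infsum_cmult_right s)
  show "Re (cinner f g) = inner f g"
    by (simp add: cinner_ell2_def inner_ell2_def infsum_Re[OF s, symmetric] Re_cinner)
qed

end

section \<open>Operators on a Hilbert space\<close>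

text \<open>\<open>B(V)\<close>: an operator on \<open>V\<close> is identified with its extension to the ambient type by \<open>0\<close> on
  the orthogonal complement of \<open>V\<close>. This identification preserves the norm, products, adjoints and
  positivity; the identity of \<open>V\<close> becomes the orthogonal projection onto \<open>V\<close>.\<close>

definition bop :: "'a::chilbert_space set \<Rightarrow> ('a \<Rightarrow>\<^sub>L 'a) set" where
  "bop V = {T. (\<forall>a x. blinfun_apply T (a *\<^sub>C x) = a *\<^sub>C blinfun_apply T x) \<and>
               (\<forall>x. blinfun_apply T x \<in> V) \<and>
               (\<forall>x. (\<forall>v\<in>V. cinner v x = 0) \<longrightarrow> blinfun_apply T x = 0)}"

definition bop_id :: "'a::chilbert_space set \<Rightarrow> 'a \<Rightarrow>\<^sub>L 'a" where
  "bop_id V = (THE T. T \<in> bop V \<and> (\<forall>v\<in>V. blinfun_apply T v = v))"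

definition is_adjoint :: "('a::chilbert_space \<Rightarrow>\<^sub>L 'a) \<Rightarrow> ('a \<Rightarrow>\<^sub>L 'a) \<Rightarrow> bool" where
  "is_adjoint S T \<longleftrightarrow> (\<forall>x y. cinner (blinfun_apply S x) y = cinner x (blinfun_apply T y))"

definition unitary_on :: "'a::chilbert_space set \<Rightarrow> ('a \<Rightarrow>\<^sub>L 'a) \<Rightarrow> bool" where
  "unitary_on V U \<longleftrightarrow> U \<in> bop V \<and> blinfun_apply U ` V = V \<and>
     (\<forall>x\<in>V. \<forall>y\<in>V. cinner (blinfun_apply U x) (blinfun_apply U y) = cinner x y)"

text \<open>Positivity of the operator matrix \<open>(A i j)\<close>, \<open>i, j < n\<close>, as an operator on the \<open>n\<close>-fold
  Hilbert sum.\<close>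

definition pos_matrix :: "nat \<Rightarrow> (nat \<Rightarrow> nat \<Rightarrow> 'a::chilbert_space \<Rightarrow>\<^sub>L 'a) \<Rightarrow> bool" where
  "pos_matrix n A \<longleftrightarrow>
     (\<forall>x. let s = (\<Sum>i<n. \<Sum>j<n. cinner (x i) (blinfun_apply (A i j) (x j))) in s \<in> \<real> \<and> 0 \<le> Re s)"

definition completely_positive ::
    "('a::chilbert_space \<Rightarrow>\<^sub>L 'a) set \<Rightarrow> (('a \<Rightarrow>\<^sub>L 'a) \<Rightarrow> ('b::chilbert_space \<Rightarrow>\<^sub>L 'b)) \<Rightarrow> bool" where
  "completely_positive E \<Phi> \<longleftrightarrow>
     (\<forall>n A. (\<forall>i<n. \<forall>j<n. A i j \<in> E) \<and> pos_matrix n A \<longrightarrow> pos_matrix n (\<lambda>i j. \<Phi> (A i j)))"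


section \<open>Unitary representations\<close>

definition unitary_rep ::
    "('g, 'm) monoid_scheme \<Rightarrow> 'a::chilbert_space set \<Rightarrow> ('g \<Rightarrow> 'a \<Rightarrow>\<^sub>L 'a) \<Rightarrow> bool" where
  "unitary_rep G V \<pi> \<longleftrightarrow> hilbert V \<and> (\<forall>g\<in>carrier G. unitary_on V (\<pi> g)) \<and>
     (\<forall>g\<in>carrier G. \<forall>h\<in>carrier G. \<pi> (g \<otimes>\<^bsub>G\<^esub> h) = \<pi> g o\<^sub>L \<pi> h)"

definition cstar_rep :: "('g, 'm) monoid_scheme \<Rightarrow> ('g \<Rightarrow> 'a::chilbert_space \<Rightarrow>\<^sub>L 'a) \<Rightarrow> ('a \<Rightarrow>\<^sub>L 'a) set"
  where "cstar_rep G \<pi> = closure (cspan (\<pi> ` carrier G))"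

text \<open>A \<open>*\<close>-homomorphism defined on the set \<open>A\<close>, an operator \<open>*\<close>-algebra, with values in \<open>B\<close>.\<close>

definition star_hom ::
    "('a::chilbert_space \<Rightarrow>\<^sub>L 'a) set \<Rightarrow> ('b::chilbert_space \<Rightarrow>\<^sub>L 'b) set \<Rightarrow>
     (('a \<Rightarrow>\<^sub>L 'a) \<Rightarrow> ('b \<Rightarrow>\<^sub>L 'b)) \<Rightarrow> bool" where
  "star_hom A B \<theta> \<longleftrightarrow> \<theta> ` A \<subseteq> B \<and>
     (\<forall>S\<in>A. \<forall>T\<in>A. \<theta> (S + T) = \<theta> S + \<theta> T) \<and>
     (\<forall>a. \<forall>T\<in>A. \<theta> (a *\<^sub>C T) = a *\<^sub>C \<theta> T) \<and>
     (\<forall>S\<in>A. \<forall>T\<in>A. \<theta> (S o\<^sub>L T) = \<theta> S o\<^sub>L \<theta> T) \<and>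
     (\<forall>S\<in>A. \<forall>T\<in>A. is_adjoint S T \<longrightarrow> is_adjoint (\<theta> S) (\<theta> T))"

definition weakly_contained ::
    "('g, 'm) monoid_scheme \<Rightarrow> ('g \<Rightarrow> 'a::chilbert_space \<Rightarrow>\<^sub>L 'a) \<Rightarrow>
     ('g \<Rightarrow> 'b::chilbert_space \<Rightarrow>\<^sub>L 'b) \<Rightarrow> bool" where
  "weakly_contained G \<pi> \<sigma> \<longleftrightarrow>
     (\<exists>\<theta>. star_hom (cstar_rep G \<sigma>) (cstar_rep G \<pi>) \<theta> \<and> (\<forall>g\<in>carrier G. \<theta> (\<sigma> g) = \<pi> g))"

text \<open>The induced representation acts on the Hilbert sum of copies of \<open>V\<close> indexed by the left cosets
  of \<open>L\<close>, \<open>(g f)(c) = \<sigma>(s(c)\<inverse> g s(g\<inverse>c)) f(g\<inverse>c)\<close>, where \<open>s\<close> selects a representative of each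
  coset. The assignment \<open>f(c) = \<xi>(s(c))\<close> identifies this space with that of the functions \<open>\<xi>\<close> on
  \<open>G\<close> satisfying \<open>\<xi>(x l) = \<sigma>(l)\<inverse> \<xi>(x)\<close> for \<open>l \<in> L\<close>, whose norms are square summable over \<open>G/L\<close>,
  with \<open>G\<close> acting by left translation.\<close>

definition coset_rep :: "'g set \<Rightarrow> 'g" where
  "coset_rep c = (SOME x. x \<in> c)"

definition ind_space ::
    "('g, 'm) monoid_scheme \<Rightarrow> 'g set \<Rightarrow> 'a::chilbert_space set \<Rightarrow> ('g set, 'a) ell2 set" where
  "ind_space G L V = {f. (\<forall>c \<in> lcosets\<^bsub>G\<^esub> L. ell2_apply f c \<in> V) \<and>
                         (\<forall>c. c \<notin> lcosets\<^bsub>G\<^esub> L \<longrightarrow> ell2_apply f c = 0)}"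

definition ind_fun ::
    "('g, 'm) monoid_scheme \<Rightarrow> 'g set \<Rightarrow> ('g \<Rightarrow> 'a::chilbert_space \<Rightarrow>\<^sub>L 'a) \<Rightarrow>
     'g \<Rightarrow> ('g set \<Rightarrow> 'a) \<Rightarrow> 'g set \<Rightarrow> 'a" where
  "ind_fun G L \<sigma> g f c =
     (if c \<in> lcosets\<^bsub>G\<^esub> L
      then let d = inv\<^bsub>G\<^esub> g <#\<^bsub>G\<^esub> c
           in blinfun_apply (\<sigma> (inv\<^bsub>G\<^esub> (coset_rep c) \<otimes>\<^bsub>G\<^esub> g \<otimes>\<^bsub>G\<^esub> coset_rep d)) (f d)
      else 0)"

definition ind_rep ::
    "('g, 'm) monoid_scheme \<Rightarrow> 'g set \<Rightarrow> ('g \<Rightarrow> 'a::chilbert_space \<Rightarrow>\<^sub>L 'a) \<Rightarrow>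
     'g \<Rightarrow> ('g set, 'a) ell2 \<Rightarrow>\<^sub>L ('g set, 'a) ell2" where
  "ind_rep G L \<sigma> g = Blinfun (\<lambda>f. Abs_ell2 (ind_fun G L \<sigma> g (ell2_apply f)))"

text \<open>The tensor product \<open>V \<otimes> W\<close> is realized inside the Hilbert sum of copies of \<open>W\<close> indexed by an
  orthonormal basis of \<open>V\<close>, with \<open>v \<otimes> w = (\<langle>b, v\<rangle> w)\<^sub>b\<close>. By Parseval's identity,
  \<open>\<langle>v \<otimes> w, v' \<otimes> w'\<rangle> = \<langle>v, v'\<rangle> \<langle>w, w'\<rangle>\<close> for \<open>v, v' \<in> V\<close>, which characterizes the Hilbert space tensor
  product up to a unique unitary. A bounded operator is determined by its values on elementary
  tensors, and \<open>\<sigma>(g) \<otimes> \<tau>(g)\<close> is isometric on their span, so the description below is definite.\<close>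

definition is_onb :: "'a::chilbert_space set \<Rightarrow> 'a set \<Rightarrow> bool" where
  "is_onb V B \<longleftrightarrow> B \<subseteq> V \<and> (\<forall>a\<in>B. \<forall>b\<in>B. cinner a b = (if a = b then 1 else 0)) \<and>
                  closure (cspan B) = V"

definition onb :: "'a::chilbert_space set \<Rightarrow> 'a set" where
  "onb V = (SOME B. is_onb V B)"

definition tensor ::
    "'a::chilbert_space set \<Rightarrow> 'a \<Rightarrow> 'b::chilbert_space \<Rightarrow> ('a, 'b) ell2" where
  "tensor V v w = Abs_ell2 (\<lambda>b. if b \<in> onb V then cinner b v *\<^sub>C w else 0)"

definition tensor_space ::
    "'a::chilbert_space set \<Rightarrow> 'b::chilbert_space set \<Rightarrow> ('a, 'b) ell2 set" where
  "tensor_space V W = closure (cspan {tensor V v w | v w. v \<in> V \<and> w \<in> W})"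

definition tensor_rep ::
    "'a::chilbert_space set \<Rightarrow> 'b::chilbert_space set \<Rightarrow> ('g \<Rightarrow> 'a \<Rightarrow>\<^sub>L 'a) \<Rightarrow> ('g \<Rightarrow> 'b \<Rightarrow>\<^sub>L 'b) \<Rightarrow>
     'g \<Rightarrow> ('a, 'b) ell2 \<Rightarrow>\<^sub>L ('a, 'b) ell2" where
  "tensor_rep V W \<sigma> \<tau> g =
     (THE T. T \<in> bop (tensor_space V W) \<and>
        (\<forall>v\<in>V. \<forall>w\<in>W. blinfun_apply T (tensor V v w) =
           tensor V (blinfun_apply (\<sigma> g) v) (blinfun_apply (\<tau> g) w)))"


section \<open>Equivariant maps and the Furstenberg--Hamana boundary\<close>

definition conj_act ::
    "('g, 'm) monoid_scheme \<Rightarrow> ('g \<Rightarrow> 'a::chilbert_space \<Rightarrow>\<^sub>L 'a) \<Rightarrow> 'g \<Rightarrow> ('a \<Rightarrow>\<^sub>L 'a) \<Rightarrow> 'a \<Rightarrow>\<^sub>L 'a" where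
  "conj_act G \<pi> g T = \<pi> g o\<^sub>L T o\<^sub>L \<pi> (inv\<^bsub>G\<^esub> g)"

text \<open>\<open>\<Phi>\<close> is a \<open>G\<close>-map between the invariant operator systems \<open>E \<subseteq> B(V)\<close> and \<open>F \<subseteq> B(W)\<close>. Values of
  \<open>\<Phi>\<close> outside \<open>E\<close> are irrelevant.\<close>

definition G_map ::
    "('g, 'm) monoid_scheme \<Rightarrow> 'a::chilbert_space set \<Rightarrow> ('g \<Rightarrow> 'a \<Rightarrow>\<^sub>L 'a) \<Rightarrow> ('a \<Rightarrow>\<^sub>L 'a) set \<Rightarrow>
     'b::chilbert_space set \<Rightarrow> ('g \<Rightarrow> 'b \<Rightarrow>\<^sub>L 'b) \<Rightarrow> ('b \<Rightarrow>\<^sub>L 'b) set \<Rightarrow>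
     (('a \<Rightarrow>\<^sub>L 'a) \<Rightarrow> ('b \<Rightarrow>\<^sub>L 'b)) \<Rightarrow> bool" where
  "G_map G V \<pi> E W \<rho> F \<Phi> \<longleftrightarrow> \<Phi> ` E \<subseteq> F \<and>
     (\<forall>S\<in>E. \<forall>T\<in>E. \<Phi> (S + T) = \<Phi> S + \<Phi> T) \<and>
     (\<forall>a. \<forall>T\<in>E. \<Phi> (a *\<^sub>C T) = a *\<^sub>C \<Phi> T) \<and>
     \<Phi> (bop_id V) = bop_id W \<and>
     completely_positive E \<Phi> \<and>
     (\<forall>g\<in>carrier G. \<forall>T\<in>E. \<Phi> (conj_act G \<pi> g T) = conj_act G \<rho> g (\<Phi> T))"

definition G_selfmaps ::
    "('g, 'm) monoid_scheme \<Rightarrow> 'a::chilbert_space set \<Rightarrow> ('g \<Rightarrow> 'a \<Rightarrow>\<^sub>L 'a) \<Rightarrow>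
     (('a \<Rightarrow>\<^sub>L 'a) \<Rightarrow> ('a \<Rightarrow>\<^sub>L 'a)) set" where
  "G_selfmaps G V \<pi> = {\<phi>. G_map G V \<pi> (bop V) V \<pi> (bop V) \<phi>}"

definition selfmap_le ::
    "'a::chilbert_space set \<Rightarrow> (('a \<Rightarrow>\<^sub>L 'a) \<Rightarrow> ('a \<Rightarrow>\<^sub>L 'a)) \<Rightarrow> (('a \<Rightarrow>\<^sub>L 'a) \<Rightarrow> ('a \<Rightarrow>\<^sub>L 'a)) \<Rightarrow> bool" where
  "selfmap_le V \<phi> \<psi> \<longleftrightarrow> (\<forall>T \<in> bop V. norm (\<phi> T) \<le> norm (\<psi> T))"

definition minimal_selfmap ::
    "('g, 'm) monoid_scheme \<Rightarrow> 'a::chilbert_space set \<Rightarrow> ('g \<Rightarrow> 'a \<Rightarrow>\<^sub>L 'a) \<Rightarrow>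
     (('a \<Rightarrow>\<^sub>L 'a) \<Rightarrow> ('a \<Rightarrow>\<^sub>L 'a)) \<Rightarrow> bool" where
  "minimal_selfmap G V \<pi> \<phi> \<longleftrightarrow> \<phi> \<in> G_selfmaps G V \<pi> \<and>
     (\<forall>\<psi> \<in> G_selfmaps G V \<pi>. selfmap_le V \<psi> \<phi> \<longrightarrow> selfmap_le V \<phi> \<psi>)"

text \<open>The Furstenberg--Hamana boundary is determined only up to isomorphism, hence a predicate rather
  than a function. Its operator system structure is the one inherited from \<open>B(V)\<close>; the matrix
  order of its C*-structure, given by the Choi--Effros product \<open>(a, b) \<mapsto> \<phi>(a b)\<close>, is the same,
  so that the product does not enter the notion of a \<open>G\<close>-map.\<close>

definition is_FH_boundary ::
    "('g, 'm) monoid_scheme \<Rightarrow> 'a::chilbert_space set \<Rightarrow> ('g \<Rightarrow> 'a \<Rightarrow>\<^sub>L 'a) \<Rightarrow> ('a \<Rightarrow>\<^sub>L 'a) set \<Rightarrow> bool" where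
  "is_FH_boundary G V \<pi> B \<longleftrightarrow> (\<exists>\<phi>. minimal_selfmap G V \<pi> \<phi> \<and> B = \<phi> ` bop V)"

end

theory Submission
  imports Defs
begin

text \<open>A weak containment \<open>\<pi> \<prec> \<rho>\<close> yields a \<open>G\<close>-map \<open>B(H\<^sub>\<rho>) \<rightarrow> B(H\<^sub>\<pi>)\<close>: extend the representation of
  \<open>C*(\<rho>)\<close> to a completely positive map (Arveson); since \<open>C*(\<rho>)\<close> lies in its multiplicative domain,
  the extension is equivariant. Applied over the subgroup \<open>L\<close> and composed with \<open>T \<mapsto> T \<otimes> 1\<close>, this gives an
  \<open>L\<close>-map \<open>\<Psi> : B(H\<^sub>\<sigma>) \<rightarrow> B(H\<^sub>\<pi>)\<close>. Applying \<open>\<Psi>\<close> to the diagonal blocks of an operator gives a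
  \<open>G\<close>-map from the operators of \<open>ind \<sigma>\<close> to those of \<open>ind (\<pi>|\<^sub>L)\<close>, and a second extension over \<open>G\<close>
  leads to \<open>B(H\<^sub>\<pi>)\<close>. Finally restrict to the boundary of \<open>ind \<sigma>\<close> and compose with a minimal
  self-map of \<open>B(H\<^sub>\<pi>)\<close>.\<close>

text \<open>Complete positivity concerns all matrix sizes at once, while weak containment supplies
  only a *-homomorphism \<theta>. Both gaps are closed by matrices. Positivity of \<theta> on
  matrices comes from square roots taken inside the matrix algebra. For the extension, rows and
  columns are indexed by the vectors of the target space themselves, so that one positive functional
  covers every finite tuple of vectors. The price is that the resulting form carries no linearity in
  its vector arguments; linearity, boundedness and the bimodule property are all recovered from
  positivity, through real quadratic polynomials that never become negative. The estimates use the
  real inner product, and the complex structure is restored by moving scalars into the algebra. Norm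
  bounds accompany the equivariant maps because \<open>G_map\<close> records none, while a
  block-diagonal operator over infinitely many cosets exists only for uniformly bounded
  blocks.\<close>

text \<open>The degenerate cases matter as much as the Cauchy-Schwarz one: with a = 0 or c = 0 the
  conclusion forces b = 0, which is how first variations and null vectors are handled.\<close>

lemma quadratic_nonneg_discriminant:
  fixes a b c :: real
  assumes "\<And>t. 0 \<le> a * t\<^sup>2 + b * t + c"
  shows "b\<^sup>2 \<le> 4 * a * c"
proof (cases "a = 0")
  case True
  have "b = 0"
  proof (rule ccontr)
    assume "b \<noteq> 0"
    \<comment> \<open>At this point the affine function takes the value -1.\<close>
    then show False using assms[of "(- c - 1) / b"] True by simp
  qed
  then show ?thesis using True by simp
next
  case False
  have "0 \<le> c" using assms[of 0] by simp
  have "a > 0"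
  proof (rule ccontr)
    assume "\<not> 0 < a"
    with False have a: "a < 0" by simp
    \<comment> \<open>Adding the values at t and -t removes b. Since t is at least 1, a t^2 + c is
      at most a t + c = a - 1, which is negative.\<close>
    define t where "t = 1 + (c + 1) / (- a)"
    have "0 \<le> a * t\<^sup>2 + b * t + c" "0 \<le> a * (- t)\<^sup>2 + b * (- t) + c" by (rule assms)+
    then have "0 \<le> a * t\<^sup>2 + c" by simp
    moreover have "t \<le> t\<^sup>2" using a \<open>0 \<le> c\<close> by (intro self_le_power) (auto simp: t_def divide_nonneg_neg intro: divide_nonneg_neg divide_nonpos_neg)
    then have "a * t\<^sup>2 \<le> a * t" using a by (simp add: mult_left_mono_neg)
    moreover have "a * t = a - c - 1" using a by (simp add: t_def field_simps)
    ultimately show False using a by simp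
  qed
  then show ?thesis using assms[of "- b / (2 * a)"]
    by (simp add: field_simps power2_eq_square)
qed

section \<open>Riesz representation, projections and adjoints\<close>

text \<open>Variational proof: if v represents f on V, then |x|^2 - 2 f(x) equals |x - v|^2 - |v|^2
  there, so v is found as the minimizer. Allowing a closed subspace V yields orthogonal projections
  from the same statement.\<close>

lemma riesz_representation:
  fixes V :: "'a::{real_inner,complete_space} set"
  assumes V: "subspace V" "closed V" and f: "bounded_linear (f :: 'a \<Rightarrow> real)"
  obtains v where "v \<in> V" "\<And>w. w \<in> V \<Longrightarrow> inner v w = f w"
proof -
  interpret f: bounded_linear f by (rule f)
  obtain K where K: "\<And>x. \<bar>f x\<bar> \<le> norm x * K" using f.bounded by auto
  define \<phi> where "\<phi> x = (norm x)\<^sup>2 - 2 * f x" for x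
  have bdd: "- K\<^sup>2 \<le> \<phi> x" for x
  proof -
    have "0 \<le> (norm x - K)\<^sup>2" by simp
    then have "2 * (norm x * K) \<le> (norm x)\<^sup>2 + K\<^sup>2" by (simp add: power2_diff)
    then show ?thesis using K[of x] by (simp add: \<phi>_def)
  qed
  define m where "m = Inf (\<phi> ` V)"
  have bdd': "bdd_below (\<phi> ` V)" by (rule bdd_belowI2[of _ "- K\<^sup>2"]) (rule bdd)
  have ne: "\<phi> ` V \<noteq> {}" using subspace_0[OF V(1)] by auto
  have m: "m \<le> \<phi> x" if "x \<in> V" for x
    unfolding m_def using that by (intro cInf_lower bdd') auto
  have "\<exists>x\<in>V. \<phi> x < m + 1 / Suc n" for n
  proof -
    have "Inf (\<phi> ` V) < m + 1 / Suc n" by (simp add: m_def)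
    from cInf_lessD[OF ne this] show ?thesis by auto
  qed
  then obtain x where x: "\<And>n. x n \<in> V" "\<And>n. \<phi> (x n) < m + 1 / Suc n" by metis
  \<comment> \<open>Parallelogram law: the midpoint of y and z also lies in V, so its value is at
    least m. Near-minimizers are therefore close to each other.\<close>
  have par: "(norm (y - z))\<^sup>2 \<le> 2 * (\<phi> y - m) + 2 * (\<phi> z - m)" if "y \<in> V" "z \<in> V" for y z
  proof -
    have "m \<le> \<phi> ((1/2) *\<^sub>R (y + z))" using that V(1) by (intro m subspace_scale subspace_add)
    moreover have "2 * \<phi> y + 2 * \<phi> z = 4 * \<phi> ((1/2) *\<^sub>R (y + z)) + (norm (y - z))\<^sup>2"
      unfolding \<phi>_def power2_norm_eq_inner
      by (simp add: f.add f.scaleR algebra_simps inner_commute)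
    ultimately show ?thesis by simp
  qed
  have "Cauchy x"
  proof (rule CauchyI)
    fix e :: real assume e: "0 < e"
    obtain N where N: "inverse (real (Suc N)) < e\<^sup>2 / 4" using e reals_Archimedean[of "e\<^sup>2 / 4"] by auto
    have "norm (x i - x j) < e" if "i \<ge> N" "j \<ge> N" for i j
    proof -
      have *: "\<phi> (x k) - m < e\<^sup>2 / 4" if "k \<ge> N" for k
      proof -
        have "1 / real (Suc k) \<le> inverse (real (Suc N))" using that by (simp add: field_simps)
        then show ?thesis using x(2)[of k] N by linarith
      qed
      have "(norm (x i - x j))\<^sup>2 < e\<^sup>2"
        using par[OF x(1) x(1), of i j] *[OF that(1)] *[OF that(2)] by argo
      then show ?thesis using e by (simp add: power2_less_imp_less)
    qed
    then show "\<exists>M. \<forall>m\<ge>M. \<forall>n\<ge>M. norm (x m - x n) < e" by blast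
  qed
  then obtain v where v: "x \<longlonglongrightarrow> v" using Cauchy_convergent_iff convergent_def by blast
  have vV: "v \<in> V" using closed_sequentially[OF V(2) _ v] x(1) by blast
  have "(\<lambda>n. \<phi> (x n)) \<longlonglongrightarrow> \<phi> v"
    unfolding \<phi>_def by (intro tendsto_intros v f.tendsto)
  moreover have "(\<lambda>n. m + 1 / Suc n) \<longlonglongrightarrow> m + 0"
    by (intro tendsto_intros LIMSEQ_Suc lim_1_over_n)
  ultimately have \<phi>v: "\<phi> v \<le> m"
    using LIMSEQ_le[of "\<lambda>n. \<phi> (x n)" "\<phi> v"] x(2) by (auto simp: less_imp_le)
  have "inner v w = f w" if w: "w \<in> V" for w
  proof -
    \<comment> \<open>Moving from the minimizer in the direction w gives a quadratic with constant
      term 0, so its linear coefficient vanishes.\<close>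
    have "0 \<le> (norm w)\<^sup>2 * t\<^sup>2 + (2 * (inner v w - f w)) * t + 0" for t
    proof -
      have "\<phi> v \<le> \<phi> (v + t *\<^sub>R w)"
        using \<phi>v m[of "v + t *\<^sub>R w"] V(1) vV w subspace_add subspace_scale by (metis order_trans)
      also have "\<phi> (v + t *\<^sub>R w) = \<phi> v + (norm w)\<^sup>2 * t\<^sup>2 + (2 * (inner v w - f w)) * t"
        unfolding \<phi>_def power2_norm_eq_inner
        by (simp add: f.add f.scaleR algebra_simps inner_commute power2_eq_square)
      finally show ?thesis by simp
    qed
    from quadratic_nonneg_discriminant[OF this] show ?thesis by simp
  qed
  with vV show ?thesis by (rule that)
qed

section \<open>Calculus of the complex inner product\<close>

lemma scaleC_simps:
  fixes x y :: "'a::chilbert_space"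
  shows "a *\<^sub>C 0 = (0::'a)" "0 *\<^sub>C x = 0" "a *\<^sub>C (r *\<^sub>R x) = r *\<^sub>R (a *\<^sub>C x)"
proof -
  interpret l: bounded_linear "\<lambda>x::'a. a *\<^sub>C x" by (rule bounded_linear_scaleC)
  show "a *\<^sub>C 0 = (0::'a)" "a *\<^sub>C (r *\<^sub>R x) = r *\<^sub>R (a *\<^sub>C x)" by (rule l.zero l.scaleR)+
  show "0 *\<^sub>C x = 0" using scaleR_scaleC[of 0 x] by simp
qed

lemma cinner_zero [simp]: "cinner 0 y = 0" "cinner x 0 = 0" for x y :: "'a::chilbert_space"
  using cinner_scaleC_left[of 0 x y] cinner_scaleC_right[of x 0 y]
  by (simp_all add: scaleC_simps)

lemma cinner_minus: "cinner (- x) y = - cinner x y" "cinner x (- y) = - cinner x y"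
  for x y :: "'a::chilbert_space"
  using cinner_add_left[of x "- x" y] cinner_add_right[of x y "- y"]
  by (simp_all add: eq_neg_iff_add_eq_0 add.commute)

lemma cinner_diff: "cinner (x - y) z = cinner x z - cinner y z" "cinner z (x - y) = cinner z x - cinner z y"
  for x y z :: "'a::chilbert_space"
  using cinner_add_left[of x "- y" z] cinner_add_right[of z x "- y"] by (simp_all add: cinner_minus)

lemma cinner_scaleR: "cinner (r *\<^sub>R x) y = r *\<^sub>R cinner x y" "cinner x (r *\<^sub>R y) = r *\<^sub>R cinner x y"
  for x y :: "'a::chilbert_space"
  by (simp_all add: scaleR_scaleC[of r x] scaleR_scaleC[of r y] cinner_scaleC_left cinner_scaleC_right scaleR_conv_of_real)

lemma cinner_conv_inner: "cinner x y = Complex (inner x y) (- inner x (\<i> *\<^sub>C y))"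
  for x y :: "'a::chilbert_space"
  unfolding complex_eq_iff Re_cinner[symmetric] by (simp add: cinner_scaleC_right)

lemma inner_scaleC_left: "inner (a *\<^sub>C x) y = inner x (cnj a *\<^sub>C y)" for x y :: "'a::chilbert_space"
  by (simp add: Re_cinner[symmetric] cinner_scaleC_left cinner_scaleC_right)

lemma cinner_eqI: "(\<And>x. cinner x u = cinner x v) \<Longrightarrow> u = v" for u v :: "'a::chilbert_space"
proof -
  assume "\<And>x. cinner x u = cinner x v"
  then have "cinner (u - v) (u - v) = 0" by (simp add: cinner_diff)
  then show "u = v" by (simp add: cinner_same)
qed

lemma bounded_bilinear_cinner: "bounded_bilinear (cinner :: 'a::chilbert_space \<Rightarrow> 'a \<Rightarrow> complex)"
  by standard (auto simp: cinner_add_left cinner_add_right cinner_scaleR intro!: exI[of _ 1] cmod_cinner_le)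

lemma hilbertD:
  assumes "hilbert V"
  shows "subspace V" "closed V" "\<And>a x. x \<in> V \<Longrightarrow> a *\<^sub>C x \<in> V" "0 \<in> V"
  using assms unfolding hilbert_def by (auto intro: subspace_0)

lemma hilbert_riesz_unique:
  assumes "hilbert V" "u \<in> V" "v \<in> V" "\<And>w. w \<in> V \<Longrightarrow> inner w u = inner w v"
  shows "u = v"
proof -
  have "inner (u - v) (u - v) = 0"
    using assms(4)[of "u - v"] subspace_diff[OF hilbertD(1)[OF assms(1)] assms(2,3)]
    by (simp add: inner_diff_right)
  then show ?thesis by simp
qed

text \<open>Bounded linear functions are only real linear here, so the adjoint is taken with respect
  to the real inner product. This makes it total, and bounded real linear in the operator.\<close>

definition adj :: "('a::chilbert_space \<Rightarrow>\<^sub>L 'b::chilbert_space) \<Rightarrow> 'b \<Rightarrow>\<^sub>L 'a" where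
  "adj T = Blinfun (\<lambda>y. SOME v. \<forall>x. inner v x = inner (blinfun_apply T x) y)"

definition clin :: "('a::chilbert_space \<Rightarrow>\<^sub>L 'b::chilbert_space) \<Rightarrow> bool" where
  "clin T \<longleftrightarrow> (\<forall>a x. blinfun_apply T (a *\<^sub>C x) = a *\<^sub>C blinfun_apply T x)"

lemma clinD: "clin T \<Longrightarrow> blinfun_apply T (a *\<^sub>C x) = a *\<^sub>C blinfun_apply T x"
  by (simp add: clin_def)

lemma inner_adj_right: "inner x (adj T y) = inner (blinfun_apply T x) y"
proof -
  define A where "A y = (SOME v. \<forall>x. inner v x = inner (blinfun_apply T x) y)" for y
  have A: "inner x (A y) = inner (blinfun_apply T x) y" for x y
  proof -
    have "bounded_linear (\<lambda>x. inner (blinfun_apply T x) y)"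
      by (rule bounded_linear_compose[OF bounded_linear_inner_left blinfun.bounded_linear_right])
    from riesz_representation[OF subspace_UNIV closed_UNIV this]
    have "\<exists>v. \<forall>x. inner v x = inner (blinfun_apply T x) y" by (metis UNIV_I)
    then have "\<forall>x. inner (A y) x = inner (blinfun_apply T x) y" unfolding A_def by (rule someI_ex)
    then show ?thesis by (simp add: inner_commute)
  qed
  have "bounded_linear A"
  proof (rule bounded_linear_intro[where K = "norm T"])
    show "A (x + y) = A x + A y" for x y
      by (rule vector_eq_ldot[THEN iffD1]) (simp add: A inner_add_right)
    show "A (r *\<^sub>R x) = r *\<^sub>R A x" for r x
      by (rule vector_eq_ldot[THEN iffD1]) (simp add: A)
    fix y
    have "norm (A y) * norm (A y) = inner (blinfun_apply T (A y)) y"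
      by (simp add: A[symmetric] power2_eq_square[symmetric] power2_norm_eq_inner)
    also have "\<dots> \<le> norm (blinfun_apply T (A y)) * norm y" by (rule norm_cauchy_schwarz)
    also have "\<dots> \<le> norm T * norm (A y) * norm y" by (intro mult_right_mono norm_blinfun) auto
    finally have "norm (A y) * norm (A y) \<le> norm (A y) * (norm y * norm T)" by (simp add: mult_ac)
    then show "norm (A y) \<le> norm y * norm T"
      by (cases "A y = 0") auto
  qed
  moreover have "adj T = Blinfun A" unfolding adj_def A_def ..
  ultimately show ?thesis by (simp add: A bounded_linear_Blinfun_apply)
qed

lemma inner_adj_left: "inner (adj T y) x = inner y (T x)"
  by (metis inner_adj_right inner_commute)

lemma adjI: "(\<And>x y. inner (blinfun_apply T x) y = inner x (blinfun_apply S y)) \<Longrightarrow> adj T = S"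
  by (rule blinfun_eqI, rule vector_eq_ldot[THEN iffD1]) (metis inner_adj_right)

lemma adj_adj [simp]: "adj (adj T) = T"
  by (rule adjI) (simp add: inner_adj_left)

lemma adj_add: "adj (S + T) = adj S + adj T"
  by (rule adjI) (simp add: inner_adj_right blinfun.add_left inner_add_left inner_add_right)

lemma adj_scaleR: "adj (r *\<^sub>R T) = r *\<^sub>R adj T"
  by (rule adjI) (simp add: inner_adj_right blinfun.scaleR_left)

lemma adj_zero [simp]: "adj 0 = 0"
  by (rule adjI) simp

lemma adj_compose: "adj (S o\<^sub>L T) = adj T o\<^sub>L adj S"
  by (rule adjI) (simp add: inner_adj_right)

lemma norm_adj [simp]: "norm (adj T) = norm T"
proof -
  have le: "norm (adj T) \<le> norm T" for T :: "'x::chilbert_space \<Rightarrow>\<^sub>L 'y::chilbert_space"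
  proof (rule norm_blinfun_bound)
    fix y
    have "norm (adj T y) * norm (adj T y) = inner (T (adj T y)) y"
      by (simp add: inner_adj_right[symmetric] power2_eq_square[symmetric] power2_norm_eq_inner)
    also have "\<dots> \<le> norm (T (adj T y)) * norm y" by (rule norm_cauchy_schwarz)
    also have "\<dots> \<le> norm T * norm (adj T y) * norm y" by (intro mult_right_mono norm_blinfun) auto
    finally have "norm (adj T y) * norm (adj T y) \<le> norm (adj T y) * (norm T * norm y)" by (simp add: mult_ac)
    then show "norm (adj T y) \<le> norm T * norm y" by (cases "adj T y = 0") auto
  qed simp
  show ?thesis using le[of T] le[of "adj T"] by simp
qed

lemma bounded_linear_adj: "bounded_linear adj"
  by (rule bounded_linear_intro[where K = 1]) (simp_all add: adj_add adj_scaleR)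

lemmas adj_diff = linear_diff[OF bounded_linear.linear[OF bounded_linear_adj]]

lemma clin_adj: "clin T \<Longrightarrow> clin (adj T)"
  unfolding clin_def
proof (intro allI)
  fix a y assume T: "\<forall>a x. blinfun_apply T (a *\<^sub>C x) = a *\<^sub>C blinfun_apply T x"
  show "adj T (a *\<^sub>C y) = a *\<^sub>C adj T y"
  proof (rule vector_eq_ldot[THEN iffD1], rule allI)
    fix x show "inner x (adj T (a *\<^sub>C y)) = inner x (a *\<^sub>C adj T y)"
      using T inner_scaleC_left[of "cnj a" x "adj T y"] inner_scaleC_left[of "cnj a" "T x" y]
      by (simp add: inner_adj_right)
  qed
qed

text \<open>The imaginary part of \<open>cinner\<close> is the real inner product with a factor i
  inserted, and \<open>adj T\<close> commutes with i when T does. Hence the real adjoint of a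
  complex linear operator is its complex adjoint.\<close>

lemma cinner_adj_right: "clin T \<Longrightarrow> cinner x (adj T y) = cinner (T x) y"
  using clinD[OF clin_adj, of T \<i> y] by (simp add: cinner_conv_inner inner_adj_right[symmetric])

lemma cinner_adj_left: "clin T \<Longrightarrow> cinner (adj T y) x = cinner y (T x)"
  by (metis cinner_adj_right clin_adj adj_adj)

lemma is_adjoint_adj: "clin S \<Longrightarrow> is_adjoint S T \<longleftrightarrow> T = adj S"
  unfolding is_adjoint_def by (metis cinner_adj_right adjI Re_cinner)

lemma clin_compose: "clin S \<Longrightarrow> clin T \<Longrightarrow> clin (S o\<^sub>L T)" by (simp add: clin_def)

lemma adj_scaleC: "clin T \<Longrightarrow> adj (a *\<^sub>C T) = cnj a *\<^sub>C adj T"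
  by (rule adjI) (simp add: inner_scaleC_left inner_adj_right clin_adj[THEN clinD, symmetric])

lemma projection:
  fixes Q :: "'a::chilbert_space \<Rightarrow>\<^sub>L 'a"
  assumes "adj Q = Q" "Q o\<^sub>L Q = Q"
  shows inner_projection: "inner f (blinfun_apply Q f) = (norm (blinfun_apply Q f))\<^sup>2"
    and norm_projection_le: "norm (blinfun_apply Q f) \<le> norm f"
proof -
  show *: "inner f (Q f) = (norm (Q f))\<^sup>2"
    using inner_adj_right[of f Q "Q f"] arg_cong[OF assms(2), of "\<lambda>R. blinfun_apply R f"] assms(1)
    by (simp add: power2_norm_eq_inner)
  have "norm (Q f) * norm (Q f) \<le> norm f * norm (Q f)"
    using norm_cauchy_schwarz[of f "Q f"] * by (simp add: power2_eq_square)
  then show "norm (Q f) \<le> norm f" by (cases "Q f = 0") auto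
qed

section \<open>Operators on a closed subspace\<close>

lemma bopD:
  assumes "T \<in> bop V"
  shows "clin T" "blinfun_apply T x \<in> V" "(\<And>v. v \<in> V \<Longrightarrow> cinner v x = 0) \<Longrightarrow> blinfun_apply T x = 0"
    "blinfun_apply T (a *\<^sub>C x) = a *\<^sub>C blinfun_apply T x"
  using assms unfolding bop_def clin_def by auto

text \<open>The projection sends x to the Riesz representative in V of the functional
  \<open>inner x\<close>. It is the only candidate for the definite description: x - P x is
  orthogonal to V, so every member of \<open>bop V\<close> kills it.\<close>

lemma bop_id:
  assumes V: "hilbert V"
  shows bop_id_in_bop: "bop_id V \<in> bop V"
    and bop_id_apply: "v \<in> V \<Longrightarrow> bop_id V v = v"
    and cinner_bop_id: "v \<in> V \<Longrightarrow> cinner v (bop_id V x) = cinner v x"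
proof -
  define P where "P x = (SOME v. v \<in> V \<and> (\<forall>w\<in>V. inner v w = inner x w))" for x
  have P: "P x \<in> V" "\<And>w. w \<in> V \<Longrightarrow> inner w (P x) = inner w x" for x
  proof -
    have "\<exists>v. v \<in> V \<and> (\<forall>w\<in>V. inner v w = inner x w)"
      using riesz_representation[OF hilbertD(1,2)[OF V] bounded_linear_inner_right[of x]] by metis
    then have "P x \<in> V \<and> (\<forall>w\<in>V. inner (P x) w = inner x w)" unfolding P_def by (rule someI_ex)
    then show "P x \<in> V" "\<And>w. w \<in> V \<Longrightarrow> inner w (P x) = inner w x" by (auto simp: inner_commute)
  qed
  note uniq = hilbert_riesz_unique[OF V]
  note sub = hilbertD(1)[OF V]
  have bl: "bounded_linear P"
  proof (rule bounded_linear_intro[where K = 1])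
    show "P (x + y) = P x + P y" for x y
      by (rule uniq) (auto simp: P inner_add_right intro: subspace_add[OF sub])
    show "P (r *\<^sub>R x) = r *\<^sub>R P x" for r x
      by (rule uniq) (auto simp: P intro: subspace_scale[OF sub])
    fix x
    have "norm (P x) * norm (P x) = inner (P x) x"
      using P(2)[OF P(1), of x x] by (simp add: power2_eq_square[symmetric] power2_norm_eq_inner)
    also have "\<dots> \<le> norm (P x) * norm x" by (rule norm_cauchy_schwarz)
    finally show "norm (P x) \<le> norm x * 1" by (cases "P x = 0") auto
  qed
  have sc: "P (a *\<^sub>C x) = a *\<^sub>C P x" for a x
  proof (rule uniq)
    fix w assume "w \<in> V"
    then show "inner w (P (a *\<^sub>C x)) = inner w (a *\<^sub>C P x)"
      using inner_scaleC_left[of "cnj a" w x] inner_scaleC_left[of "cnj a" w "P x"]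
      by (simp add: P hilbertD(3)[OF V])
  qed (auto simp: P hilbertD(3)[OF V])
  have cin: "cinner v (P x) = cinner v x" if "v \<in> V" for v x
    unfolding cinner_conv_inner sc[symmetric] by (simp add: P that)
  have app: "blinfun_apply (Blinfun P) = P" by (rule bounded_linear_Blinfun_apply[OF bl])
  have P1: "P v = v" if "v \<in> V" for v by (rule uniq) (auto simp: P that)
  have PB: "Blinfun P \<in> bop V"
    unfolding bop_def mem_Collect_eq app
  proof (intro conjI allI impI sc P(1))
    fix x assume 0: "\<forall>v\<in>V. cinner v x = 0"
    show "P x = 0" by (rule uniq) (auto simp: P(1) hilbertD(4)[OF V] cin 0 Re_cinner[symmetric])
  qed
  have "bop_id V = Blinfun P"
    unfolding bop_id_def
  proof (rule the_equality)
    show "Blinfun P \<in> bop V \<and> (\<forall>v\<in>V. blinfun_apply (Blinfun P) v = v)"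
      using PB P1 by (simp add: app)
    fix T assume T: "T \<in> bop V \<and> (\<forall>v\<in>V. blinfun_apply T v = v)"
    show "T = Blinfun P"
    proof (rule blinfun_eqI)
      fix x
      have "T (x - P x) = 0"
        by (rule bopD(3)[of _ V]) (use T cin in \<open>auto simp: cinner_diff\<close>)
      then show "T x = Blinfun P x" using T P(1)[of x] by (simp add: blinfun.diff_right app)
    qed
  qed
  then show "bop_id V \<in> bop V" "v \<in> V \<Longrightarrow> bop_id V v = v"
     "v \<in> V \<Longrightarrow> cinner v (bop_id V x) = cinner v x"
    using PB by (simp_all add: app P1 cin)
qed

lemma bop_comp_id:
  assumes "hilbert V" "T \<in> bop V"
  shows "T o\<^sub>L bop_id V = T" "bop_id V o\<^sub>L T = T"
    "T (bop_id V x) = T x"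
proof -
  show *: "T (bop_id V x) = T x" for x
  proof -
    have "T (x - bop_id V x) = 0"
      by (rule bopD(3)[OF assms(2)]) (simp add: cinner_diff cinner_bop_id[OF assms(1)])
    then show ?thesis by (simp add: blinfun.diff_right)
  qed
  show "T o\<^sub>L bop_id V = T" "bop_id V o\<^sub>L T = T"
    by (auto intro!: blinfun_eqI simp: * bop_id_apply[OF assms(1)] bopD(2)[OF assms(2)])
qed

lemma bop_eqI:
  assumes V: "hilbert V" and S: "S \<in> bop V" and T: "T \<in> bop V"
    and eq: "\<And>v w. v \<in> V \<Longrightarrow> w \<in> V \<Longrightarrow> cinner v (blinfun_apply S w) = cinner v (blinfun_apply T w)"
  shows "S = T"
proof (rule blinfun_eqI, rule hilbert_riesz_unique[OF V])
  fix x w assume "w \<in> V"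
  show "inner w (S x) = inner w (T x)"
    using eq[OF \<open>w \<in> V\<close>, of "bop_id V x"] bopD(2)[OF bop_id_in_bop[OF V]]
    by (simp add: bop_comp_id(3)[OF V] S T Re_cinner[symmetric])
qed (auto intro: bopD S T)

lemma bop_intro:
  assumes "clin T" "\<And>x. blinfun_apply T x \<in> V" "\<And>x. (\<And>v. v \<in> V \<Longrightarrow> cinner v x = 0) \<Longrightarrow> blinfun_apply T x = 0"
  shows "T \<in> bop V"
  using assms unfolding bop_def clin_def by auto

lemma adj_bop_id: "hilbert V \<Longrightarrow> adj (bop_id V) = bop_id V"
proof (rule adjI)
  fix u v assume V: "hilbert V"
  have "cinner (bop_id V u) v = cinner (bop_id V u) (bop_id V v)"
    by (simp add: cinner_bop_id[OF V] bopD(2)[OF bop_id_in_bop[OF V]])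
  also have "\<dots> = cinner u (bop_id V v)"
    by (metis V bopD(2) bop_id_in_bop cinner_bop_id cinner_commute)
  finally show "inner (bop_id V u) v = inner u (bop_id V v)" by (metis Re_cinner)
qed

text \<open>With P the projection onto V, T = T P gives T* = P T*, so T* has range in V; for x
  orthogonal to V, T* x is orthogonal to everything because T has range in V.\<close>

lemma bop_adj:
  assumes V: "hilbert V" and T: "T \<in> bop V"
  shows "adj T \<in> bop V"
proof (rule bop_intro)
  show "clin (adj T)" by (rule clin_adj[OF bopD(1)[OF T]])
  have eq: "adj T = bop_id V o\<^sub>L adj T"
    using arg_cong[OF bop_comp_id(1)[OF V T], of adj] by (simp add: adj_compose adj_bop_id[OF V])
  show "adj T x \<in> V" for x
    by (subst eq) (simp add: bopD(2)[OF bop_id_in_bop[OF V]])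
  fix x assume *: "\<And>v. v \<in> V \<Longrightarrow> cinner v x = 0"
  show "adj T x = 0"
    by (rule cinner_eqI) (simp add: cinner_adj_right bopD(1,2)[OF T] *)
qed

lemma inner_bop_id: "hilbert V \<Longrightarrow> inner (bop_id V x) y = inner x (bop_id V y)"
  using inner_adj_right[of x "bop_id V" y] by (simp add: adj_bop_id)

lemma inner_bop_id_same:
  "hilbert V \<Longrightarrow> inner x (bop_id V x) = (norm (bop_id V x))\<^sup>2"
  by (rule inner_projection) (auto simp: adj_bop_id bop_comp_id bop_id_in_bop)

lemma norm_bop_id_le: "hilbert V \<Longrightarrow> norm (bop_id V x) \<le> norm x"
  by (rule norm_projection_le) (auto simp: adj_bop_id bop_comp_id bop_id_in_bop)

lemma bop_closed:
  assumes "hilbert V"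
  shows "S \<in> bop V \<Longrightarrow> T \<in> bop V \<Longrightarrow> S + T \<in> bop V" "T \<in> bop V \<Longrightarrow> a *\<^sub>C T \<in> bop V"
    "T \<in> bop V \<Longrightarrow> r *\<^sub>R T \<in> bop V"
    "S \<in> bop V \<Longrightarrow> T \<in> bop V \<Longrightarrow> S o\<^sub>L T \<in> bop V" "0 \<in> bop V"
proof -
  note V = hilbertD[OF assms]
  show "S \<in> bop V \<Longrightarrow> T \<in> bop V \<Longrightarrow> S + T \<in> bop V"
    unfolding bop_def by (simp add: blinfun.add_left scaleC_add_right subspace_add[OF V(1)])
  show "T \<in> bop V \<Longrightarrow> a *\<^sub>C T \<in> bop V"
    unfolding bop_def by (simp add: scaleC_scaleC mult.commute V(3) scaleC_simps)
  show "T \<in> bop V \<Longrightarrow> r *\<^sub>R T \<in> bop V"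
    unfolding bop_def by (simp add: blinfun.scaleR_left scaleC_simps subspace_scale[OF V(1)])
  show "S \<in> bop V \<Longrightarrow> T \<in> bop V \<Longrightarrow> S o\<^sub>L T \<in> bop V"
    unfolding bop_def by (simp add: blinfun.zero_right)
  show "0 \<in> bop V"
    unfolding bop_def by (simp add: V(4) scaleC_simps)
qed

section \<open>Closed spans\<close>

definition closed_subspace :: "'a::real_normed_vector set \<Rightarrow> bool" where
  "closed_subspace V \<longleftrightarrow> subspace V \<and> closed V"

lemma closed_subspace_vimage:
  "bounded_linear f \<Longrightarrow> closed_subspace A \<Longrightarrow> closed_subspace (f -` A)"
  unfolding closed_subspace_def
  by (auto intro: linear_subspace_vimage bounded_linear.linear closed_vimage
      linear_continuous_on)

lemma closed_subspace_singleton: "closed_subspace {0}"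
  by (simp add: closed_subspace_def subspace_single_0)

lemma closed_subspace_kernel: "bounded_linear f \<Longrightarrow> closed_subspace {x. f x = 0}"
  using closed_subspace_vimage[OF _ closed_subspace_singleton] by (simp add: vimage_def)

lemma closed_subspace_INT:
  "(\<And>i. i \<in> I \<Longrightarrow> closed_subspace (A i)) \<Longrightarrow> closed_subspace (\<Inter>i\<in>I. A i)"
  unfolding closed_subspace_def by (auto intro: subspace_Inter)

lemma closed_subspace_closure_span: "closed_subspace (closure (span S))"
proof -
  have "subspace (closure (span S))"
    unfolding subspace_def
  proof (intro conjI ballI allI)
    show "0 \<in> closure (span S)" using closure_subset span_zero by blast
    fix x y c assume "x \<in> closure (span S)" "y \<in> closure (span S)"
    then obtain f g where f: "\<And>n. f n \<in> span S" "f \<longlonglongrightarrow> x" and g: "\<And>n. g n \<in> span S" "g \<longlonglongrightarrow> y"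
      unfolding closure_sequential by metis
    show "x + y \<in> closure (span S)" unfolding closure_sequential
      by (rule exI[of _ "\<lambda>n. f n + g n"]) (auto intro: tendsto_add f g span_add)
    show "c *\<^sub>R x \<in> closure (span S)" unfolding closure_sequential
      by (rule exI[of _ "\<lambda>n. c *\<^sub>R f n"]) (auto intro: tendsto_scaleR f span_scale)
  qed
  then show ?thesis by (simp add: closed_subspace_def)
qed

lemma closure_span_least: "closed_subspace A \<Longrightarrow> S \<subseteq> A \<Longrightarrow> closure (span S) \<subseteq> A"
  by (simp add: closed_subspace_def closure_minimal span_minimal)

text \<open>The density principle behind most extensions from generators: a property passes to the
  closed span once it is written as a closed subspace, built from kernels, preimages and
  intersections. A real subspace A suffices, since \<open>cspan\<close> is a real span of complex
  multiples.\<close>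

lemma closure_cspan_least:
  assumes "closed_subspace A" "\<And>a x. x \<in> S \<Longrightarrow> a *\<^sub>C x \<in> A"
  shows "closure (cspan S) \<subseteq> A"
  unfolding cspan_def using assms by (intro closure_span_least) auto

lemma closed_subspace_closure_cspan: "closed_subspace (closure (cspan S))"
  unfolding cspan_def by (rule closed_subspace_closure_span)

lemma closure_cspan_base: "x \<in> S \<Longrightarrow> a *\<^sub>C x \<in> closure (cspan S)"
  unfolding cspan_def by (rule closure_subset[THEN subsetD], rule span_base) blast

lemma hilbert_iff: "hilbert V \<longleftrightarrow> closed_subspace V \<and> (\<forall>a. \<forall>x\<in>V. a *\<^sub>C x \<in> V)"
  unfolding hilbert_def closed_subspace_def by auto

lemma hilbert_closure_cspan: "hilbert (closure (cspan S))"
proof -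
  have "closure (cspan S) \<subseteq> (\<lambda>x. a *\<^sub>C x) -` closure (cspan S)" for a
    by (rule closure_cspan_least)
      (auto intro: closed_subspace_vimage bounded_linear_scaleC closed_subspace_closure_cspan
        closure_cspan_base simp: scaleC_scaleC)
  then show ?thesis unfolding hilbert_iff by (auto simp: closed_subspace_closure_cspan)
qed

lemma closure_cspan_superset: "S \<subseteq> closure (cspan S)" for S :: "'a::chilbert_space set"
  using closure_cspan_base[of _ S 1] by auto

lemma hilbert_closure_cspan_least: "hilbert V \<Longrightarrow> S \<subseteq> V \<Longrightarrow> closure (cspan S) \<subseteq> V"
  by (rule closure_cspan_least) (auto simp: hilbert_iff)

section \<open>Operators from Gram kernels\<close>

text \<open>Equal Gram kernels determine an isometry between the closed spans. It is built from its
  graph, the closed span of the pairs (e x, e' x), so no choice of linear combinations occurs. Basis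
  expansions, tensor products of unitaries and the flip of tensor factors are all instances.\<close>

lemma gram_isometry:
  fixes e :: "'x \<Rightarrow> 'a::chilbert_space" and e' :: "'x \<Rightarrow> 'b::chilbert_space"
  assumes gram: "\<And>x y. x \<in> X \<Longrightarrow> y \<in> X \<Longrightarrow> cinner (e x) (e y) = cinner (e' x) (e' y)"
  obtains U :: "'a \<Rightarrow>\<^sub>L 'b" where "clin U" "\<And>x. x \<in> X \<Longrightarrow> blinfun_apply U (e x) = e' x"
    "\<And>u v. u \<in> closure (cspan (e ` X)) \<Longrightarrow> v \<in> closure (cspan (e ` X)) \<Longrightarrow>
      cinner (U u) (U v) = cinner u v"
    "blinfun_apply U ` closure (cspan (e ` X)) = closure (cspan (e' ` X))"
    "\<And>u. blinfun_apply U u \<in> closure (cspan (e' ` X))"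
    "\<And>u. (\<And>v. v \<in> closure (cspan (e ` X)) \<Longrightarrow> cinner v u = 0) \<Longrightarrow> blinfun_apply U u = 0"
proof -
  define K where "K = closure (cspan (e ` X))"
  define K' where "K' = closure (cspan (e' ` X))"
  have hK: "hilbert K" unfolding K_def by (rule hilbert_closure_cspan)
  define D where "D = {(a *\<^sub>C e x, a *\<^sub>C e' x) | a x. x \<in> X}"
  have DI: "x \<in> X \<Longrightarrow> (a *\<^sub>C e x, a *\<^sub>C e' x) \<in> D" for a x
    unfolding D_def by blast
  have DE: "\<lbrakk>p \<in> D; \<And>a x. p = (a *\<^sub>C e x, a *\<^sub>C e' x) \<Longrightarrow> x \<in> X \<Longrightarrow> thesis\<rbrakk> \<Longrightarrow> thesis" for p thesis
    unfolding D_def by blast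
  define \<Gamma> where "\<Gamma> = closure (span D)"
  have D\<Gamma>: "D \<subseteq> \<Gamma>" unfolding \<Gamma>_def using closure_subset span_superset by blast
  have sub\<Gamma>: "closed_subspace \<Gamma>" unfolding \<Gamma>_def by (rule closed_subspace_closure_span)
  note least = closure_span_least[of _ D, folded \<Gamma>_def]
  \<comment> \<open>The defect of isometry, as a form on pairs. It vanishes on generators by the
    Gram hypothesis.\<close>
  define h where "h p q = cinner (fst p) (fst q) - cinner (snd p) (snd q)"
    for p q :: "'a \<times> 'b"
  have bl1: "bounded_linear (\<lambda>p. h p q)" for q
    unfolding h_def
    by (intro bounded_linear_sub bounded_linear_compose[OF bounded_bilinear.bounded_linear_left[OF bounded_bilinear_cinner]]
      bounded_linear_fst bounded_linear_snd)
  have bl2: "bounded_linear (\<lambda>q. h p q)" for p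
    unfolding h_def
    by (intro bounded_linear_sub bounded_linear_compose[OF bounded_bilinear.bounded_linear_right[OF bounded_bilinear_cinner]]
      bounded_linear_fst bounded_linear_snd)
  have "\<Gamma> \<subseteq> (\<Inter>q\<in>D. {p. h p q = 0})"
    by (intro least closed_subspace_INT closed_subspace_kernel bl1)
      (auto simp: D_def h_def cinner_scaleC_left cinner_scaleC_right gram)
  \<comment> \<open>The vanishing is extended in one variable at a time: the first already ranges
    over all of \<Gamma>, now the second does.\<close>
  then have "\<Gamma> \<subseteq> (\<Inter>p\<in>\<Gamma>. {q. h p q = 0})"
    by (intro least closed_subspace_INT closed_subspace_kernel bl2) auto
  then have h0: "h p q = 0" if "p \<in> \<Gamma>" "q \<in> \<Gamma>" for p q using that by auto
  have eqn: "norm (snd p) = norm (fst p)" if "p \<in> \<Gamma>" for p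
  proof -
    have "complex_of_real ((norm (fst p))\<^sup>2) = complex_of_real ((norm (snd p))\<^sup>2)"
      using h0[OF that that] by (simp add: h_def cinner_same)
    then show ?thesis by (simp only: of_real_eq_iff) (simp add: power2_eq_iff_nonneg)
  qed
  have np2: "norm p \<le> 2 * norm (fst p)" "norm p \<le> 2 * norm (snd p)" if "p \<in> \<Gamma>" for p
    using norm_Pair_le[of "fst p" "snd p"] eqn[OF that] by simp_all
  have subg: "subspace \<Gamma>" "complete \<Gamma>"
    using sub\<Gamma> by (simp_all add: closed_subspace_def complete_eq_closed)
  \<comment> \<open>Both coordinate projections are bounded below on the complete space \<Gamma>, so
    their images are complete and hence exactly the closed spans.\<close>
  have im: "f ` \<Gamma> = closure (cspan (k ` X))"
    if f: "bounded_linear f" and nf: "\<And>p. p \<in> \<Gamma> \<Longrightarrow> norm p \<le> 2 * norm (f p)"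
      and fD: "\<And>a x. f (a *\<^sub>C e x, a *\<^sub>C e' x) = a *\<^sub>C k x"
    for f :: "'a \<times> 'b \<Rightarrow> 'c::chilbert_space" and k
  proof -
    have "complete (f ` \<Gamma>)"
      by (rule complete_isometric_image[of "1/2", OF _ subg(1) f _ subg(2)]) (use nf in force)+
    then have cs: "closed_subspace (f ` \<Gamma>)"
      using linear_subspace_image[OF bounded_linear.linear[OF f] subg(1)]
      by (simp add: closed_subspace_def complete_imp_closed)
    have "a *\<^sub>C k x \<in> f ` \<Gamma>" if "x \<in> X" for a x
      using fD[of a x] DI[OF that] D\<Gamma> by (metis image_eqI subsetD)
    then have "closure (cspan (k ` X)) \<subseteq> f ` \<Gamma>" by (intro closure_cspan_least[OF cs]) auto
    moreover have "\<Gamma> \<subseteq> f -` closure (cspan (k ` X))"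
      by (rule least[OF closed_subspace_vimage[OF f closed_subspace_closure_cspan]])
        (auto simp: fD intro!: closure_cspan_base elim!: DE)
    ultimately show ?thesis by auto
  qed
  have fstK: "fst ` \<Gamma> = K" unfolding K_def by (rule im[OF bounded_linear_fst]) (simp_all add: np2(1))
  have sndK: "snd ` \<Gamma> = K'" unfolding K'_def by (rule im[OF bounded_linear_snd]) (simp_all add: np2(2))
  have uniq: "w = w'" if "(u, w) \<in> \<Gamma>" "(u, w') \<in> \<Gamma>" for u w w'
    using eqn[of "(u, w) - (u, w')"] subspace_diff[OF subg(1) that] by simp
  have sc0: "\<Gamma> \<subseteq> (\<lambda>p. (a *\<^sub>C fst p, a *\<^sub>C snd p)) -` \<Gamma>" for a
    by (rule least[OF closed_subspace_vimage[OF _ sub\<Gamma>]])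
      (auto intro!: bounded_linear_Pair bounded_linear_compose[OF bounded_linear_scaleC]
        bounded_linear_fst bounded_linear_snd D\<Gamma>[THEN subsetD] DI simp: scaleC_scaleC elim!: DE)
  have sc: "(a *\<^sub>C u, a *\<^sub>C w) \<in> \<Gamma>" if "(u, w) \<in> \<Gamma>" for a u w
    using subsetD[OF sc0 that, of a] by simp
  \<comment> \<open>Composing with the projection makes the isometry total, with value 0 on the
    orthogonal complement, as the convention for \<open>bop\<close> demands.\<close>
  define P where "P = bop_id K"
  define f where "f u = (SOME w. (P u, w) \<in> \<Gamma>)" for u
  have PK: "P u \<in> K" for u unfolding P_def by (rule bopD(2)[OF bop_id_in_bop[OF hK]])
  have f: "(P u, f u) \<in> \<Gamma>" for u
  proof -
    have "\<exists>w. (P u, w) \<in> \<Gamma>" using PK[of u] fstK by force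
    then show ?thesis unfolding f_def by (rule someI_ex)
  qed
  have fI: "f u = w" if "(P u, w) \<in> \<Gamma>" for u w using uniq f that by blast
  have "bounded_linear f"
  proof (rule bounded_linear_intro[where K = 1])
    show "f (u + v) = f u + f v" for u v
      using subspace_add[OF subg(1) f[of u] f[of v]] by (intro fI) (simp add: blinfun.add_right)
    show "f (r *\<^sub>R u) = r *\<^sub>R f u" for r u
      using subspace_scale[OF subg(1) f[of u], of r] by (intro fI) (simp add: blinfun.scaleR_right)
    show "norm (f u) \<le> norm u * 1" for u
      using eqn[OF f[of u]] norm_bop_id_le[OF hK, of u] by (simp add: P_def)
  qed
  then have app: "blinfun_apply (Blinfun f) = f" by (rule bounded_linear_Blinfun_apply)
  show thesis
  proof (rule that[of "Blinfun f"], unfold app, fold K_def K'_def)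
    show "clin (Blinfun f)"
      unfolding clin_def app
      by (auto intro!: fI sc[OF f, unfolded P_def] simp: P_def bopD(4)[OF bop_id_in_bop[OF hK]])
    have P1: "P u = u" if "u \<in> K" for u using that by (simp add: P_def bop_id_apply[OF hK])
    show "f (e x) = e' x" if "x \<in> X" for x
    proof (rule fI)
      have "(e x, e' x) \<in> D" using DI[OF that, of 1] by simp
      moreover have "e x \<in> K"
        unfolding K_def by (rule closure_cspan_superset[THEN subsetD]) (rule imageI[OF that])
      ultimately show "(P (e x), e' x) \<in> \<Gamma>" using D\<Gamma> P1 by auto
    qed
    show "cinner (f u) (f v) = cinner u v" if "u \<in> K" "v \<in> K" for u v
      using h0[OF f[of u] f[of v]] by (simp add: h_def P1 that)
    show fK': "f u \<in> K'" for u using f[of u] sndK by force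
    show "f ` K = K'"
    proof (intro equalityI subsetI)
      fix w assume "w \<in> K'"
      then obtain u where "(u, w) \<in> \<Gamma>" using sndK by force
      moreover have "u \<in> K" using calculation fstK by force
      ultimately show "w \<in> f ` K" using fI[of u w] P1[of u] by force
    qed (auto simp: fK')
    show "f u = 0" if "\<And>v. v \<in> K \<Longrightarrow> cinner v u = 0" for u
    proof (rule fI)
      have "P u = 0" unfolding P_def by (rule bopD(3)[OF bop_id_in_bop[OF hK] that])
      then show "(P u, 0) \<in> \<Gamma>" using subspace_0[OF subg(1)] by (simp add: zero_prod_def)
    qed
  qed
qed

section \<open>Coordinates of Hilbert sums\<close>

lemma ell2_apply_simps [simp]:
  "ell2_apply 0 i = 0" "ell2_apply (f + g) i = ell2_apply f i + ell2_apply g i"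
  "ell2_apply (f - g) i = ell2_apply f i - ell2_apply g i" "ell2_apply (- f) i = - ell2_apply f i"
  "ell2_apply (a *\<^sub>C f) i = a *\<^sub>C ell2_apply f i" "ell2_apply (r *\<^sub>R f) i = r *\<^sub>R ell2_apply f i"
  by (simp_all add: zero_ell2.rep_eq plus_ell2.rep_eq minus_ell2_apply uminus_ell2.rep_eq
    scaleC_ell2.rep_eq scaleR_ell2.rep_eq)

lemma ell2_apply_sum: "ell2_apply (\<Sum>k\<in>K. f k) i = (\<Sum>k\<in>K. ell2_apply (f k) i)"
  by (induction K rule: infinite_finite_induct) auto

lemma cinner_ell2_has_sum:
  "((\<lambda>i. cinner (ell2_apply f i) (ell2_apply g i)) has_sum cinner f g) UNIV"
  unfolding cinner_ell2_def by (intro has_sum_infsum square_summable_cinner ell2_summable)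

definition sproj :: "'i \<Rightarrow> ('i, 'a::chilbert_space) ell2 \<Rightarrow>\<^sub>L 'a" where
  "sproj i = Blinfun (\<lambda>f. ell2_apply f i)"

text \<open>The coordinate embedding. As an adjoint it is bounded and complex linear without a
  computation; \<open>single_apply\<close> identifies its coordinates.\<close>

definition single :: "'i \<Rightarrow> 'a::chilbert_space \<Rightarrow>\<^sub>L ('i, 'a) ell2" where
  "single i = adj (sproj i)"

lemma sproj_apply [simp]: "sproj i f = ell2_apply f i"
  for f :: "('i, 'a::chilbert_space) ell2"
proof -
  have "bounded_linear (\<lambda>f :: ('i, 'a) ell2. ell2_apply f i)"
    by (rule bounded_linear_intro[where K = 1]) (auto simp: norm_ell2_apply_le)
  then show ?thesis by (simp add: sproj_def bounded_linear_Blinfun_apply)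
qed

lemma clin_sproj: "clin (sproj i)" by (simp add: clin_def)

lemma clin_single: "clin (single i)" by (simp add: single_def clin_adj clin_sproj)

lemma adj_single [simp]: "adj (single i) = sproj i" "adj (sproj i) = single i"
  by (simp_all add: single_def)

lemma cinner_single:
  "cinner (single i x) f = cinner x (ell2_apply f i)"
  "cinner f (single i x) = cinner (ell2_apply f i) x"
  using cinner_adj_left[OF clin_sproj, of i x f] cinner_adj_right[OF clin_sproj, of f i x]
  by simp_all

lemma single_apply [simp]: "ell2_apply (single i x) j = (if j = i then x else 0)"
  for i :: 'i and x :: "'a::chilbert_space"
proof -
  have s: "(\<lambda>k. (norm (if k = i then x else 0))\<^sup>2) summable_on UNIV"
  proof -
    have "((\<lambda>k. (norm (if k = i then x else 0))\<^sup>2) has_sum (norm x)\<^sup>2) UNIV"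
      by (rule has_sum_finite_neutralI[of "{i}"]) auto
    then show ?thesis by (rule has_sum_imp_summable)
  qed
  define g where "g = Abs_ell2 (\<lambda>k. if k = i then x else 0)"
  have g: "ell2_apply g = (\<lambda>k. if k = i then x else 0)" unfolding g_def using s by (simp add: Abs_ell2_inverse)
  have "single i x = g"
  proof (rule cinner_eqI)
    fix f :: "('i, 'a) ell2"
    have "((\<lambda>k. cinner (ell2_apply f k) (ell2_apply g k)) has_sum cinner (ell2_apply f i) x) UNIV"
      by (rule has_sum_finite_neutralI[of "{i}"]) (auto simp: g)
    then have "cinner f g = cinner (ell2_apply f i) x"
      using cinner_ell2_has_sum has_sum_unique by blast
    then show "cinner f (single i x) = cinner f g" by (simp add: cinner_single)
  qed
  then show ?thesis by (simp add: g)
qed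

section \<open>Orthonormal bases and tensor products\<close>

text \<open>An orthonormal set that is maximal by Zorn spans densely: otherwise the normalized
  component of some vector orthogonal to its closed span could be added. This makes the choice in
  \<open>onb\<close> meaningful.\<close>

lemma ex_onb: "hilbert V \<Longrightarrow> \<exists>B. is_onb V B" for V :: "'a::chilbert_space set"
proof -
  assume V: "hilbert V"
  define ons where "ons B \<longleftrightarrow> B \<subseteq> V \<and> (\<forall>a\<in>B. \<forall>b\<in>B. cinner a b = (if a = b then 1 else 0))"
    for B :: "'a set"
  have "\<exists>M\<in>Collect ons. \<forall>X\<in>Collect ons. M \<subseteq> X \<longrightarrow> X = M"
  proof (rule subset_Zorn')
    fix C assume C: "subset.chain (Collect ons) C"
    show "\<Union>C \<in> Collect ons"
      unfolding mem_Collect_eq ons_def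
    proof (intro conjI ballI)
      show "\<Union>C \<subseteq> V" using C by (force simp: subset.chain_def ons_def)
      fix a b assume "a \<in> \<Union>C" "b \<in> \<Union>C"
      then obtain A B where "A \<in> C" "B \<in> C" "a \<in> A" "b \<in> B" by auto
      moreover have "A \<subseteq> B \<or> B \<subseteq> A" using C calculation unfolding subset.chain_def by auto
      ultimately obtain D where "D \<in> C" "a \<in> D" "b \<in> D" by auto
      moreover have "ons D" using C calculation unfolding subset.chain_def by auto
      ultimately show "cinner a b = (if a = b then 1 else 0)" by (auto simp: ons_def)
    qed
  qed
  then obtain B where B: "ons B" and max: "\<And>X. ons X \<Longrightarrow> B \<subseteq> X \<Longrightarrow> X = B" by auto
  define K where "K = closure (cspan B)"
  have hK: "hilbert K" unfolding K_def by (rule hilbert_closure_cspan)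
  have KV: "K \<subseteq> V" unfolding K_def using B by (intro hilbert_closure_cspan_least[OF V]) (auto simp: ons_def)
  have "V \<subseteq> K"
  proof
    fix v assume v: "v \<in> V"
    define u where "u = v - bop_id K v"
    have PvK: "bop_id K v \<in> K" by (rule bopD(2)[OF bop_id_in_bop[OF hK]])
    have u0: "cinner k u = 0" if "k \<in> K" for k
      using cinner_bop_id[OF hK that] by (simp add: u_def cinner_diff)
    have "u = 0"
    proof (rule ccontr)
      assume "u \<noteq> 0"
      define w where "w = (1 / norm u) *\<^sub>R u"
      have wV: "w \<in> V" using hilbertD(1)[OF V] v PvK KV
        by (auto simp: w_def u_def intro!: subspace_scale subspace_diff)
      have w0: "cinner k w = 0" "cinner w k = 0" if "k \<in> B" for k
      proof -
        have "k \<in> K" unfolding K_def using closure_cspan_superset that by blast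
        then show "cinner k w = 0" by (simp add: w_def cinner_scaleR u0)
        then show "cinner w k = 0" by (metis cinner_commute complex_cnj_zero)
      qed
      have "norm w = 1" using \<open>u \<noteq> 0\<close> by (simp add: w_def)
      then have w1: "cinner w w = 1" by (simp add: cinner_same)
      have "ons (insert w B)"
        using B wV w0 w1 unfolding ons_def by auto
      then have "w \<in> B" using max by blast
      then show False using w0[of w] w1 by simp
    qed
    then show "v \<in> K" using PvK by (simp add: u_def)
  qed
  then have "is_onb V B" using B KV by (auto simp: is_onb_def ons_def K_def)
  then show ?thesis by blast
qed

lemma onb: "hilbert V \<Longrightarrow> is_onb V (onb V)"
  unfolding onb_def by (rule someI_ex[OF ex_onb])

text \<open>Parseval's identity without series manipulations: the coordinate map is the Gram
  isometry from the basis to the standard unit vectors of the scalar Hilbert sum.\<close>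

lemma onb_expansion:
  assumes V: "hilbert V"
  obtains c :: "'a::chilbert_space \<Rightarrow> ('a, complex) ell2" where
    "\<And>v b. v \<in> V \<Longrightarrow> ell2_apply (c v) b = (if b \<in> onb V then cinner b v else 0)"
    "\<And>v v'. v \<in> V \<Longrightarrow> v' \<in> V \<Longrightarrow> cinner (c v) (c v') = cinner v v'"
proof -
  define B where "B = onb V"
  have B: "is_onb V B" unfolding B_def by (rule onb[OF V])
  have BV: "B \<subseteq> V" and ort: "\<And>a b. a \<in> B \<Longrightarrow> b \<in> B \<Longrightarrow> cinner a b = (if a = b then 1 else 0)"
    and cl: "closure (cspan B) = V"
    using B by (auto simp: is_onb_def)
  define d where "d b = single b (1::complex)" for b :: 'a
  have gram: "cinner (id a) (id b) = cinner (d a) (d b)" if "a \<in> B" "b \<in> B" for a b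
    using that by (simp add: ort d_def cinner_single cinner_complex_def)
  obtain U where
    U: "clin U" "\<And>x. x \<in> B \<Longrightarrow> blinfun_apply U x = d x"
    "\<And>u v. u \<in> V \<Longrightarrow> v \<in> V \<Longrightarrow> cinner (blinfun_apply U u) (blinfun_apply U v) = cinner u v"
    "\<And>u. blinfun_apply U u \<in> closure (cspan (d ` B))"
    by (rule gram_isometry[of B id d, OF gram, unfolded image_id id_apply cl])
      (assumption, assumption, rule that, assumption+)
  show thesis
  proof (rule that[of "blinfun_apply U"])
    fix v b assume v: "v \<in> V"
    show "ell2_apply (U v) b = (if b \<in> onb V then cinner b v else 0)"
    proof (cases "b \<in> B")
      case True
      then have "cinner b v = cinner (d b) (U v)" using U(3)[of b v] U(2)[of b] BV v by auto
      also have "\<dots> = ell2_apply (U v) b" by (simp add: d_def cinner_single cinner_complex_def)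
      finally show ?thesis using True by (simp add: B_def)
    next
      case False
      have "closure (cspan (d ` B)) \<subseteq> {f. sproj b f = 0}"
        by (rule closure_cspan_least[OF closed_subspace_kernel[OF blinfun.bounded_linear_right]])
          (use False in \<open>auto simp: d_def scaleC_simps\<close>)
      then show ?thesis using U(4)[of v] False by (auto simp: B_def)
    qed
  qed (simp add: U)
qed

lemma norm_square_summable_scaleC_const:
  fixes c :: "'i \<Rightarrow> complex" and w :: "'a::chilbert_space"
  assumes "(\<lambda>i. (norm (c i))\<^sup>2) summable_on UNIV"
  shows "(\<lambda>i. (norm (c i *\<^sub>C w))\<^sup>2) summable_on UNIV"
  using summable_on_cmult_left[OF assms, of "(norm w)\<^sup>2"] by (simp add: power_mult_distrib)

lemma tensor_apply:
  assumes "hilbert V" "v \<in> V"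
  shows "ell2_apply (tensor V v w) b = (if b \<in> onb V then cinner b v *\<^sub>C w else 0)"
proof -
  obtain c :: "_ \<Rightarrow> ('a, complex) ell2" where
    c: "\<And>b. ell2_apply (c v) b = (if b \<in> onb V then cinner b v else 0)"
    using onb_expansion[OF assms(1)] assms(2) by metis
  have "(\<lambda>b. (norm (ell2_apply (c v) b *\<^sub>C w))\<^sup>2) summable_on UNIV"
    by (rule norm_square_summable_scaleC_const[OF ell2_summable])
  then have "(\<lambda>b. (norm (if b \<in> onb V then cinner b v *\<^sub>C w else 0))\<^sup>2) summable_on UNIV"
    by (rule summable_on_cong[THEN iffD1, rotated]) (simp add: c scaleC_simps)
  then have "ell2_apply (tensor V v w) = (\<lambda>b. if b \<in> onb V then cinner b v *\<^sub>C w else 0)"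
    unfolding tensor_def by (intro Abs_ell2_inverse) (simp only: mem_Collect_eq)
  then show ?thesis by simp
qed

lemma cinner_tensor:
  assumes "hilbert V" "v \<in> V" "v' \<in> V"
  shows "cinner (tensor V v w) (tensor V v' w') = cinner v v' * cinner w w'"
proof -
  obtain c :: "_ \<Rightarrow> ('a, complex) ell2" where
    c: "\<And>v b. v \<in> V \<Longrightarrow> ell2_apply (c v) b = (if b \<in> onb V then cinner b v else 0)"
    "\<And>v v'. v \<in> V \<Longrightarrow> v' \<in> V \<Longrightarrow> cinner (c v) (c v') = cinner v v'"
    using onb_expansion[OF assms(1)] by metis
  have "((\<lambda>b. cinner (ell2_apply (c v) b) (ell2_apply (c v') b) * cinner w w') has_sum
      cinner (c v) (c v') * cinner w w') UNIV"
    by (intro has_sum_cmult_left cinner_ell2_has_sum)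
  moreover have "cinner (ell2_apply (c v) b) (ell2_apply (c v') b) * cinner w w' =
      cinner (ell2_apply (tensor V v w) b) (ell2_apply (tensor V v' w') b)" for b
    by (simp add: c assms tensor_apply cinner_complex_def cinner_scaleC_left cinner_scaleC_right)
  ultimately have "((\<lambda>b. cinner (ell2_apply (tensor V v w) b) (ell2_apply (tensor V v' w') b)) has_sum
      cinner v v' * cinner w w') UNIV"
    by (simp add: c(2) assms)
  then show ?thesis using cinner_ell2_has_sum has_sum_unique by blast
qed

section \<open>Extension of positive functionals\<close>

text \<open>The functional is given by its graph, a subspace of \<open>X \<times> \<real>\<close>; positivity makes a subspace
  single-valued.\<close>

lemma riesz_extension:
  fixes X P :: "'x::real_vector set" and Gr :: "('x \<times> real) set"
  assumes X: "subspace X"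
    and P0: "0 \<in> P" and Padd: "\<And>x y. x \<in> P \<Longrightarrow> y \<in> P \<Longrightarrow> x + y \<in> P"
    and Pscale: "\<And>x r. x \<in> P \<Longrightarrow> 0 \<le> r \<Longrightarrow> r *\<^sub>R x \<in> P"
    and Gr: "subspace Gr" "fst ` Gr \<subseteq> X" "\<And>x r. (x, r) \<in> Gr \<Longrightarrow> x \<in> P \<Longrightarrow> 0 \<le> r"
    and major: "\<And>x. x \<in> X \<Longrightarrow> \<exists>y r. (y, r) \<in> Gr \<and> y - x \<in> P"
  obtains F :: "'x \<Rightarrow> real" where
    "\<And>x y. x \<in> X \<Longrightarrow> y \<in> X \<Longrightarrow> F (x + y) = F x + F y"
    "\<And>x r. x \<in> X \<Longrightarrow> F (r *\<^sub>R x) = r * F x"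
    "\<And>x. x \<in> X \<Longrightarrow> x \<in> P \<Longrightarrow> 0 \<le> F x"
    "\<And>x r. (x, r) \<in> Gr \<Longrightarrow> F x = r"
proof -
  define A where "A = {M. subspace M \<and> Gr \<subseteq> M \<and> fst ` M \<subseteq> X \<and> (\<forall>x r. (x, r) \<in> M \<longrightarrow> x \<in> P \<longrightarrow> 0 \<le> r)}"
  have "\<exists>M\<in>A. \<forall>Y\<in>A. M \<subseteq> Y \<longrightarrow> Y = M"
  proof (rule subset_Zorn_nonempty)
    have "Gr \<in> A" using Gr by (auto simp: A_def)
    then show "A \<noteq> {}" by blast
    fix C assume ne: "C \<noteq> {}" and C: "subset.chain A C"
    have CA: "C \<subseteq> A" and dir: "\<And>M N. M \<in> C \<Longrightarrow> N \<in> C \<Longrightarrow> M \<subseteq> N \<or> N \<subseteq> M"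
      using C unfolding subset.chain_def by auto
    have "subspace (\<Union>C)"
      unfolding subspace_def
    proof (intro conjI ballI allI)
      obtain M where "M \<in> C" using ne by blast
      then show "0 \<in> \<Union>C" using CA subspace_0[of M] by (auto simp: A_def)
      fix x y c
      assume x: "x \<in> \<Union>C"
      then obtain M where M: "M \<in> C" "x \<in> M" by auto
      then show "c *\<^sub>R x \<in> \<Union>C" using CA by (auto simp: A_def intro: subspace_scale)
      assume "y \<in> \<Union>C"
      then obtain N where N: "N \<in> C" "y \<in> N" by auto
      obtain L where "L \<in> C" "x \<in> L" "y \<in> L" using M N dir[OF M(1) N(1)] by auto
      then show "x + y \<in> \<Union>C" using CA by (auto simp: A_def intro: subspace_add)
    qed
    moreover have "Gr \<subseteq> \<Union>C" using ne CA unfolding A_def by blast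
    moreover have "fst ` \<Union>C \<subseteq> X" using CA unfolding A_def by blast
    moreover have "\<forall>x r. (x, r) \<in> \<Union>C \<longrightarrow> x \<in> P \<longrightarrow> 0 \<le> r" using CA unfolding A_def by blast
    ultimately show "\<Union>C \<in> A" unfolding A_def by simp
  qed
  then obtain M where MA: "M \<in> A" and max: "\<And>Y. Y \<in> A \<Longrightarrow> M \<subseteq> Y \<Longrightarrow> Y = M" by blast
  have M: "subspace M" "Gr \<subseteq> M" "fst ` M \<subseteq> X"
    and pos: "\<And>x r. (x, r) \<in> M \<Longrightarrow> x \<in> P \<Longrightarrow> 0 \<le> r"
    using MA unfolding A_def by blast+
  have "X \<subseteq> fst ` M"
  proof
    fix x0 assume x0: "x0 \<in> X"
    \<comment> \<open>The values of M at elements dominating x0. A value c for x0 must lie below all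
      of them and above -r' whenever y' + x0 is positive; by \<open>low\<close> the infimum
      satisfies both, and \<open>major\<close> at x0 and at -x0 makes it finite.\<close>
    define U where "U = {r. \<exists>y. (y, r) \<in> M \<and> y - x0 \<in> P}"
    have low: "- r' \<le> r" if "r \<in> U" "(y', r') \<in> M" "y' + x0 \<in> P" for r y' r'
    proof -
      obtain y where y: "(y, r) \<in> M" "y - x0 \<in> P" using \<open>r \<in> U\<close> unfolding U_def by blast
      have "(y + y', r + r') \<in> M" using subspace_add[OF M(1) y(1) that(2)] by simp
      moreover have "y + y' \<in> P" using Padd[OF y(2) that(3)] by simp
      ultimately show ?thesis using pos[of "y + y'" "r + r'"] by simp
    qed
    obtain y1 r1 where "(y1, r1) \<in> Gr" "y1 - x0 \<in> P" using major[OF x0] by auto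
    then have Une: "U \<noteq> {}" unfolding U_def using M(2) by auto
    have "- x0 \<in> X" using subspace_neg[OF X x0] .
    then obtain y2 r2 where "(y2, r2) \<in> Gr" "y2 - (- x0) \<in> P" using major by metis
    then have yr2: "(y2, r2) \<in> M" "y2 + x0 \<in> P" using M(2) by auto
    then have bdd: "bdd_below U" using low by (intro bdd_belowI[of _ "- r2"]) auto
    define c where "c = Inf U"
    have c1: "c \<le> r" if "(y, r) \<in> M" "y - x0 \<in> P" for y r
      unfolding c_def using that bdd by (intro cInf_lower) (auto simp: U_def)
    have c2: "- r \<le> c" if "(y, r) \<in> M" "y + x0 \<in> P" for y r
      unfolding c_def using that low Une by (intro cInf_greatest) auto
    define M' where "M' = {z + t *\<^sub>R (x0, c) | z t. z \<in> M}"
    have MM': "M \<subseteq> M'"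
    proof
      fix z assume "z \<in> M" then have "z = z + 0 *\<^sub>R (x0, c)" "z \<in> M" by (auto simp: zero_prod_def)
      then show "z \<in> M'" unfolding M'_def by blast
    qed
    have "M' \<in> A"
      unfolding A_def mem_Collect_eq
    proof (intro conjI allI impI)
      show "subspace M'"
        unfolding subspace_def
      proof (intro conjI ballI allI)
        show "0 \<in> M'" using MM' subspace_0[OF M(1)] by auto
        fix u v and k :: real assume "u \<in> M'" "v \<in> M'"
        then obtain z t z' t' where *: "z \<in> M" "z' \<in> M" "u = z + t *\<^sub>R (x0, c)" "v = z' + t' *\<^sub>R (x0, c)"
          unfolding M'_def by blast
        have "u + v = (z + z') + (t + t') *\<^sub>R (x0, c)" unfolding *(3,4) by (simp add: algebra_simps)
        then show "u + v \<in> M'" unfolding M'_def using subspace_add[OF M(1) *(1,2)] by blast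
        have "k *\<^sub>R u = k *\<^sub>R z + (k * t) *\<^sub>R (x0, c)" unfolding *(3) by (simp add: algebra_simps)
        then show "k *\<^sub>R u \<in> M'" unfolding M'_def using subspace_scale[OF M(1) *(1), of k] by blast
      qed
      show "Gr \<subseteq> M'" using M(2) MM' by blast
      show "fst ` M' \<subseteq> X" using M(3) x0 X unfolding M'_def
        by (auto intro!: subspace_add subspace_scale)
      fix x r assume "(x, r) \<in> M'" and xP: "x \<in> P"
      then obtain y s t where ys: "(y, s) \<in> M" "x = y + t *\<^sub>R x0" "r = s + t * c"
        unfolding M'_def by auto
      \<comment> \<open>Dividing by the absolute value of t reduces positivity of y + t x0 to the
        cases t = 1 and t = -1, which are \<open>c2\<close> and \<open>c1\<close>.\<close>
      consider "t = 0" | "t > 0" | "t < 0" by linarith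
      then show "0 \<le> r"
      proof cases
        case 1 then show ?thesis using pos ys xP by simp
      next
        case 2
        have "(inverse t *\<^sub>R y, inverse t * s) \<in> M" using subspace_scale[OF M(1) ys(1), of "inverse t"] by simp
        moreover have "inverse t *\<^sub>R y + x0 \<in> P"
          using Pscale[OF xP, of "inverse t"] 2 by (simp add: ys(2) scaleR_add_right)
        ultimately have "- (inverse t * s) \<le> c" by (rule c2)
        then have "0 \<le> t * (inverse t * s + c)" using 2 by (intro mult_nonneg_nonneg) auto
        also have "\<dots> = r" using 2 by (simp add: ys(3) algebra_simps)
        finally show ?thesis .
      next
        case 3
        have "(inverse (- t) *\<^sub>R y, inverse (- t) * s) \<in> M" using subspace_scale[OF M(1) ys(1), of "inverse (- t)"] by simp
        moreover have "inverse (- t) *\<^sub>R y - x0 \<in> P"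
          using Pscale[OF xP, of "inverse (- t)"] 3 by (simp add: ys(2) scaleR_add_right)
        ultimately have "c \<le> inverse (- t) * s" by (rule c1)
        then have "0 \<le> (- t) * (inverse (- t) * s - c)" using 3 by (intro mult_nonneg_nonneg) auto
        also have "\<dots> = r" using 3 by (simp add: ys(3) algebra_simps)
        finally show ?thesis .
      qed
    qed
    then have "M' = M" using max MM' by blast
    moreover have "(x0, c) \<in> M'"
    proof -
      have "(x0, c) = 0 + 1 *\<^sub>R (x0, c)" by (simp add: zero_prod_def)
      then show ?thesis unfolding M'_def using subspace_0[OF M(1)] by blast
    qed
    ultimately show "x0 \<in> fst ` M" by force
  qed
  then have "\<exists>r. (x, r) \<in> M" if "x \<in> X" for x using that by force
  then have F: "(x, SOME r. (x, r) \<in> M) \<in> M" if "x \<in> X" for x using someI_ex that by metis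
  have uniq: "r = s" if "(x, r) \<in> M" "(x, s) \<in> M" for x r s
    using subspace_diff[OF M(1) that] subspace_diff[OF M(1) that(2,1)] pos[OF _ P0, of "r - s"] pos[OF _ P0, of "s - r"]
    by simp
  show thesis
  proof (rule that[of "\<lambda>x. SOME r. (x, r) \<in> M"])
    fix x y k r
    show "x \<in> X \<Longrightarrow> x \<in> P \<Longrightarrow> 0 \<le> (SOME r. (x, r) \<in> M)" using F pos by blast
    show "(SOME r. (x, r) \<in> M) = r" if "(x, r) \<in> Gr"
      by (rule uniq[OF F]) (use that M Gr(2) in force)+
    show "(SOME r. (k *\<^sub>R x, r) \<in> M) = k * (SOME r. (x, r) \<in> M)" if "x \<in> X"
      using uniq[OF F[OF subspace_scale[OF X that]]] subspace_scale[OF M(1) F[OF that], of k] by simp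
    show "(SOME r. (x + y, r) \<in> M) = (SOME r. (x, r) \<in> M) + (SOME r. (y, r) \<in> M)" if "x \<in> X" "y \<in> X"
      using uniq[OF F[OF subspace_add[OF X that]]] subspace_add[OF M(1) F[OF that(1)] F[OF that(2)]] by simp
  qed
qed

section \<open>The C*-algebra of a representation\<close>

lemma scaleC_blinfun_simps:
  fixes S T :: "'a::real_normed_vector \<Rightarrow>\<^sub>L 'b::chilbert_space"
  shows "a *\<^sub>C (S + T) = a *\<^sub>C S + a *\<^sub>C T" "a *\<^sub>C b *\<^sub>C T = (a * b) *\<^sub>C T" "1 *\<^sub>C T = T"
    "(a *\<^sub>C T) o\<^sub>L R = a *\<^sub>C (T o\<^sub>L R)" "complex_of_real r *\<^sub>C T = r *\<^sub>R T"
  by (auto intro!: blinfun_eqI simp: blinfun.add_left scaleC_add_right scaleC_scaleC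
    scaleR_scaleC blinfun.scaleR_left)

lemma compose_scaleC: "clin S \<Longrightarrow> S o\<^sub>L (a *\<^sub>C T) = a *\<^sub>C (S o\<^sub>L T)"
  by (rule blinfun_eqI) (simp add: clinD)

lemma bounded_linear_scaleC_blinfun:
  "bounded_linear (\<lambda>T :: 'a::real_normed_vector \<Rightarrow>\<^sub>L 'b::chilbert_space. a *\<^sub>C T)"
proof (rule bounded_linear_intro[where K = "cmod a"])
  fix T :: "'a \<Rightarrow>\<^sub>L 'b"
  show "norm (a *\<^sub>C T) \<le> norm T * cmod a"
  proof (rule norm_blinfun_bound)
    fix x
    have "norm ((a *\<^sub>C T) x) = cmod a * norm (T x)" by simp
    also have "\<dots> \<le> cmod a * (norm T * norm x)" by (intro mult_left_mono norm_blinfun) auto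
    finally show "norm ((a *\<^sub>C T) x) \<le> norm T * cmod a * norm x" by (simp add: mult_ac)
  qed simp
  show "a *\<^sub>C (r *\<^sub>R T) = r *\<^sub>R a *\<^sub>C T" for r
    by (rule blinfun_eqI) (simp add: blinfun.scaleR_left scaleC_simps)
qed (simp add: scaleC_blinfun_simps)

text \<open>Range in V and vanishing on the orthogonal complement amount to P T P = T for the
  projection P onto V; together with complex linearity these are closed linear conditions.\<close>

lemma closed_subspace_bop:
  assumes V: "hilbert V"
  shows "closed_subspace (bop V)"
proof -
  have "bop V = (\<Inter>(a, x)\<in>UNIV. {T. blinfun_apply T (a *\<^sub>C x) - a *\<^sub>C blinfun_apply T x = 0}) \<inter>
      {T. (bop_id V o\<^sub>L T o\<^sub>L bop_id V) - T = 0}" (is "_ = ?A \<inter> ?B")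
  proof (intro equalityI subsetI)
    fix T assume "T \<in> bop V"
    moreover from this have "bop_id V o\<^sub>L T o\<^sub>L bop_id V = T" by (metis bop_comp_id(1,2)[OF V])
    ultimately show "T \<in> ?A \<inter> ?B" by (simp add: bopD(4))
  next
    fix T assume T: "T \<in> ?A \<inter> ?B"
    have eq: "T x = bop_id V (T (bop_id V x))" for x
    proof -
      have "bop_id V o\<^sub>L T o\<^sub>L bop_id V = T" using T by simp
      from arg_cong[OF this, of "\<lambda>R. blinfun_apply R x"] show ?thesis by simp
    qed
    show "T \<in> bop V"
    proof (rule bop_intro)
      show "clin T" using T by (auto simp: clin_def)
      show "T x \<in> V" for x by (subst eq) (rule bopD(2)[OF bop_id_in_bop[OF V]])
      show "T x = 0" if "\<And>v. v \<in> V \<Longrightarrow> cinner v x = 0" for x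
        using bopD(3)[OF bop_id_in_bop[OF V] that] by (subst eq) (simp add: blinfun.zero_right)
    qed
  qed
  moreover have "closed_subspace ?A"
    unfolding split_beta by (intro closed_subspace_INT closed_subspace_kernel bounded_linear_sub
      blinfun.bounded_linear_left bounded_linear_compose[OF bounded_linear_scaleC])
  moreover have "closed_subspace ?B"
    by (intro closed_subspace_kernel bounded_linear_sub bounded_linear_ident
      bounded_linear_compose[OF bounded_bilinear.bounded_linear_left[OF bounded_bilinear_blinfun_compose]]
      bounded_bilinear.bounded_linear_right[OF bounded_bilinear_blinfun_compose])
  ultimately show ?thesis
    by (auto simp: closed_subspace_def intro: subspace_inter)
qed

lemma unitary_repD:
  fixes G (structure)
  assumes "group G" "unitary_rep G V \<rho>"
  shows "hilbert V" "g \<in> carrier G \<Longrightarrow> \<rho> g \<in> bop V"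
    "g \<in> carrier G \<Longrightarrow> h \<in> carrier G \<Longrightarrow> \<rho> (g \<otimes> h) = \<rho> g o\<^sub>L \<rho> h"
    "\<rho> \<one> = bop_id V"
    "g \<in> carrier G \<Longrightarrow> \<rho> g o\<^sub>L \<rho> (inv g) = bop_id V"
    "g \<in> carrier G \<Longrightarrow> adj (\<rho> g) = \<rho> (inv g)"
proof -
  interpret group G by (rule assms(1))
  show V: "hilbert V" and mult: "\<And>g h. g \<in> carrier G \<Longrightarrow> h \<in> carrier G \<Longrightarrow> \<rho> (g \<otimes> h) = \<rho> g o\<^sub>L \<rho> h"
    and bop: "\<And>g. g \<in> carrier G \<Longrightarrow> \<rho> g \<in> bop V"
    using assms(2) by (auto simp: unitary_rep_def unitary_on_def)
  have surj: "blinfun_apply (\<rho> g) ` V = V" and iso: "x \<in> V \<Longrightarrow> y \<in> V \<Longrightarrow> cinner (\<rho> g x) (\<rho> g y) = cinner x y"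
    if "g \<in> carrier G" for g x y
    using assms(2) that by (auto simp: unitary_rep_def unitary_on_def)
  show one: "\<rho> \<one> = bop_id V"
  proof (rule bop_eqI[OF V bop[OF one_closed] bop_id_in_bop[OF V]])
    fix v w assume "w \<in> V"
    then obtain u where u: "u \<in> V" "w = \<rho> \<one> u" using surj[OF one_closed] by auto
    \<comment> \<open>The image of the unit is idempotent and maps V onto V, so it fixes every
      vector of V.\<close>
    have "\<rho> \<one> o\<^sub>L \<rho> \<one> = \<rho> \<one>" using mult[OF one_closed one_closed] by simp
    then have "\<rho> \<one> w = w" using u by (metis blinfun_apply_blinfun_compose)
    then show "cinner v (\<rho> \<one> w) = cinner v (bop_id V w)" by (simp add: bop_id_apply[OF V \<open>w \<in> V\<close>])
  qed
  show inv: "\<rho> g o\<^sub>L \<rho> (inv g) = bop_id V" if "g \<in> carrier G" for g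
    using mult[OF that inv_closed[OF that]] by (simp add: that one)
  show "adj (\<rho> g) = \<rho> (inv g)" if g: "g \<in> carrier G"
  proof (rule adjI)
    fix x y
    let ?P = "blinfun_apply (bop_id V)"
    note PV = bopD(2)[OF bop_id_in_bop[OF V]]
    have Py: "?P y = \<rho> g (\<rho> (inv g) y)" using inv[OF g] by (metis blinfun_apply_blinfun_compose)
    have "cinner (\<rho> g x) y = cinner (\<rho> g x) (?P y)"
      by (simp add: cinner_bop_id[OF V] bopD(2)[OF bop[OF g]])
    also have "\<dots> = cinner (\<rho> g (?P x)) (\<rho> g (\<rho> (inv g) y))"
      by (simp add: Py bop_comp_id(3)[OF V bop[OF g]])
    also have "\<dots> = cinner (?P x) (\<rho> (inv g) y)"
      by (intro iso g PV bopD(2)[OF bop[OF inv_closed[OF g]]])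
    also have "\<dots> = cinner x (\<rho> (inv g) y)"
      by (metis V bopD(2) bop bop_id_in_bop cinner_bop_id cinner_commute g inv_closed)
    finally show "inner (\<rho> g x) y = inner x (\<rho> (inv g) y)" by (metis Re_cinner)
  qed
qed

lemma cstar_rep_props:
  assumes G: "group G" and \<rho>: "unitary_rep G V \<rho>"
  shows "closed_subspace (cstar_rep G \<rho>)" "g \<in> carrier G \<Longrightarrow> \<rho> g \<in> cstar_rep G \<rho>"
    "T \<in> cstar_rep G \<rho> \<Longrightarrow> a *\<^sub>C T \<in> cstar_rep G \<rho>"
    "S \<in> cstar_rep G \<rho> \<Longrightarrow> T \<in> cstar_rep G \<rho> \<Longrightarrow> S o\<^sub>L T \<in> cstar_rep G \<rho>"
    "T \<in> cstar_rep G \<rho> \<Longrightarrow> adj T \<in> cstar_rep G \<rho>"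
    "cstar_rep G \<rho> \<subseteq> bop V"
proof -
  interpret group G by (rule G)
  note u = unitary_repD[OF G \<rho>]
  let ?C = "cstar_rep G \<rho>"
  show cs: "closed_subspace ?C" unfolding cstar_rep_def by (rule closed_subspace_closure_cspan)
  have base: "a *\<^sub>C \<rho> g \<in> ?C" if "g \<in> carrier G" for a g
    unfolding cstar_rep_def by (rule closure_cspan_base) (use that in blast)
  show base1: "\<rho> g \<in> ?C" if "g \<in> carrier G" for g using base[OF that, of 1] by (simp add: scaleC_blinfun_simps)
  note least = closure_cspan_least[of _ "\<rho> ` carrier G", folded cstar_rep_def]
  show sub: "?C \<subseteq> bop V"
    by (rule least[OF closed_subspace_bop]) (auto intro!: bop_closed u)
  have "?C \<subseteq> (\<lambda>T. a *\<^sub>C T) -` ?C" for a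
    by (rule least[OF closed_subspace_vimage[OF bounded_linear_scaleC_blinfun cs]])
      (auto simp: scaleC_blinfun_simps intro: base)
  then show scale: "\<And>a T. T \<in> ?C \<Longrightarrow> a *\<^sub>C T \<in> ?C" by blast
  \<comment> \<open>Products are treated in two stages: the right factor is a generator here and the
    left one arbitrary; the next step releases the right factor.\<close>
  have "?C \<subseteq> (\<lambda>T. T o\<^sub>L \<rho> h) -` ?C" if "h \<in> carrier G" for h
    by (rule least[OF closed_subspace_vimage[OF bounded_bilinear.bounded_linear_left[OF bounded_bilinear_blinfun_compose] cs]])
      (use that in \<open>auto simp: scaleC_blinfun_simps u(3)[symmetric] intro!: base m_closed\<close>)
  then have "?C \<subseteq> (\<lambda>T. S o\<^sub>L T) -` ?C" if "S \<in> ?C" for S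
    by (intro least[OF closed_subspace_vimage[OF bounded_bilinear.bounded_linear_right[OF bounded_bilinear_blinfun_compose] cs]])
      (use that bopD(1)[OF subsetD[OF sub that]] in \<open>auto simp: compose_scaleC intro: scale\<close>)
  then show "S \<in> ?C \<Longrightarrow> T \<in> ?C \<Longrightarrow> S o\<^sub>L T \<in> ?C" by blast
  have "?C \<subseteq> adj -` ?C"
    by (rule least[OF closed_subspace_vimage[OF bounded_linear_adj cs]])
      (auto simp: adj_scaleC bopD(1)[OF u(2)] u(6) intro!: base inv_closed)
  then show "T \<in> ?C \<Longrightarrow> adj T \<in> ?C" by blast
qed

section \<open>Positivity of matrices over a C*-algebra\<close>

text \<open>The group is forgotten: what remains is a unital *-homomorphism from a norm-closed
  operator algebra that contains the identity of B(V). No continuity of \<theta> is postulated;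
  positivity will be derived algebraically.\<close>

locale cstar_hom =
  fixes V :: "'a::chilbert_space set" and W :: "'b::chilbert_space set"
    and C :: "('a \<Rightarrow>\<^sub>L 'a) set" and \<theta> :: "('a \<Rightarrow>\<^sub>L 'a) \<Rightarrow> ('b \<Rightarrow>\<^sub>L 'b)"
  assumes V: "hilbert V" and W: "hilbert W"
    and C_sub: "closed_subspace C" and C_bop: "C \<subseteq> bop V"
    and C_scaleC: "T \<in> C \<Longrightarrow> a *\<^sub>C T \<in> C" and C_mult: "S \<in> C \<Longrightarrow> T \<in> C \<Longrightarrow> S o\<^sub>L T \<in> C"
    and C_adj: "T \<in> C \<Longrightarrow> adj T \<in> C" and C_id: "bop_id V \<in> C"
    and \<theta>_bop: "T \<in> C \<Longrightarrow> \<theta> T \<in> bop W"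
    and \<theta>_add: "S \<in> C \<Longrightarrow> T \<in> C \<Longrightarrow> \<theta> (S + T) = \<theta> S + \<theta> T"
    and \<theta>_scaleC: "T \<in> C \<Longrightarrow> \<theta> (a *\<^sub>C T) = a *\<^sub>C \<theta> T"
    and \<theta>_mult: "S \<in> C \<Longrightarrow> T \<in> C \<Longrightarrow> \<theta> (S o\<^sub>L T) = \<theta> S o\<^sub>L \<theta> T"
    and \<theta>_adj: "T \<in> C \<Longrightarrow> \<theta> (adj T) = adj (\<theta> T)"
    and \<theta>_id: "\<theta> (bop_id V) = bop_id W"

text \<open>Unitality is read off at the unit of the group, where both representations give the
  projection onto their space. The relational form of adjoints in \<open>star_hom\<close> turns into
  an equation because adjoints are unique.\<close>

lemma weakly_contained_cstar_hom:
  assumes G: "group G" and \<rho>: "unitary_rep G V \<rho>" and \<pi>: "unitary_rep G W \<pi>"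
    and wc: "weakly_contained G \<pi> \<rho>"
  obtains \<theta> where "cstar_hom V W (cstar_rep G \<rho>) \<theta>" "\<And>g. g \<in> carrier G \<Longrightarrow> \<theta> (\<rho> g) = \<pi> g"
proof -
  interpret group G by (rule G)
  note u = unitary_repD[OF G \<rho>] and u' = unitary_repD[OF G \<pi>]
  note C = cstar_rep_props[OF G \<rho>] and C' = cstar_rep_props[OF G \<pi>]
  obtain \<theta> where th: "star_hom (cstar_rep G \<rho>) (cstar_rep G \<pi>) \<theta>" and g: "\<And>g. g \<in> carrier G \<Longrightarrow> \<theta> (\<rho> g) = \<pi> g"
    using wc unfolding weakly_contained_def by auto
  have im: "\<theta> T \<in> bop W" if "T \<in> cstar_rep G \<rho>" for T
    using th that C'(6) by (auto simp: star_hom_def)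
  have "cstar_hom V W (cstar_rep G \<rho>) \<theta>"
  proof
    fix T assume T: "T \<in> cstar_rep G \<rho>"
    have "is_adjoint T (adj T)" using bopD(1)[OF subsetD[OF C(6) T]] by (simp add: is_adjoint_adj)
    then have "is_adjoint (\<theta> T) (\<theta> (adj T))" using th T C(5)[OF T] by (simp add: star_hom_def)
    then show "\<theta> (adj T) = adj (\<theta> T)" using im[OF T] by (simp add: is_adjoint_adj bopD(1))
  qed (use th g[OF one_closed] C(2)[OF one_closed] in
      \<open>auto simp: star_hom_def u(4) u'(4) intro: u u' C im C' subsetD[OF C(6)]\<close>)
  then show thesis using g by (rule that)
qed

section \<open>Finite operator matrices, their entries and square roots\<close>

lemma blinfun_compose_simps:
  "(S + T) o\<^sub>L R = (S o\<^sub>L R) + (T o\<^sub>L R)" "P o\<^sub>L (S + T) = (P o\<^sub>L S) + (P o\<^sub>L T)"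
  "(S - T) o\<^sub>L R = (S o\<^sub>L R) - (T o\<^sub>L R)" "P o\<^sub>L (S - T) = (P o\<^sub>L S) - (P o\<^sub>L T)"
  "(r *\<^sub>R S) o\<^sub>L R = r *\<^sub>R (S o\<^sub>L R)" "P o\<^sub>L (r *\<^sub>R S) = r *\<^sub>R (P o\<^sub>L S)"
  for P :: "'c::real_normed_vector \<Rightarrow>\<^sub>L 'd::real_normed_vector"
    and R :: "'a::real_normed_vector \<Rightarrow>\<^sub>L 'b::real_normed_vector"
  by (auto intro!: blinfun_eqI simp: blinfun.bilinear_simps)

lemma inner_single: "inner f (single i x) = inner (ell2_apply f i) x"
  by (metis Re_cinner cinner_single(2))

text \<open>The matrix acts on the Hilbert sum over the whole index type and is zero outside the
  block S. Arbitrary index types are allowed because the indices will be vectors.\<close>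

definition opmat :: "'i set \<Rightarrow> ('i \<Rightarrow> 'i \<Rightarrow> 'a::chilbert_space \<Rightarrow>\<^sub>L 'a) \<Rightarrow> ('i, 'a) ell2 \<Rightarrow>\<^sub>L ('i, 'a) ell2" where
  "opmat S M = (\<Sum>i\<in>S. \<Sum>j\<in>S. single i o\<^sub>L M i j o\<^sub>L sproj j)"

lemma ell2_apply_opmat:
  assumes "finite S"
  shows "ell2_apply (opmat S M f) i =
    (if i \<in> S then \<Sum>j\<in>S. M i j (ell2_apply f j) else 0)"
proof -
  have "ell2_apply (opmat S M f) i =
     (\<Sum>k\<in>S. \<Sum>j\<in>S. if i = k then M k j (ell2_apply f j) else 0)"
    by (simp add: opmat_def blinfun.sum_left ell2_apply_sum)
  also have "\<dots> = (\<Sum>k\<in>S. if i = k then \<Sum>j\<in>S. M k j (ell2_apply f j) else 0)"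
    by (intro sum.cong) auto
  finally show ?thesis using assms by simp
qed

lemma inner_opmat:
  "inner f (opmat S M g) =
    (\<Sum>i\<in>S. \<Sum>j\<in>S. inner (ell2_apply f i) (M i j (ell2_apply g j)))"
  by (simp add: opmat_def blinfun.sum_left inner_sum_right inner_single)

definition entry :: "'i \<Rightarrow> 'i \<Rightarrow> (('i, 'a::chilbert_space) ell2 \<Rightarrow>\<^sub>L ('i, 'a) ell2) \<Rightarrow> 'a \<Rightarrow>\<^sub>L 'a" where
  "entry i j B = sproj i o\<^sub>L B o\<^sub>L single j"

lemma ell2_apply_single_sum:
  "finite S \<Longrightarrow> j \<in> S \<Longrightarrow> (\<Sum>k\<in>S. blinfun_apply (M k) (if k = j then x else 0)) = blinfun_apply (M j) x"
proof -
  assume "finite S" "j \<in> S"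
  moreover have "(\<Sum>k\<in>S. blinfun_apply (M k) (if k = j then x else 0)) =
     (\<Sum>k\<in>S. if k = j then blinfun_apply (M k) x else 0)"
    by (intro sum.cong) (auto simp: blinfun.zero_right)
  ultimately show ?thesis by simp
qed

lemma entry_opmat: "finite S \<Longrightarrow> i \<in> S \<Longrightarrow> j \<in> S \<Longrightarrow> entry i j (opmat S M) = M i j"
  by (rule blinfun_eqI) (simp add: entry_def ell2_apply_opmat ell2_apply_single_sum)

lemma opmat_cong: "(\<And>i j. i \<in> S \<Longrightarrow> j \<in> S \<Longrightarrow> M i j = N i j) \<Longrightarrow> opmat S M = opmat S N"
  unfolding opmat_def by (intro sum.cong) auto

lemma opmat_add: "opmat S M + opmat S N = opmat S (\<lambda>i j. M i j + N i j)"
  unfolding opmat_def by (simp add: sum.distrib[symmetric] blinfun_compose_simps)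

lemma opmat_scaleR: "r *\<^sub>R opmat S M = opmat S (\<lambda>i j. r *\<^sub>R M i j)"
  unfolding opmat_def
  by (simp add: scaleR_sum_right blinfun_compose_simps)

lemma opmat_compose:
  assumes "finite S"
  shows "opmat S M o\<^sub>L opmat S N = opmat S (\<lambda>i j. \<Sum>k\<in>S. M i k o\<^sub>L N k j)"
proof (rule blinfun_eqI, rule ell2_eqI)
  fix f i
  have "(\<Sum>k\<in>S. M i k (\<Sum>j\<in>S. N k j (ell2_apply f j))) = (\<Sum>j\<in>S. \<Sum>k\<in>S. M i k (N k j (ell2_apply f j)))"
    by (simp add: blinfun.sum_right) (rule sum.swap)
  then show "ell2_apply ((opmat S M o\<^sub>L opmat S N) f) i =
    ell2_apply (opmat S (\<lambda>i j. \<Sum>k\<in>S. M i k o\<^sub>L N k j) f) i"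
    using assms by (simp add: ell2_apply_opmat blinfun.sum_left cong: sum.cong if_cong)
qed

lemma adj_opmat: "adj (opmat S M) = opmat S (\<lambda>i j. adj (M j i))"
proof (rule adjI)
  fix f g
  show "inner (opmat S M f) g = inner f (opmat S (\<lambda>i j. adj (M j i)) g)"
    unfolding inner_opmat inner_commute[of "opmat S M f"]
    by (subst sum.swap) (simp add: inner_adj_right inner_commute)
qed

instance chilbert_space \<subseteq> banach ..

text \<open>The square root of \<open>s B\<close> is \<open>Q - c\<close>, where \<open>c\<close> is the fixed point of the contraction
  \<open>c \<mapsto> (Q - s B + c\<^sup>2) / 2\<close>, which preserves the operator algebra \<open>M\<close> with unit \<open>Q\<close>.\<close>

lemma square_root_in_algebra:
  fixes M :: "('a::chilbert_space \<Rightarrow>\<^sub>L 'a) set"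
  assumes M: "closed_subspace M" "\<And>S T. S \<in> M \<Longrightarrow> T \<in> M \<Longrightarrow> S o\<^sub>L T \<in> M"
    and Q: "Q \<in> M" "adj Q = Q" "\<And>T. T \<in> M \<Longrightarrow> Q o\<^sub>L T = T" "\<And>T. T \<in> M \<Longrightarrow> T o\<^sub>L Q = T"
    and B: "B \<in> M" "adj B = B" and e: "0 < e"
    and low: "\<And>f. e * (norm (blinfun_apply Q f))\<^sup>2 \<le> inner f (blinfun_apply B f)"
  obtains b s where "0 < s" "b \<in> M" "adj b = b" "b o\<^sub>L b = s *\<^sub>R B"
proof -
  note sub = M(1)[unfolded closed_subspace_def, THEN conjunct1]
  \<comment> \<open>The summand e makes K positive and at least e, so that d below lies in [0,
    1).\<close>
  define K where "K = norm B + e"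
  have K: "0 < K" using e by (simp add: K_def add_nonneg_pos)
  \<comment> \<open>This s minimizes 1 - 2 s e + s^2 K^2, the bound for the squared norm of Q - s B;
    the minimum is the number d below.\<close>
  define s where "s = e / K\<^sup>2"
  have s: "0 < s" using e K by (simp add: s_def)
  define x where "x = Q - s *\<^sub>R B"
  have xM: "x \<in> M" unfolding x_def by (intro subspace_diff subspace_scale sub Q B)
  have xadj: "adj x = x"
    by (simp add: x_def adj_diff adj_scaleR Q B)
  define d where "d = 1 - e\<^sup>2 / K\<^sup>2"
  have eK: "e \<le> K" by (simp add: K_def)
  have d: "0 \<le> d" "d < 1" using e K power_mono[OF eK, of 2] by (auto simp: d_def field_simps)
  define t where "t = sqrt d"
  have t: "0 \<le> t" "t < 1" using d by (auto simp: t_def real_sqrt_lt_1_iff)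
  have xt: "norm x \<le> t"
  proof (rule norm_blinfun_bound[OF t(1)])
    fix f
    define g where "g = blinfun_apply Q f"
    have Qg: "Q g = g" using arg_cong[OF Q(3)[OF Q(1)], of "\<lambda>R. blinfun_apply R f"] by (simp add: g_def)
    have "x f = x g" using arg_cong[OF Q(4)[OF xM], of "\<lambda>R. blinfun_apply R f"] by (simp add: g_def)
    also have "x g = g - s *\<^sub>R B g" by (simp add: x_def blinfun.diff_left blinfun.scaleR_left Qg)
    finally have xf: "x f = g - s *\<^sub>R B g" .
    have "(norm (x f))\<^sup>2 = (norm g)\<^sup>2 - 2 * s * inner g (B g) + s\<^sup>2 * (norm (B g))\<^sup>2"
      unfolding xf power2_norm_eq_inner
      by (simp add: inner_diff_left inner_diff_right inner_commute power2_eq_square)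
    also have "\<dots> \<le> (norm g)\<^sup>2 - 2 * s * (e * (norm g)\<^sup>2) + s\<^sup>2 * (K * norm g)\<^sup>2"
    proof -
      have "norm (B g) \<le> K * norm g"
        using norm_blinfun[of B g] e mult_right_mono[of "norm B" K "norm g"] by (simp add: K_def)
      then have "(norm (B g))\<^sup>2 \<le> (K * norm g)\<^sup>2" by (rule power_mono) simp
      then have "s\<^sup>2 * (norm (B g))\<^sup>2 \<le> s\<^sup>2 * (K * norm g)\<^sup>2" by (rule mult_left_mono) simp
      moreover have "2 * s * (e * (norm g)\<^sup>2) \<le> 2 * s * inner g (B g)"
        using low[of g] s by (simp add: Qg)
      ultimately show ?thesis by linarith
    qed
    also have "\<dots> = d * (norm g)\<^sup>2"
      using K by (simp add: s_def d_def power2_eq_square field_simps)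
    also have "\<dots> \<le> d * (norm f)\<^sup>2"
      unfolding g_def by (intro mult_left_mono power_mono norm_projection_le Q Q(3)) (use d in auto)
    also have "\<dots> = (t * norm f)\<^sup>2" using d by (simp add: t_def power_mult_distrib)
    finally show "norm (x f) \<le> t * norm f" by (rule power2_le_imp_le) (simp add: t)
  qed
  \<comment> \<open>The smaller root of t + r^2 = 2 r: the map F then preserves the ball of radius
    r, and it is r-Lipschitz there with r < 1.\<close>
  define r where "r = 1 - sqrt (1 - t)"
  have r: "0 \<le> r" "r < 1" "t + r * r = 2 * r"
  proof -
    have "(sqrt (1 - t))\<^sup>2 = 1 - t" using t by simp
    then show "t + r * r = 2 * r" by (simp add: r_def power2_eq_square algebra_simps)
    show "0 \<le> r" "r < 1" using t by (auto simp: r_def)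
  qed
  define Z where "Z = {c \<in> M. adj c = c \<and> norm c \<le> r}"
  define F where "F c = (1/2) *\<^sub>R (x + (c o\<^sub>L c))" for c
  have "closed Z"
  proof -
    have "Z = M \<inter> {c. adj c - c = 0} \<inter> cball 0 r" by (auto simp: Z_def)
    moreover have "closed_subspace {c :: 'a \<Rightarrow>\<^sub>L 'a. adj c - c = 0}"
      by (intro closed_subspace_kernel bounded_linear_sub bounded_linear_adj bounded_linear_ident)
    ultimately show ?thesis using M(1) by (auto simp: closed_subspace_def intro!: closed_Int)
  qed
  moreover have "Z \<noteq> {}"
  proof -
    have "0 \<in> Z" using subspace_0[OF sub] r by (simp add: Z_def)
    then show ?thesis by blast
  qed
  moreover have "F ` Z \<subseteq> Z"
  proof
    fix y assume "y \<in> F ` Z"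
    then obtain c where c: "c \<in> M" "adj c = c" "norm c \<le> r" and y: "y = F c" by (auto simp: Z_def)
    have "norm (c o\<^sub>L c) \<le> r * r"
      using norm_blinfun_compose[of c c] mult_mono[OF c(3) c(3)] r(1) by simp
    then have "norm (x + (c o\<^sub>L c)) \<le> 2 * r"
      using norm_triangle_ineq[of x "c o\<^sub>L c"] xt r(3) by linarith
    moreover have "F c \<in> M" unfolding F_def by (intro subspace_scale subspace_add sub xM M(2) c)
    moreover have "adj (F c) = F c" by (simp add: F_def adj_scaleR adj_add xadj adj_compose c)
    ultimately show "y \<in> Z" by (simp add: y Z_def F_def)
  qed
  moreover have "dist (F c) (F c') \<le> r * dist c c'" if "c \<in> Z" "c' \<in> Z" for c c'
  proof -
    have "F c - F c' = (1/2) *\<^sub>R ((c o\<^sub>L (c - c')) + ((c - c') o\<^sub>L c'))"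
      by (simp add: F_def blinfun_compose_simps algebra_simps)
    also have "norm \<dots> \<le> (1/2) * (norm c * norm (c - c') + norm (c - c') * norm c')"
      by (simp, intro norm_triangle_mono norm_blinfun_compose)
    also have "\<dots> \<le> (1/2) * (r * norm (c - c') + norm (c - c') * r)"
      using that by (intro mult_left_mono add_mono mult_right_mono) (auto simp: Z_def)
    finally show ?thesis by (simp add: dist_norm mult.commute)
  qed
  ultimately have "\<exists>!c\<in>Z. F c = c"
    using r by (intro Banach_fix[of Z r]) (auto simp: complete_eq_closed)
  then obtain c where c: "c \<in> M" "adj c = c" and Fc: "F c = c" by (auto simp: Z_def)
  have cc: "c o\<^sub>L c = 2 *\<^sub>R c - x"
  proof -
    have "2 *\<^sub>R c = x + (c o\<^sub>L c)" using arg_cong[OF Fc, of "\<lambda>y. 2 *\<^sub>R y"] by (simp add: F_def)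
    then show ?thesis by simp
  qed
  show thesis
  proof (rule that[OF s])
    show "Q - c \<in> M" by (intro subspace_diff sub Q c)
    show "adj (Q - c) = Q - c" by (simp add: adj_diff Q c)
    \<comment> \<open>The fixed-point equation reads c^2 = 2 c - x, so the square is Q - 2 c + c^2 =
      Q - x.\<close>
    show "(Q - c) o\<^sub>L (Q - c) = s *\<^sub>R B"
      by (simp add: blinfun_compose_simps Q c cc) (simp add: x_def scaleR_2)
  qed
qed

context cstar_hom begin

lemma C_subspace: "subspace C" using C_sub by (simp add: closed_subspace_def)

lemma theta_scaleR: "T \<in> C \<Longrightarrow> \<theta> (r *\<^sub>R T) = r *\<^sub>R \<theta> T"
  using \<theta>_scaleC[of T "complex_of_real r"] by (simp add: scaleC_blinfun_simps)

lemma theta_zero: "\<theta> 0 = 0"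
  using theta_scaleR[OF C_id, of 0] by simp

lemma theta_sum: "(\<And>k. k \<in> K \<Longrightarrow> T k \<in> C) \<Longrightarrow> \<theta> (\<Sum>k\<in>K. T k) = (\<Sum>k\<in>K. \<theta> (T k))"
  by (induction K rule: infinite_finite_induct)
    (auto simp: theta_zero \<theta>_add C_subspace subspace_sum)

lemma C_unit: "T \<in> C \<Longrightarrow> bop_id V o\<^sub>L T = T" "T \<in> C \<Longrightarrow> T o\<^sub>L bop_id V = T"
  using C_bop bop_comp_id[OF V] by auto

text \<open>The matrix algebra over C supported on S, described through entries rather than as a
  range, so that it is visibly a closed subspace; the fixed point of the square root construction
  then stays inside it.\<close>

definition matalg :: "'i set \<Rightarrow> (('i, 'a) ell2 \<Rightarrow>\<^sub>L ('i, 'a) ell2) set" where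
  "matalg S = {B. (\<forall>i\<in>S. \<forall>j\<in>S. entry i j B \<in> C) \<and> B - opmat S (\<lambda>i j. entry i j B) = 0}"

lemma bounded_linear_entry: "bounded_linear (entry i j)"
  unfolding entry_def
  by (rule bounded_linear_compose[OF bounded_bilinear.bounded_linear_left[OF bounded_bilinear_blinfun_compose]
     bounded_bilinear.bounded_linear_right[OF bounded_bilinear_blinfun_compose]])

lemma opmat_in_matalg:
  assumes "finite S" "\<And>i j. i \<in> S \<Longrightarrow> j \<in> S \<Longrightarrow> M i j \<in> C"
  shows "opmat S M \<in> matalg S"
  using assms by (auto simp: matalg_def entry_opmat intro!: opmat_cong)

lemma closed_subspace_matalg:
  fixes S :: "'i set"
  assumes "finite S" shows "closed_subspace (matalg S)"
proof -
  have "matalg S = (\<Inter>(i, j)\<in>S \<times> S. entry i j -` C) \<inter>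
      {B :: ('i, 'a) ell2 \<Rightarrow>\<^sub>L ('i, 'a) ell2. B - opmat S (\<lambda>i j. entry i j B) = 0}"
    by (auto simp: matalg_def)
  moreover have "closed_subspace (\<Inter>(i, j)\<in>S \<times> S. entry i j -` C)"
    unfolding split_beta by (intro closed_subspace_INT closed_subspace_vimage bounded_linear_entry C_sub)
  moreover have "closed_subspace {B :: ('i, 'a) ell2 \<Rightarrow>\<^sub>L ('i, 'a) ell2. B - opmat S (\<lambda>i j. entry i j B) = 0}"
    unfolding opmat_def
    by (intro closed_subspace_kernel bounded_linear_sub bounded_linear_ident bounded_linear_sum
       bounded_linear_compose[OF bounded_bilinear.bounded_linear_left[OF bounded_bilinear_blinfun_compose]]
       bounded_linear_compose[OF bounded_bilinear.bounded_linear_right[OF bounded_bilinear_blinfun_compose]]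
       bounded_linear_entry)
  ultimately show ?thesis
    by (auto simp: closed_subspace_def intro!: subspace_inter closed_Int)
qed

lemma matalg_eq: "B \<in> matalg S \<Longrightarrow> B = opmat S (\<lambda>i j. entry i j B)"
  by (simp add: matalg_def)

lemma matalg_entry: "B \<in> matalg S \<Longrightarrow> i \<in> S \<Longrightarrow> j \<in> S \<Longrightarrow> entry i j B \<in> C"
  by (simp add: matalg_def)

text \<open>After a perturbation by e times the unit Q the matrix is, up to a positive factor, the
  square of a self-adjoint matrix with entries in C, and \<theta> applied to the entries turns this
  square into a sum of squared norms. Positivity refers to the real part of the quadratic form, so A
  itself need not be self-adjoint.\<close>

lemma theta_matrix_nonneg:
  fixes S :: "'i set" and \<xi> :: "'i \<Rightarrow> 'b"
  assumes S: "finite S" and A: "\<And>i j. i \<in> S \<Longrightarrow> j \<in> S \<Longrightarrow> A i j \<in> C"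
    and pos: "\<And>f. 0 \<le> inner f (opmat S A f)"
  shows "0 \<le> (\<Sum>i\<in>S. \<Sum>j\<in>S. inner (\<xi> i) (\<theta> (A i j) (\<xi> j)))" (is "0 \<le> ?s A")
proof -
  \<comment> \<open>Twice the self-adjoint part of A; the real quadratic form only doubles.\<close>
  define H where "H i j = A i j + adj (A j i)" for i j
  have HC: "H i j \<in> C" if "i \<in> S" "j \<in> S" for i j
    unfolding H_def using that by (intro subspace_add C_subspace A C_adj)
  have adjH: "adj (H j i) = H i j" for i j by (simp add: H_def adj_add add.commute)
  define p where "p = bop_id V"
  define Q where "Q = opmat S (\<lambda>i j. if i = j then p else 0)"
  have pC: "(if i = j then p else 0) \<in> C" for i j :: 'i using C_id subspace_0[OF C_subspace] by (simp add: p_def)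
  have sum_delta: "(\<Sum>k\<in>S. (if i = k then p else 0) o\<^sub>L N k) = p o\<^sub>L N i"
    "(\<Sum>k\<in>S. N k o\<^sub>L (if k = i then p else 0)) = N i o\<^sub>L p" if "i \<in> S" for i and N :: "'i \<Rightarrow> 'a \<Rightarrow>\<^sub>L 'a"
  proof -
    have "(\<Sum>k\<in>S. (if i = k then p else 0) o\<^sub>L N k) = (\<Sum>k\<in>S. if i = k then p o\<^sub>L N k else 0)"
      by (intro sum.cong) (auto intro!: blinfun_eqI)
    then show "(\<Sum>k\<in>S. (if i = k then p else 0) o\<^sub>L N k) = p o\<^sub>L N i" using S that by simp
    have "(\<Sum>k\<in>S. N k o\<^sub>L (if k = i then p else 0)) = (\<Sum>k\<in>S. if k = i then N k o\<^sub>L p else 0)"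
      by (intro sum.cong) (auto intro!: blinfun_eqI simp: blinfun.zero_right)
    then show "(\<Sum>k\<in>S. N k o\<^sub>L (if k = i then p else 0)) = N i o\<^sub>L p" using S that by simp
  qed
  have Qm: "Q \<in> matalg S" unfolding Q_def by (intro opmat_in_matalg S pC)
  have Q1: "Q o\<^sub>L T = T" "T o\<^sub>L Q = T" if "T \<in> matalg S" for T
  proof -
    have "Q o\<^sub>L T = opmat S (\<lambda>i j. \<Sum>k\<in>S. (if i = k then p else 0) o\<^sub>L entry k j T)"
      unfolding Q_def by (subst matalg_eq[OF that]) (rule opmat_compose[OF S])
    also have "\<dots> = opmat S (\<lambda>i j. entry i j T)"
      using matalg_entry[OF that] by (intro opmat_cong) (simp add: sum_delta p_def C_unit)
    finally show "Q o\<^sub>L T = T" using matalg_eq[OF that] by simp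
    have "T o\<^sub>L Q = opmat S (\<lambda>i j. \<Sum>k\<in>S. entry i k T o\<^sub>L (if k = j then p else 0))"
      unfolding Q_def by (subst matalg_eq[OF that]) (rule opmat_compose[OF S])
    also have "\<dots> = opmat S (\<lambda>i j. entry i j T)"
      using matalg_entry[OF that] by (intro opmat_cong) (simp add: sum_delta p_def C_unit)
    finally show "T o\<^sub>L Q = T" using matalg_eq[OF that] by simp
  qed
  have Qadj: "adj Q = Q"
    unfolding Q_def adj_opmat by (intro opmat_cong) (auto simp: p_def adj_bop_id[OF V])
  have mult: "S1 o\<^sub>L T1 \<in> matalg S" if "S1 \<in> matalg S" "T1 \<in> matalg S" for S1 T1
    apply (subst matalg_eq[OF that(1)], subst matalg_eq[OF that(2)])
    unfolding opmat_compose[OF S]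
    using that by (intro opmat_in_matalg S subspace_sum C_subspace C_mult) (auto intro: matalg_entry)
  have eps: "- (e * (\<Sum>i\<in>S. (norm (\<xi> i))\<^sup>2)) \<le> ?s H" if e: "0 < e" for e
  proof -
    \<comment> \<open>The added multiple of the unit provides the strict lower bound that the square
      root requires.\<close>
    define N where "N i j = H i j + e *\<^sub>R (if i = j then p else 0)" for i j
    define B where "B = opmat S N"
    have NC: "N i j \<in> C" if "i \<in> S" "j \<in> S" for i j
      unfolding N_def using that pC by (intro subspace_add subspace_scale C_subspace HC)
    have Bm: "B \<in> matalg S" unfolding B_def using NC by (intro opmat_in_matalg S)
    have Badj: "adj B = B"
      unfolding B_def adj_opmat
      by (intro opmat_cong) (auto simp: N_def adj_add adjH adj_scaleR p_def adj_bop_id[OF V])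
    have Bsplit: "B = opmat S A + adj (opmat S A) + e *\<^sub>R Q"
      unfolding B_def Q_def adj_opmat opmat_scaleR opmat_add by (rule opmat_cong) (simp add: N_def H_def)
    have low: "e * (norm (Q f))\<^sup>2 \<le> inner f (B f)" for f
    proof -
      have "inner f (Q f) = (norm (Q f))\<^sup>2" by (rule inner_projection[OF Qadj Q1(1)[OF Qm]])
      then show ?thesis using pos[of f] inner_adj_right[of f "opmat S A" f] inner_commute[of f "opmat S A f"]
        by (simp add: Bsplit blinfun.add_left blinfun.scaleR_left inner_add_right)
    qed
    obtain b s where b: "0 < s" "b \<in> matalg S" "adj b = b" "b o\<^sub>L b = s *\<^sub>R B"
      using square_root_in_algebra[OF closed_subspace_matalg[OF S] mult Qm Qadj Q1 Bm Badj e low] by blast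
    define \<beta> where "\<beta> i j = entry i j b" for i j
    have \<beta>C: "\<beta> i j \<in> C" if "i \<in> S" "j \<in> S" for i j unfolding \<beta>_def by (rule matalg_entry[OF b(2) that])
    have b\<beta>: "b = opmat S \<beta>" unfolding \<beta>_def by (rule matalg_eq[OF b(2)])
    have \<beta>adj: "adj (\<beta> i j) = \<beta> j i" if "i \<in> S" "j \<in> S" for i j
    proof -
      have "\<beta> j i = entry j i (adj b)" by (simp add: \<beta>_def b(3))
      also have "\<dots> = adj (\<beta> i j)" unfolding b\<beta> adj_opmat using that by (simp add: entry_opmat S)
      finally show ?thesis by simp
    qed
    have eq: "s *\<^sub>R N i j = (\<Sum>k\<in>S. \<beta> i k o\<^sub>L \<beta> k j)" if "i \<in> S" "j \<in> S" for i j
    proof -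
      have "opmat S (\<lambda>i j. s *\<^sub>R N i j) = opmat S (\<lambda>i j. \<Sum>k\<in>S. \<beta> i k o\<^sub>L \<beta> k j)"
        using b(4) unfolding B_def b\<beta> opmat_compose[OF S] opmat_scaleR by simp
      from arg_cong[OF this, of "entry i j"] show ?thesis using that by (simp add: entry_opmat S)
    qed
    \<comment> \<open>Since b is self-adjoint, \<beta> i k is the adjoint of \<beta> k i; summing
      over i and j leaves, for each k, the squared norm of one vector.\<close>
    have th: "s * inner (\<xi> i) (\<theta> (N i j) (\<xi> j)) = (\<Sum>k\<in>S. inner (\<theta> (\<beta> k i) (\<xi> i)) (\<theta> (\<beta> k j) (\<xi> j)))"
      if ij: "i \<in> S" "j \<in> S" for i j
    proof -
      have "s *\<^sub>R \<theta> (N i j) = (\<Sum>k\<in>S. \<theta> (\<beta> i k) o\<^sub>L \<theta> (\<beta> k j))"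
        unfolding theta_scaleR[OF NC[OF ij], symmetric] eq[OF ij]
        using ij by (subst theta_sum) (auto intro!: sum.cong C_mult \<beta>C \<theta>_mult)
      then have "s * inner (\<xi> i) (\<theta> (N i j) (\<xi> j)) = inner (\<xi> i) ((\<Sum>k\<in>S. \<theta> (\<beta> i k) o\<^sub>L \<theta> (\<beta> k j)) (\<xi> j))"
        by (metis blinfun.scaleR_left inner_scaleR_right)
      also have "\<dots> = (\<Sum>k\<in>S. inner (\<xi> i) (\<theta> (\<beta> i k) (\<theta> (\<beta> k j) (\<xi> j))))"
        by (simp add: blinfun.sum_left inner_sum_right)
      also have "\<dots> = (\<Sum>k\<in>S. inner (\<theta> (\<beta> k i) (\<xi> i)) (\<theta> (\<beta> k j) (\<xi> j)))"
      proof (rule sum.cong[OF refl])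
        fix k assume k: "k \<in> S"
        have "\<theta> (\<beta> i k) = adj (\<theta> (\<beta> k i))" using \<theta>_adj[OF \<beta>C] \<beta>adj k ij by metis
        then show "inner (\<xi> i) (\<theta> (\<beta> i k) (\<theta> (\<beta> k j) (\<xi> j))) = inner (\<theta> (\<beta> k i) (\<xi> i)) (\<theta> (\<beta> k j) (\<xi> j))"
          by (simp add: inner_adj_right)
      qed
      finally show ?thesis .
    qed
    have "s * ?s N = (\<Sum>i\<in>S. \<Sum>j\<in>S. \<Sum>k\<in>S. inner (\<theta> (\<beta> k i) (\<xi> i)) (\<theta> (\<beta> k j) (\<xi> j)))"
      by (simp add: sum_distrib_left th)
    also have "\<dots> = (\<Sum>i\<in>S. \<Sum>k\<in>S. \<Sum>j\<in>S. inner (\<theta> (\<beta> k i) (\<xi> i)) (\<theta> (\<beta> k j) (\<xi> j)))"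
      by (intro sum.cong refl sum.swap)
    also have "\<dots> = (\<Sum>k\<in>S. \<Sum>i\<in>S. \<Sum>j\<in>S. inner (\<theta> (\<beta> k i) (\<xi> i)) (\<theta> (\<beta> k j) (\<xi> j)))"
      by (rule sum.swap)
    also have "\<dots> = (\<Sum>k\<in>S. inner (\<Sum>i\<in>S. \<theta> (\<beta> k i) (\<xi> i)) (\<Sum>j\<in>S. \<theta> (\<beta> k j) (\<xi> j)))"
      by (simp only: inner_sum_left) (simp only: inner_sum_right)
    also have "\<dots> \<ge> 0" by (intro sum_nonneg) simp
    finally have N0: "0 \<le> ?s N" using b(1) by (simp add: zero_le_mult_iff)
    have "?s N = ?s H + (\<Sum>i\<in>S. \<Sum>j\<in>S. if i = j then e * inner (\<xi> i) (bop_id W (\<xi> j)) else 0)"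
      unfolding sum.distrib[symmetric]
    proof (intro sum.cong refl)
      fix i j assume "i \<in> S" "j \<in> S"
      then show "inner (\<xi> i) (\<theta> (N i j) (\<xi> j)) =
        inner (\<xi> i) (\<theta> (H i j) (\<xi> j)) + (if i = j then e * inner (\<xi> i) (bop_id W (\<xi> j)) else 0)"
        using HC[of i j] C_id subspace_scale[OF C_subspace C_id, of e]
        by (auto simp: N_def p_def \<theta>_add theta_scaleR \<theta>_id blinfun.add_left blinfun.scaleR_left inner_add_right)
    qed
    also have "\<dots> = ?s H + e * (\<Sum>i\<in>S. inner (\<xi> i) (bop_id W (\<xi> i)))"
      using S by (simp add: sum_distrib_left)
    also have "\<dots> \<le> ?s H + e * (\<Sum>i\<in>S. (norm (\<xi> i))\<^sup>2)"
    proof -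
      have "inner (\<xi> i) (bop_id W (\<xi> i)) \<le> (norm (\<xi> i))\<^sup>2" for i
        by (simp add: inner_bop_id_same[OF W] norm_bop_id_le[OF W] power_mono)
      then show ?thesis using e by (intro add_left_mono mult_left_mono sum_mono) auto
    qed
    finally show ?thesis using N0 by linarith
  qed
  have "0 \<le> ?s H"
  proof (rule ccontr)
    assume neg: "\<not> 0 \<le> ?s H"
    define n where "n = (\<Sum>i\<in>S. (norm (\<xi> i))\<^sup>2)"
    have n: "0 \<le> n" unfolding n_def by (rule sum_nonneg) simp
    \<comment> \<open>With this choice e n is at most half of -(?s H), against the lower bound
      \<open>eps\<close>; the summand 1 keeps the denominator positive when all vectors
      vanish.\<close>
    define e where "e = (- ?s H) / (2 * (n + 1))"
    have e: "0 < e" using neg n unfolding e_def by (intro divide_pos_pos) auto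
    have "e * n \<le> e * (n + 1)" using e by (intro mult_left_mono) auto
    also have "\<dots> = (- ?s H) / 2" using n by (simp add: e_def field_simps)
    finally show False using eps[OF e, folded n_def] neg by linarith
  qed
  also have "?s H = 2 * ?s A"
  proof -
    have "?s H = (\<Sum>i\<in>S. \<Sum>j\<in>S. inner (\<xi> i) (\<theta> (A i j) (\<xi> j)) + inner (\<xi> j) (\<theta> (A j i) (\<xi> i)))"
    proof (intro sum.cong refl)
      fix i j assume ij: "i \<in> S" "j \<in> S"
      show "inner (\<xi> i) (\<theta> (H i j) (\<xi> j)) = inner (\<xi> i) (\<theta> (A i j) (\<xi> j)) + inner (\<xi> j) (\<theta> (A j i) (\<xi> i))"
        using ij A[of i j] A[of j i] C_adj[of "A j i"] inner_commute[of "\<xi> j" "\<theta> (A j i) (\<xi> i)"]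
        by (simp add: H_def \<theta>_add \<theta>_adj blinfun.add_left inner_add_right inner_adj_right)
    qed
    also have "\<dots> = ?s A + (\<Sum>i\<in>S. \<Sum>j\<in>S. inner (\<xi> j) (\<theta> (A j i) (\<xi> i)))"
      by (simp add: sum.distrib)
    also have "(\<Sum>i\<in>S. \<Sum>j\<in>S. inner (\<xi> j) (\<theta> (A j i) (\<xi> i))) = ?s A" by (rule sum.swap)
    finally show ?thesis by simp
  qed
  finally show ?thesis by simp
qed

end

section \<open>Completely positive extension\<close>

text \<open>Padding with zeros lets two finite matrices share an index set, so that they can be
  added.\<close>

lemma opmat_mono:
  assumes "finite S'" "S \<subseteq> S'"
  shows "opmat S M = opmat S' (\<lambda>i j. if i \<in> S \<and> j \<in> S then M i j else 0)"
proof (rule blinfun_eqI, rule ell2_eqI)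
  fix f i
  have S: "finite S" using assms finite_subset by blast
  have "(\<Sum>j\<in>S. M i j (ell2_apply f j)) = (\<Sum>j\<in>S'. (if i \<in> S \<and> j \<in> S then M i j else 0) (ell2_apply f j))"
    if "i \<in> S"
    using assms that by (intro sum.mono_neutral_cong_left) auto
  moreover have "(\<Sum>j\<in>S'. (if i \<in> S \<and> j \<in> S then M i j else 0) (ell2_apply f j)) = 0" if "i \<notin> S"
    using that by simp
  ultimately show "ell2_apply (opmat S M f) i = ell2_apply (opmat S' (\<lambda>i j. if i \<in> S \<and> j \<in> S then M i j else 0) f) i"
    using assms by (auto simp: ell2_apply_opmat S)
qed

lemma single_compose_sproj_opmat:
  assumes "finite S" "k \<in> S" "l \<in> S"
  shows "single k o\<^sub>L T o\<^sub>L sproj l = opmat S (\<lambda>i j. if i = k \<and> j = l then T else 0)"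
proof (rule blinfun_eqI, rule ell2_eqI)
  fix f i
  have "(\<Sum>j\<in>S. (if i = k \<and> j = l then T else 0) (ell2_apply f j)) = (\<Sum>j\<in>S. if j = l then (if i = k then T (ell2_apply f l) else 0) else 0)"
    by (intro sum.cong) auto
  then show "ell2_apply ((single k o\<^sub>L T o\<^sub>L sproj l) f) i = ell2_apply (opmat S (\<lambda>i j. if i = k \<and> j = l then T else 0) f) i"
    using assms by (auto simp: ell2_apply_opmat)
qed

text \<open>The finitely supported matrices over D: the space on which the positive functional is
  extended, with the vectors of the target space as index type.\<close>

definition finmat :: "'i itself \<Rightarrow> ('a::chilbert_space \<Rightarrow>\<^sub>L 'a) set \<Rightarrow> (('i, 'a) ell2 \<Rightarrow>\<^sub>L ('i, 'a) ell2) set" where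
  "finmat _ D = {opmat S M | S M. finite S \<and> (\<forall>i j. M i j \<in> D)}"

lemma subspace_finmat:
  assumes D: "subspace D"
  shows "subspace (finmat TYPE('i) D)"
  unfolding subspace_def
proof (intro conjI ballI allI)
  have "0 = opmat {} (\<lambda>_ _. 0)" by (simp add: opmat_def)
  then show "0 \<in> finmat TYPE('i) D" unfolding finmat_def using subspace_0[OF D]
    by (auto intro!: exI[of _ "{}"] exI[of _ "\<lambda>_ _. 0"])
  fix x y and c :: real assume "x \<in> finmat TYPE('i) D" "y \<in> finmat TYPE('i) D"
  then obtain S M S' M' where x: "finite S" "x = opmat S M" "\<And>i j. M i j \<in> D"
    and y: "finite S'" "y = opmat S' M'" "\<And>i j. M' i j \<in> D"
    unfolding finmat_def by blast
  have "x + y = opmat (S \<union> S') (\<lambda>i j. (if i \<in> S \<and> j \<in> S then M i j else 0) + (if i \<in> S' \<and> j \<in> S' then M' i j else 0))"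
    unfolding x(2) y(2) using x(1) y(1)
    by (simp only: opmat_mono[of "S \<union> S'" S] opmat_mono[of "S \<union> S'" S'] opmat_add finite_Un Un_upper1 Un_upper2 simp_thms)
  moreover have "(if i \<in> S \<and> j \<in> S then M i j else 0) + (if i \<in> S' \<and> j \<in> S' then M' i j else 0) \<in> D" for i j
    using x(3) y(3) subspace_0[OF D] by (intro subspace_add[OF D]) auto
  ultimately show "x + y \<in> finmat TYPE('i) D" unfolding finmat_def using x(1) y(1) by blast
  have "c *\<^sub>R x = opmat S (\<lambda>i j. c *\<^sub>R M i j)" by (simp add: x(2) opmat_scaleR)
  then show "c *\<^sub>R x \<in> finmat TYPE('i) D"
    unfolding finmat_def using x(1) subspace_scale[OF D x(3)] by blast
qed

lemma single_compose_sproj_finmat: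
  fixes k l :: 'i
  assumes "subspace D" "T \<in> D"
  shows "single k o\<^sub>L T o\<^sub>L sproj l \<in> finmat TYPE('i) D"
proof -
  have "single k o\<^sub>L T o\<^sub>L sproj l = opmat {k, l} (\<lambda>i j. if i = k \<and> j = l then T else 0)"
    by (rule single_compose_sproj_opmat) auto
  moreover have "(if i = k \<and> j = l then T else 0) \<in> D" for i j
    using assms subspace_0 by auto
  ultimately show ?thesis unfolding finmat_def by (auto intro!: exI[of _ "{k, l}"])
qed

lemma additive_on_subspace_sum:
  fixes F :: "'x::real_vector \<Rightarrow> real"
  assumes X: "subspace X" and F: "\<And>x y. x \<in> X \<Longrightarrow> y \<in> X \<Longrightarrow> F (x + y) = F x + F y"
    "\<And>x r. x \<in> X \<Longrightarrow> F (r *\<^sub>R x) = r * F x"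
    and g: "\<And>k. k \<in> K \<Longrightarrow> g k \<in> X"
  shows "F (\<Sum>k\<in>K. g k) = (\<Sum>k\<in>K. F (g k))"
proof -
  have "F 0 = 0" using F(2)[OF subspace_0[OF X], of 0] by simp
  then show ?thesis using g
    by (induction K rule: infinite_finite_induct) (auto simp: F(1) subspace_sum[OF X])
qed

context cstar_hom begin

text \<open>\<open>q T \<xi> \<eta>\<close> will be the real part of \<open>\<langle>\<xi>, \<Phi>(T) \<eta>\<rangle>\<close>. It is obtained by extending a positive
  functional on matrices indexed by the vectors of the target space.\<close>

lemma ex_positive_form:
  obtains q :: "('a \<Rightarrow>\<^sub>L 'a) \<Rightarrow> 'b \<Rightarrow> 'b \<Rightarrow> real" where
    "\<And>S T \<xi> \<eta>. S \<in> bop V \<Longrightarrow> T \<in> bop V \<Longrightarrow> q (S + T) \<xi> \<eta> = q S \<xi> \<eta> + q T \<xi> \<eta>"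
    "\<And>r T \<xi> \<eta>. T \<in> bop V \<Longrightarrow> q (r *\<^sub>R T) \<xi> \<eta> = r * q T \<xi> \<eta>"
    "\<And>a \<xi> \<eta>. a \<in> C \<Longrightarrow> q a \<xi> \<eta> = inner \<xi> (\<theta> a \<eta>)"
    "\<And>n T \<xi>. (\<And>i j. i < n \<Longrightarrow> j < n \<Longrightarrow> T i j \<in> bop V) \<Longrightarrow>
      (\<And>x. 0 \<le> (\<Sum>i<n. \<Sum>j<n. inner (x i) (T i j (x j)))) \<Longrightarrow>
      0 \<le> (\<Sum>i<(n::nat). \<Sum>j<n. q (T i j) (\<xi> i) (\<xi> j))"
proof -
  have subV: "subspace (bop V)" using closed_subspace_bop[OF V] by (simp add: closed_subspace_def)
  define X where "X = finmat TYPE('b) (bop V)"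
  have X: "subspace X" unfolding X_def by (rule subspace_finmat[OF subV])
  \<comment> \<open>Only the real quadratic form is tested, so a skew-adjoint matrix lies in both P
    and its negative. Symmetry of the form q is deduced from this later.\<close>
  define P where "P = {B :: ('b, 'a) ell2 \<Rightarrow>\<^sub>L ('b, 'a) ell2. \<forall>f. 0 \<le> inner f (blinfun_apply B f)}"
  \<comment> \<open>The indices are used twice, as matrix positions and as the vectors paired with
    the entries.\<close>
  define val where "val S M = (\<Sum>i\<in>S. \<Sum>j\<in>S. inner i (\<theta> (M i j) j))"
    for S and M :: "'b \<Rightarrow> 'b \<Rightarrow> 'a \<Rightarrow>\<^sub>L 'a"
  define Gr where "Gr = {(opmat S M, val S M) | S M. finite S \<and> (\<forall>i j. M i j \<in> C)}"
  have val_mono: "val S M = val S' (\<lambda>i j. if i \<in> S \<and> j \<in> S then M i j else 0)"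
    if "finite S'" "S \<subseteq> S'" for S S' M
  proof -
    have S: "finite S" using that finite_subset by blast
    have "val S' (\<lambda>i j. if i \<in> S \<and> j \<in> S then M i j else 0) =
      (\<Sum>i\<in>S'. \<Sum>j\<in>S'. if i \<in> S then if j \<in> S then inner i (\<theta> (M i j) j) else 0 else 0)"
      unfolding val_def by (intro sum.cong refl) (auto simp: theta_zero)
    also have "\<dots> = (\<Sum>i\<in>S'. if i \<in> S then \<Sum>j\<in>S'. if j \<in> S then inner i (\<theta> (M i j) j) else 0 else 0)"
      by (intro sum.cong refl) auto
    also have "\<dots> = val S M"
      unfolding val_def using that by (simp add: sum.inter_restrict[symmetric] Int_absorb1)
    finally show ?thesis by simp
  qed
  have pos: "0 \<le> r" if "(B, r) \<in> Gr" "B \<in> P" for B r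
    using that theta_matrix_nonneg[of _ _ "\<lambda>i. i"] unfolding Gr_def P_def val_def by auto
  have Gr: "subspace Gr"
    unfolding subspace_def
  proof (intro conjI ballI allI)
    have "0 = (opmat {} (\<lambda>_ _. 0), val {} (\<lambda>_ _. 0))" by (simp add: opmat_def val_def zero_prod_def)
    then show "0 \<in> Gr" unfolding Gr_def using subspace_0[OF C_subspace] by blast
    fix x y and c :: real assume "x \<in> Gr" "y \<in> Gr"
    then obtain S M S' M' where x: "finite S" "x = (opmat S M, val S M)" "\<And>i j. M i j \<in> C"
      and y: "finite S'" "y = (opmat S' M', val S' M')" "\<And>i j. M' i j \<in> C"
      unfolding Gr_def by blast
    define N where "N i j = (if i \<in> S \<and> j \<in> S then M i j else 0)" for i j
    define N' where "N' i j = (if i \<in> S' \<and> j \<in> S' then M' i j else 0)" for i j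
    have NC: "N i j \<in> C" "N' i j \<in> C" for i j
      using x(3) y(3) subspace_0[OF C_subspace] by (auto simp: N_def N'_def)
    have "x = (opmat (S \<union> S') N, val (S \<union> S') N)" "y = (opmat (S \<union> S') N', val (S \<union> S') N')"
      unfolding x(2) y(2) N_def N'_def using x(1) y(1) by (auto intro!: opmat_mono val_mono)
    then have "x + y = (opmat (S \<union> S') (\<lambda>i j. N i j + N' i j), val (S \<union> S') (\<lambda>i j. N i j + N' i j))"
      by (simp add: opmat_add val_def \<theta>_add NC blinfun.add_left inner_add_right sum.distrib)
    then show "x + y \<in> Gr" unfolding Gr_def using x(1) y(1) NC subspace_add[OF C_subspace] by blast
    have "c *\<^sub>R x = (opmat S (\<lambda>i j. c *\<^sub>R M i j), val S (\<lambda>i j. c *\<^sub>R M i j))"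
      by (simp add: x(2) opmat_scaleR val_def theta_scaleR x(3) blinfun.scaleR_left sum_distrib_left)
    then show "c *\<^sub>R x \<in> Gr" unfolding Gr_def using x(1) x(3) subspace_scale[OF C_subspace] by blast
  qed
  have GrX: "fst ` Gr \<subseteq> X"
  proof
    fix x assume "x \<in> fst ` Gr"
    then obtain S M where *: "x = opmat S M" "finite S" "\<And>i j. M i j \<in> C" unfolding Gr_def by auto
    have "\<And>i j. M i j \<in> bop V" using *(3) C_bop by blast
    then show "x \<in> X" unfolding X_def finmat_def using *(1,2) by blast
  qed
  have major: "\<exists>y r. (y, r) \<in> Gr \<and> y - x \<in> P" if "x \<in> X" for x
  proof -
    obtain S M where S: "finite S" and x: "x = opmat S M" and M: "\<And>i j. M i j \<in> bop V"
      using \<open>x \<in> X\<close> unfolding X_def finmat_def by blast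
    \<comment> \<open>Q is the unit of the matrices supported on S. It has entries in C, and
      \<open>norm x\<close> times Q dominates x, so every element of X has a majorant in the domain
      of the functional.\<close>
    define \<Delta> where "\<Delta> i j = (if i = j then bop_id V else 0)" for i j :: 'b
    define Q where "Q = opmat S \<Delta>"
    have \<Delta>C: "\<Delta> i j \<in> C" for i j using C_id subspace_0[OF C_subspace] by (simp add: \<Delta>_def)
    have Q: "ell2_apply (Q f) i = (if i \<in> S then bop_id V (ell2_apply f i) else 0)" for f i
    proof -
      have "(\<Sum>j\<in>S. \<Delta> i j (ell2_apply f j)) = (\<Sum>j\<in>S. if i = j then bop_id V (ell2_apply f j) else 0)"
        unfolding \<Delta>_def by (intro sum.cong) auto
      then show ?thesis by (simp add: Q_def ell2_apply_opmat S)
    qed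
    have QQ: "Q o\<^sub>L Q = Q"
      by (rule blinfun_eqI, rule ell2_eqI) (simp add: Q bop_id_apply[OF V] bopD(2)[OF bop_id_in_bop[OF V]])
    have Qadj: "adj Q = Q"
      unfolding Q_def adj_opmat by (intro opmat_cong) (auto simp: \<Delta>_def adj_bop_id[OF V])
    have "inner f (x f) \<le> norm x * inner f (Q f)" for f
    proof -
      have "inner f (x f) = inner (Q f) (x (Q f))"
        unfolding x inner_opmat
        by (intro sum.cong refl) (simp add: Q inner_bop_id[OF V] bop_comp_id(3)[OF V M] bop_id_apply[OF V] bopD(2)[OF M])
      also have "\<dots> \<le> norm (Q f) * norm (x (Q f))" by (rule norm_cauchy_schwarz)
      also have "\<dots> \<le> norm (Q f) * (norm x * norm (Q f))" by (intro mult_left_mono norm_blinfun) auto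
      also have "\<dots> = norm x * inner f (Q f)"
        by (simp add: inner_projection[OF Qadj QQ] power2_eq_square)
      finally show ?thesis .
    qed
    then have "norm x *\<^sub>R Q - x \<in> P"
      by (simp add: P_def blinfun.diff_left blinfun.scaleR_left inner_diff_right)
    moreover have "(norm x *\<^sub>R Q, norm x * val S \<Delta>) \<in> Gr"
    proof -
      have "(Q, val S \<Delta>) \<in> Gr" unfolding Gr_def Q_def using S \<Delta>C by blast
      from subspace_scale[OF Gr this, of "norm x"] show ?thesis by simp
    qed
    ultimately show ?thesis by blast
  qed
  have P0: "0 \<in> P" and Padd: "\<And>x y. x \<in> P \<Longrightarrow> y \<in> P \<Longrightarrow> x + y \<in> P"
    and Pscale: "\<And>x r. x \<in> P \<Longrightarrow> 0 \<le> r \<Longrightarrow> r *\<^sub>R x \<in> P"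
    by (auto simp: P_def blinfun.add_left blinfun.scaleR_left inner_add_right)
  obtain F where F: "\<And>x y. x \<in> X \<Longrightarrow> y \<in> X \<Longrightarrow> F (x + y) = F x + F y"
    "\<And>x r. x \<in> X \<Longrightarrow> F (r *\<^sub>R x) = r * F x"
    "\<And>x. x \<in> X \<Longrightarrow> x \<in> P \<Longrightarrow> 0 \<le> F x"
    "\<And>x r. (x, r) \<in> Gr \<Longrightarrow> F x = r"
    by (rule riesz_extension[OF X P0 Padd Pscale Gr GrX pos major]) (assumption+, rule that, assumption+)
  define q where "q T \<xi> \<eta> = F (single \<xi> o\<^sub>L T o\<^sub>L sproj \<eta>)" for T \<xi> \<eta>
  have sX: "single \<xi> o\<^sub>L T o\<^sub>L sproj \<eta> \<in> X" if "T \<in> bop V" for T \<xi> \<eta>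
    unfolding X_def by (rule single_compose_sproj_finmat[OF subV that])
  show thesis
  proof (rule that[of q])
    fix S T \<xi> \<eta> assume "S \<in> bop V" "T \<in> bop V"
    then show "q (S + T) \<xi> \<eta> = q S \<xi> \<eta> + q T \<xi> \<eta>"
      unfolding q_def by (simp add: F(1)[symmetric] sX blinfun_compose_simps)
  next
    fix r T \<xi> \<eta> assume "T \<in> bop V"
    then show "q (r *\<^sub>R T) \<xi> \<eta> = r * q T \<xi> \<eta>"
      unfolding q_def by (simp add: F(2)[symmetric] sX blinfun_compose_simps)
  next
    fix a and \<xi> \<eta> :: 'b assume a: "a \<in> C"
    let ?M = "\<lambda>i j. if i = \<xi> \<and> j = \<eta> then a else 0"
    have "q a \<xi> \<eta> = F (opmat {\<xi>, \<eta>} ?M)"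
      unfolding q_def by (subst single_compose_sproj_opmat[of "{\<xi>, \<eta>}"]) auto
    also have "\<dots> = val {\<xi>, \<eta>} ?M"
      by (rule F(4)) (use a subspace_0[OF C_subspace] in \<open>auto simp: Gr_def intro!: exI[of _ "{\<xi>, \<eta>}"] exI[of _ ?M]\<close>)
    also have "\<dots> = inner \<xi> (\<theta> a \<eta>)"
      unfolding val_def by (cases "\<xi> = \<eta>") (auto simp: theta_zero)
    finally show "q a \<xi> \<eta> = inner \<xi> (\<theta> a \<eta>)" .
  next
    fix n :: nat and T :: "nat \<Rightarrow> nat \<Rightarrow> 'a \<Rightarrow>\<^sub>L 'a" and \<xi> :: "nat \<Rightarrow> 'b"
    assume T: "\<And>i j. i < n \<Longrightarrow> j < n \<Longrightarrow> T i j \<in> bop V"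
      and p: "\<And>x. 0 \<le> (\<Sum>i<n. \<Sum>j<n. inner (x i) (T i j (x j)))"
    let ?B = "\<Sum>i<n. \<Sum>j<n. single (\<xi> i) o\<^sub>L T i j o\<^sub>L sproj (\<xi> j)"
    \<comment> \<open>The vectors \<xi> i may coincide, in which case several blocks add up at one
      position. Positivity survives, because the quadratic form of the sum at f is that of T at the
      vectors given by the coordinates of f at \<xi> i.\<close>
    have "?B \<in> P"
      unfolding P_def using p[of "\<lambda>i. ell2_apply _ (\<xi> i)"]
      by (simp add: blinfun.sum_left inner_sum_right inner_single)
    then have "0 \<le> F ?B" using T by (intro F(3) subspace_sum[OF X] sX) auto
    also have "F ?B = (\<Sum>i<n. F (\<Sum>j<n. single (\<xi> i) o\<^sub>L T i j o\<^sub>L sproj (\<xi> j)))"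
      by (rule additive_on_subspace_sum[OF X F(1,2)]) (use T in \<open>auto intro!: subspace_sum[OF X] sX\<close>)
    also have "\<dots> = (\<Sum>i<n. \<Sum>j<n. q (T i j) (\<xi> i) (\<xi> j))"
      unfolding q_def
      by (intro sum.cong refl additive_on_subspace_sum[OF X F(1,2)]) (use T in \<open>auto intro!: sX\<close>)
    finally show "0 \<le> (\<Sum>i<n. \<Sum>j<n. q (T i j) (\<xi> i) (\<xi> j))" .
  qed
qed


text \<open>The form q is positive but not yet linear in its vectors. Every missing property is
  obtained by testing positivity on a small matrix: symmetry, then a null-vector principle, from
  which additivity in the vectors and the module property over C follow together.\<close>

lemma ucp_extension:
  obtains \<Phi> where
    "\<And>T. T \<in> bop V \<Longrightarrow> \<Phi> T \<in> bop W"
    "\<And>S T. S \<in> bop V \<Longrightarrow> T \<in> bop V \<Longrightarrow> \<Phi> (S + T) = \<Phi> S + \<Phi> T"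
    "\<And>a T. T \<in> bop V \<Longrightarrow> \<Phi> (a *\<^sub>C T) = a *\<^sub>C \<Phi> T"
    "\<And>a. a \<in> C \<Longrightarrow> \<Phi> a = \<theta> a"
    "\<And>T. T \<in> bop V \<Longrightarrow> norm (\<Phi> T) \<le> norm T"
    "completely_positive (bop V) \<Phi>"
    "\<And>a T. a \<in> C \<Longrightarrow> T \<in> bop V \<Longrightarrow> \<Phi> (a o\<^sub>L T) = \<theta> a o\<^sub>L \<Phi> T"
    "\<And>a T. a \<in> C \<Longrightarrow> T \<in> bop V \<Longrightarrow> \<Phi> (T o\<^sub>L a) = \<Phi> T o\<^sub>L \<theta> a"
proof -
  obtain q :: "('a \<Rightarrow>\<^sub>L 'a) \<Rightarrow> 'b \<Rightarrow> 'b \<Rightarrow> real" where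
    q_add: "\<And>S T \<xi> \<eta>. S \<in> bop V \<Longrightarrow> T \<in> bop V \<Longrightarrow> q (S + T) \<xi> \<eta> = q S \<xi> \<eta> + q T \<xi> \<eta>"
    and q_scale: "\<And>r T \<xi> \<eta>. T \<in> bop V \<Longrightarrow> q (r *\<^sub>R T) \<xi> \<eta> = r * q T \<xi> \<eta>"
    and q_C: "\<And>a \<xi> \<eta>. a \<in> C \<Longrightarrow> q a \<xi> \<eta> = inner \<xi> (\<theta> a \<eta>)"
    and q_pos: "\<And>n T \<xi>. (\<And>i j. i < n \<Longrightarrow> j < n \<Longrightarrow> T i j \<in> bop V) \<Longrightarrow>
      (\<And>x. 0 \<le> (\<Sum>i<n. \<Sum>j<n. inner (x i) (T i j (x j)))) \<Longrightarrow>
      0 \<le> (\<Sum>i<(n::nat). \<Sum>j<n. q (T i j) (\<xi> i) (\<xi> j))"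
    using ex_positive_form by blast
  define p where "p = bop_id V"
  note bc = bop_closed[OF V]
  have C_bop': "a \<in> C \<Longrightarrow> a \<in> bop V" for a using C_bop by blast
  have pC: "p \<in> C" and pB: "p \<in> bop V" unfolding p_def by (rule C_id, rule bop_id_in_bop[OF V])
  have \<theta>p: "\<theta> p = bop_id W" by (simp add: p_def \<theta>_id)
  have q0: "q 0 \<xi> \<eta> = 0" for \<xi> \<eta> using q_scale[OF bc(5), of 0] by simp
  have q_minus: "q (- T) \<xi> \<eta> = - q T \<xi> \<eta>" if "T \<in> bop V" for T \<xi> \<eta>
    using q_scale[OF that, of "- 1"] by simp
  have minusB: "- T \<in> bop V" if "T \<in> bop V" for T using bc(3)[OF that, of "- 1"] by simp
  have q_adj: "q (adj T) \<eta> \<xi> = q T \<xi> \<eta>" if T: "T \<in> bop V" for T \<xi> \<eta>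
  proof -
    have aT: "adj T \<in> bop V" by (rule bop_adj[OF V T])
    \<comment> \<open>The skew matrix with rows (0, T) and (-T*, 0) has zero real quadratic form.
      Hence it and its negative are both positive, and the value of q on it is 0.\<close>
    define M where "M i j = (if i = (0::nat) \<and> j = (1::nat) then T else if i = 1 \<and> j = 0 then - adj T else 0)" for i j
    define x where "x i = (if i = (0::nat) then \<xi> else \<eta>)" for i
    have two: "{..<2::nat} = {0, 1}" by auto
    have MB: "M i j \<in> bop V" "- M i j \<in> bop V" for i j
      using T aT minusB bc(5) by (auto simp: M_def intro: minusB)
    have 0: "(\<Sum>i<2. \<Sum>j<2. inner (y i) (M i j (y j))) = 0" for y
      by (simp add: two M_def blinfun.minus_left inner_adj_right inner_commute)
    have s: "(\<Sum>i<2. \<Sum>j<2. q (M i j) (x i) (x j)) = q T \<xi> \<eta> - q (adj T) \<eta> \<xi>"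
      by (simp add: two M_def x_def q0 q_minus aT)
    have "0 \<le> (\<Sum>i<2. \<Sum>j<2. q (M i j) (x i) (x j))"
      by (rule q_pos) (simp_all only: MB 0 order_refl)
    moreover have "0 \<le> (\<Sum>i<2. \<Sum>j<2. q (- M i j) (x i) (x j))"
    proof (rule q_pos)
      show "0 \<le> (\<Sum>i<2. \<Sum>j<2. inner (y i) ((- M i j) (y j)))" for y
        using 0[of y] by (simp add: blinfun.minus_left sum_negf)
    qed (rule MB)
    then have "0 \<le> - (\<Sum>i<2. \<Sum>j<2. q (M i j) (x i) (x j))"
      by (simp add: q_minus MB sum_negf)
    ultimately show ?thesis using s by simp
  qed
  \<comment> \<open>The matrix of products c_i* c_j is positive, its quadratic form being the
    squared norm of the sum of the c_i x_i.\<close>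
  have gram: "0 \<le> (\<Sum>i<(n::nat). \<Sum>j<n. q (adj (c i) o\<^sub>L c j) (\<xi> i) (\<xi> j))"
    if c: "\<And>i. i < n \<Longrightarrow> c i \<in> bop V" for n c \<xi>
  proof (rule q_pos)
    show "adj (c i) o\<^sub>L c j \<in> bop V" if "i < n" "j < n" for i j
      using that c by (intro bc bop_adj[OF V])
    fix x :: "nat \<Rightarrow> 'a"
    have "(\<Sum>i<n. \<Sum>j<n. inner (x i) ((adj (c i) o\<^sub>L c j) (x j))) = inner (\<Sum>i<n. c i (x i)) (\<Sum>j<n. c j (x j))"
      by (simp only: inner_sum_left) (simp only: inner_sum_right blinfun_apply_blinfun_compose inner_adj_right)
    then show "0 \<le> (\<Sum>i<n. \<Sum>j<n. inner (x i) ((adj (c i) o\<^sub>L c j) (x j)))" by simp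
  qed
  \<comment> \<open>Cauchy-Schwarz at a null vector: testing positivity on the family t a_k*
    together with T gives a polynomial in t whose leading coefficient is the squared norm of the
    vanishing sum. Its linear coefficient must then be 0.\<close>
  have null: "(\<Sum>k<m. q (a k o\<^sub>L T) (\<xi> k) \<eta>) = 0"
    if a: "\<And>k. k < m \<Longrightarrow> a k \<in> C" and T: "T \<in> bop V"
      and z: "(\<Sum>k<(m::nat). \<theta> (adj (a k)) (\<xi> k)) = 0" for m a T \<xi> \<eta>
  proof -
    have aB: "a k \<in> bop V" "adj (a k) \<in> bop V" if "k < m" for k using a[OF that] C_bop' bop_adj[OF V] by auto
    have aT: "adj T \<in> bop V" by (rule bop_adj[OF V T])
    let ?L = "\<Sum>k<m. q (a k o\<^sub>L T) (\<xi> k) \<eta>"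
    have "0 \<le> 0 * t\<^sup>2 + (2 * ?L) * t + q (adj T o\<^sub>L T) \<eta> \<eta>" for t
    proof -
      define c where "c k = (if k < m then t *\<^sub>R adj (a k) else T)" for k
      define x where "x k = (if k < m then \<xi> k else \<eta>)" for k
      have cB: "c k \<in> bop V" for k using aB T bc by (auto simp: c_def)
      have "(\<Sum>i<m. \<Sum>j<m. q (adj (c i) o\<^sub>L c j) (x i) (x j)) = (\<Sum>i<m. \<Sum>j<m. t\<^sup>2 * inner (\<theta> (adj (a i)) (\<xi> i)) (\<theta> (adj (a j)) (\<xi> j)))"
      proof (intro sum.cong refl)
        fix i j assume ij: "i \<in> {..<m}" "j \<in> {..<m}"
        have aa: "a i o\<^sub>L adj (a j) \<in> C" using ij a by (intro C_mult C_adj) auto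
        have "q (adj (c i) o\<^sub>L c j) (x i) (x j) = t\<^sup>2 * q (a i o\<^sub>L adj (a j)) (\<xi> i) (\<xi> j)"
          using ij q_scale[OF C_bop'[OF aa], of "t\<^sup>2"]
          by (simp add: c_def x_def adj_scaleR blinfun_compose_simps power2_eq_square)
        also have "q (a i o\<^sub>L adj (a j)) (\<xi> i) (\<xi> j) = inner (\<xi> i) (\<theta> (a i) (\<theta> (adj (a j)) (\<xi> j)))"
          using ij a by (simp add: q_C[OF aa] \<theta>_mult C_adj)
        also have "\<dots> = inner (\<theta> (adj (a i)) (\<xi> i)) (\<theta> (adj (a j)) (\<xi> j))"
          using ij a \<theta>_adj[of "a i"] inner_adj_left[of "\<theta> (a i)"] by simp
        finally show "q (adj (c i) o\<^sub>L c j) (x i) (x j) = t\<^sup>2 * inner (\<theta> (adj (a i)) (\<xi> i)) (\<theta> (adj (a j)) (\<xi> j))" .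
      qed
      also have "\<dots> = t\<^sup>2 * inner (\<Sum>i<m. \<theta> (adj (a i)) (\<xi> i)) (\<Sum>j<m. \<theta> (adj (a j)) (\<xi> j))"
        by (simp only: inner_sum_left) (simp only: inner_sum_right sum_distrib_left)
      also have "\<dots> = 0" using z by simp
      finally have A: "(\<Sum>i<m. \<Sum>j<m. q (adj (c i) o\<^sub>L c j) (x i) (x j)) = 0" .
      have B1: "q (adj (c i) o\<^sub>L c m) (x i) (x m) = t * q (a i o\<^sub>L T) (\<xi> i) \<eta>"
        and B2: "q (adj (c m) o\<^sub>L c i) (x m) (x i) = t * q (a i o\<^sub>L T) (\<xi> i) \<eta>" if "i < m" for i
      proof -
        have aT': "a i o\<^sub>L T \<in> bop V" using that aB T by (intro bc)
        show *: "q (adj (c i) o\<^sub>L c m) (x i) (x m) = t * q (a i o\<^sub>L T) (\<xi> i) \<eta>"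
          using that q_scale[OF aT'] by (simp add: c_def x_def adj_scaleR blinfun_compose_simps)
        have "adj (c m) o\<^sub>L c i = adj (adj (c i) o\<^sub>L c m)" by (simp add: adj_compose)
        then show "q (adj (c m) o\<^sub>L c i) (x m) (x i) = t * q (a i o\<^sub>L T) (\<xi> i) \<eta>"
          using q_adj[of "adj (c i) o\<^sub>L c m" "x m" "x i"] * bc(4)[OF bop_adj[OF V cB] cB] by simp
      qed
      have "0 \<le> (\<Sum>i<Suc m. \<Sum>j<Suc m. q (adj (c i) o\<^sub>L c j) (x i) (x j))" by (rule gram[OF cB])
      also have "\<dots> = (\<Sum>i<m. \<Sum>j<m. q (adj (c i) o\<^sub>L c j) (x i) (x j)) + (\<Sum>i<m. t * q (a i o\<^sub>L T) (\<xi> i) \<eta>)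
        + (\<Sum>i<m. t * q (a i o\<^sub>L T) (\<xi> i) \<eta>) + q (adj T o\<^sub>L T) \<eta> \<eta>"
        by (simp add: sum.distrib B1 B2) (simp add: c_def x_def)
      finally show ?thesis by (simp add: A sum_distrib_left[symmetric] algebra_simps)
    qed
    from quadratic_nonneg_discriminant[OF this] show ?thesis by simp
  qed
  have pT: "p o\<^sub>L T = T" if "T \<in> bop V" for T unfolding p_def by (rule bop_comp_id(2)[OF V that])
  have adjp: "adj p = p" unfolding p_def by (rule adj_bop_id[OF V])
  have rp: "r *\<^sub>R p \<in> C" for r by (rule subspace_scale[OF C_subspace pC])
  \<comment> \<open>The null-vector principle with coefficients p, -p, -p at the vectors \<xi> +
    \<xi>', \<xi>, \<xi>'.\<close>
  have q_lin: "q T (\<xi> + \<xi>') \<eta> = q T \<xi> \<eta> + q T \<xi>' \<eta>" if T: "T \<in> bop V" for T \<xi> \<xi>' \<eta>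
  proof -
    define a where "a k = (if k = (0::nat) then p else - 1 *\<^sub>R p)" for k
    define x where "x k = (if k = (0::nat) then \<xi> + \<xi>' else if k = 1 then \<xi> else \<xi>')" for k
    have three: "{..<3::nat} = {0, 1, 2}" by auto
    have "(\<Sum>k<3. q (a k o\<^sub>L T) (x k) \<eta>) = 0"
    proof (rule null[OF _ T])
      show "a k \<in> C" for k using pC rp[of "-1"] by (simp add: a_def)
      show "(\<Sum>k<3. \<theta> (adj (a k)) (x k)) = 0"
        using theta_scaleR[OF pC, of "-1"] adj_scaleR[of "-1" p]
        by (simp add: three a_def x_def adjp \<theta>p blinfun.minus_left blinfun.add_right)
    qed
    then show ?thesis
      using pT[OF T] q_minus[OF T] blinfun_compose_simps(5)[of "-1" p T] by (simp add: three a_def x_def)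
  qed
  have q_mod: "q (a o\<^sub>L T) \<xi> \<eta> = q T (\<theta> (adj a) \<xi>) \<eta>" if a: "a \<in> C" and T: "T \<in> bop V" for a T \<xi> \<eta>
  proof -
    define c where "c k = (if k = (0::nat) then a else - 1 *\<^sub>R p)" for k
    define x where "x k = (if k = (0::nat) then \<xi> else \<theta> (adj a) \<xi>)" for k
    have two: "{..<2::nat} = {0, 1}" by auto
    have "(\<Sum>k<2. q (c k o\<^sub>L T) (x k) \<eta>) = 0"
    proof (rule null[OF _ T])
      show "c k \<in> C" for k using a rp[of "-1"] by (simp add: c_def)
      show "(\<Sum>k<2. \<theta> (adj (c k)) (x k)) = 0"
        using theta_scaleR[OF pC, of "-1"] adj_scaleR[of "-1" p] bop_id_apply[OF W bopD(2)[OF \<theta>_bop[OF C_adj[OF a]]]]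
        by (simp add: two c_def x_def adjp \<theta>p blinfun.minus_left)
    qed
    then show ?thesis
      using pT[OF T] q_minus[OF T] blinfun_compose_simps(5)[of "-1" p T] by (simp add: two c_def x_def)
  qed
  have q_P: "q T (bop_id W \<xi>) \<eta> = q T \<xi> \<eta>" if "T \<in> bop V" for T \<xi> \<eta>
    using q_mod[OF pC that] by (simp add: pT[OF that] adjp \<theta>p)
  \<comment> \<open>A complex scalar c becomes the algebra element c p, so complex homogeneity is an
    instance of the module property.\<close>
  have q_scaleC: "q (c *\<^sub>C T) \<xi> \<eta> = q T (cnj c *\<^sub>C \<xi>) \<eta>" if T: "T \<in> bop V" for c T \<xi> \<eta>
  proof -
    have "c *\<^sub>C T = (c *\<^sub>C p) o\<^sub>L T" by (simp add: scaleC_blinfun_simps pT[OF T])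
    then have "q (c *\<^sub>C T) \<xi> \<eta> = q T (\<theta> (adj (c *\<^sub>C p)) \<xi>) \<eta>" using q_mod[OF C_scaleC[OF pC] T] by simp
    also have "\<theta> (adj (c *\<^sub>C p)) \<xi> = bop_id W (cnj c *\<^sub>C \<xi>)"
      using adj_scaleC[OF bopD(1)[OF pB], of c] by (simp add: adjp \<theta>_scaleC pC \<theta>p bopD(4)[OF bop_id_in_bop[OF W]])
    finally show ?thesis using q_P[OF T] by simp
  qed
  have q_scaleR: "q T (r *\<^sub>R \<xi>) \<eta> = r * q T \<xi> \<eta>" if T: "T \<in> bop V" for r T \<xi> \<eta>
    using q_scaleC[OF T, of "complex_of_real r" \<xi> \<eta>] q_scale[OF T]
    by (simp add: scaleC_blinfun_simps scaleR_scaleC)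
  \<comment> \<open>Cauchy-Schwarz for q combined with T* T \<le> |T|^2 p; on p the form is the
    squared norm of the projection to W.\<close>
  have q_bound: "\<bar>q T \<xi> \<eta>\<bar> \<le> norm \<xi> * (norm T * norm \<eta>)" if T: "T \<in> bop V" for T \<xi> \<eta>
  proof -
    have aT: "adj T \<in> bop V" by (rule bop_adj[OF V T])
    have TT: "adj T o\<^sub>L T \<in> bop V" by (intro bc aT T)
    have "0 \<le> q p \<xi> \<xi> * t\<^sup>2 + (2 * q T \<xi> \<eta>) * t + q (adj T o\<^sub>L T) \<eta> \<eta>" for t
    proof -
      define c where "c k = (if k = (0::nat) then t *\<^sub>R p else T)" for k
      define x where "x k = (if k = (0::nat) then \<xi> else \<eta>)" for k
      have two: "{..<2::nat} = {0, 1}" by auto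
      have "0 \<le> (\<Sum>i<2. \<Sum>j<2. q (adj (c i) o\<^sub>L c j) (x i) (x j))"
        by (rule gram) (auto simp: c_def intro: bc pB T)
      moreover have "q (adj T o\<^sub>L t *\<^sub>R p) \<eta> \<xi> = t * q T \<xi> \<eta>"
        using q_adj[OF T, of \<eta> \<xi>] q_scale[OF aT, of t] pT[OF T] bop_comp_id(1)[OF V aT]
        by (simp add: blinfun_compose_simps p_def)
      ultimately show ?thesis
        using q_scale[OF T, of t] q_scale[OF pB, of "t * t"]
        by (simp add: two c_def x_def adj_scaleR adjp blinfun_compose_simps pT pB T power2_eq_square algebra_simps)
    qed
    from quadratic_nonneg_discriminant[OF this]
    have 1: "(q T \<xi> \<eta>)\<^sup>2 \<le> q p \<xi> \<xi> * q (adj T o\<^sub>L T) \<eta> \<eta>" by (simp add: power_mult_distrib)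
    have pp: "q p \<zeta> \<zeta> \<le> (norm \<zeta>)\<^sup>2" "0 \<le> q p \<zeta> \<zeta>" for \<zeta>
      using norm_bop_id_le[OF W, of \<zeta>] by (simp_all add: q_C[OF pC] \<theta>p inner_bop_id_same[OF W] power_mono)
    have "0 \<le> (\<Sum>i<Suc 0. \<Sum>j<Suc 0. q ((norm T)\<^sup>2 *\<^sub>R p + (-1) *\<^sub>R (adj T o\<^sub>L T)) \<eta> \<eta>)"
    proof (rule q_pos)
      show "(norm T)\<^sup>2 *\<^sub>R p + (-1) *\<^sub>R (adj T o\<^sub>L T) \<in> bop V" by (intro bc pB TT)
      fix x :: "nat \<Rightarrow> 'a"
      let ?y = "x 0"
      have "inner ?y (p ?y) = inner (p ?y) (p ?y)"
        unfolding p_def by (simp add: inner_bop_id_same[OF V] power2_norm_eq_inner)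
      moreover have "(norm (T ?y))\<^sup>2 \<le> (norm T * norm (p ?y))\<^sup>2"
        using norm_blinfun[of T "p ?y"] bop_comp_id(3)[OF V T, of ?y] by (intro power_mono) (simp_all add: p_def)
      ultimately show "0 \<le> (\<Sum>i<Suc 0. \<Sum>j<Suc 0. inner (x i) (((norm T)\<^sup>2 *\<^sub>R p + (-1) *\<^sub>R (adj T o\<^sub>L T)) (x j)))"
        by (simp add: blinfun.diff_left blinfun.scaleR_left inner_diff_right inner_adj_right power_mult_distrib power2_norm_eq_inner)
    qed
    then have 2: "q (adj T o\<^sub>L T) \<eta> \<eta> \<le> (norm T)\<^sup>2 * q p \<eta> \<eta>"
      using q_add[OF bc(3)[OF pB, of "(norm T)\<^sup>2"] bc(3)[OF TT, of "-1"], of \<eta> \<eta>]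
        q_scale[OF pB] q_minus[OF TT] by simp
    have 3: "q (adj T o\<^sub>L T) \<eta> \<eta> \<le> (norm T * norm \<eta>)\<^sup>2"
      using 2 mult_left_mono[OF pp(1)[of \<eta>], of "(norm T)\<^sup>2"] by (simp add: power_mult_distrib)
    have "q p \<xi> \<xi> * q (adj T o\<^sub>L T) \<eta> \<eta> \<le> (norm \<xi>)\<^sup>2 * (norm T * norm \<eta>)\<^sup>2"
      using 3 pp[of \<xi>] by (intro order_trans[OF mult_left_mono[OF 3 pp(2)] mult_right_mono[OF pp(1)]]) auto
    then have "\<bar>q T \<xi> \<eta>\<bar>\<^sup>2 \<le> (norm \<xi> * (norm T * norm \<eta>))\<^sup>2"
      using 1 by (simp add: power_mult_distrib)
    then show ?thesis by (rule power2_le_imp_le) simp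
  qed
  have ex: "\<exists>S. \<forall>\<xi> \<eta>. inner \<xi> (blinfun_apply S \<eta>) = q T \<xi> \<eta>" if T: "T \<in> bop V" for T
  proof -
    have "\<exists>v. \<forall>\<xi>. inner \<xi> v = q T \<xi> \<eta>" for \<eta>
    proof -
      have "bounded_linear (\<lambda>\<xi>. q T \<xi> \<eta>)"
        by (rule bounded_linear_intro[where K = "norm T * norm \<eta>"])
          (simp_all add: q_lin[OF T] q_scaleR[OF T] q_bound[OF T])
      from riesz_representation[OF subspace_UNIV closed_UNIV this] show ?thesis
        by (metis UNIV_I inner_commute)
    qed
    then obtain f where f: "\<And>\<xi> \<eta>. inner \<xi> (f \<eta>) = q T \<xi> \<eta>" by metis
    \<comment> \<open>Linearity was proved in the first vector only; symmetry of q under adjoints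
      transfers it to the second.\<close>
    have aT: "adj T \<in> bop V" by (rule bop_adj[OF V T])
    have swap: "q T \<xi> \<eta> = q (adj T) \<eta> \<xi>" for \<xi> \<eta> by (rule q_adj[OF T, symmetric])
    have "bounded_linear f"
    proof (rule bounded_linear_intro[where K = "norm T"])
      show "f (x + y) = f x + f y" for x y
        by (rule vector_eq_ldot[THEN iffD1]) (simp add: f inner_add_right swap q_lin[OF aT])
      show "f (r *\<^sub>R x) = r *\<^sub>R f x" for r x
        by (rule vector_eq_ldot[THEN iffD1]) (simp add: f swap q_scaleR[OF aT])
      fix x
      have "norm (f x) * norm (f x) = q T (f x) x"
        by (simp add: f[symmetric] power2_eq_square[symmetric] power2_norm_eq_inner)
      also have "\<dots> \<le> norm (f x) * (norm T * norm x)" using q_bound[OF T, of "f x" x] by simp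
      finally show "norm (f x) \<le> norm x * norm T" by (cases "f x = 0") (auto simp: mult.commute)
    qed
    then have "blinfun_apply (Blinfun f) = f" by (rule bounded_linear_Blinfun_apply)
    then show ?thesis using f by metis
  qed
  define \<Phi> where "\<Phi> T = (SOME S. \<forall>\<xi> \<eta>. inner \<xi> (blinfun_apply S \<eta>) = q T \<xi> \<eta>)" for T
  have \<Phi>: "inner \<xi> (\<Phi> T \<eta>) = q T \<xi> \<eta>" if "T \<in> bop V" for T \<xi> \<eta>
    using someI_ex[OF ex[OF that]] unfolding \<Phi>_def by blast
  have eqI: "S = T" if "\<And>\<xi> \<eta>. inner \<xi> (blinfun_apply S \<eta>) = inner \<xi> (blinfun_apply T \<eta>)" for S T :: "'b \<Rightarrow>\<^sub>L 'b"
    by (rule blinfun_eqI, rule vector_eq_ldot[THEN iffD1]) (simp add: that)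
  have \<Phi>_adj: "\<Phi> (adj T) = adj (\<Phi> T)" if T: "T \<in> bop V" for T
    by (rule eqI) (simp add: \<Phi> bop_adj[OF V] T inner_adj_right inner_commute[of "\<Phi> T _"] q_adj)
  have \<Phi>_scaleC: "\<Phi> (c *\<^sub>C T) = c *\<^sub>C \<Phi> T" if T: "T \<in> bop V" for c T
  proof (rule eqI)
    fix \<xi> \<eta>
    show "inner \<xi> (\<Phi> (c *\<^sub>C T) \<eta>) = inner \<xi> ((c *\<^sub>C \<Phi> T) \<eta>)"
      using inner_scaleC_left[of "cnj c" \<xi> "\<Phi> T \<eta>"] \<Phi>[OF T, of "cnj c *\<^sub>C \<xi>" \<eta>]
      by (simp add: \<Phi>[OF bc(2)[OF T]] q_scaleC[OF T])
  qed
  have clin: "clin (\<Phi> T)" if T: "T \<in> bop V" for T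
    unfolding clin_def
  proof (intro allI, rule vector_eq_ldot[THEN iffD1], rule allI)
    fix c \<eta> \<xi>
    have aT: "adj T \<in> bop V" by (rule bop_adj[OF V T])
    have "inner \<xi> (\<Phi> T (c *\<^sub>C \<eta>)) = inner (\<Phi> (adj T) \<xi>) (c *\<^sub>C \<eta>)"
      by (simp add: \<Phi>_adj[OF T] inner_adj_left)
    also have "\<dots> = inner (\<Phi> (cnj c *\<^sub>C adj T) \<xi>) \<eta>"
      by (simp add: \<Phi>_scaleC[OF aT] inner_scaleC_left)
    also have "\<dots> = inner (\<Phi> (adj (c *\<^sub>C T)) \<xi>) \<eta>"
      by (simp add: adj_scaleC bopD(1)[OF T])
    also have "\<dots> = inner \<xi> (c *\<^sub>C \<Phi> T \<eta>)"
      by (simp add: \<Phi>_adj[OF bc(2)[OF T]] inner_adj_left \<Phi>_scaleC[OF T])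
    finally show "inner \<xi> (\<Phi> T (c *\<^sub>C \<eta>)) = inner \<xi> (c *\<^sub>C \<Phi> T \<eta>)" .
  qed
  have modl: "\<Phi> (a o\<^sub>L T) = \<theta> a o\<^sub>L \<Phi> T" if a: "a \<in> C" and T: "T \<in> bop V" for a T
  proof (rule eqI)
    fix \<xi> \<eta>
    show "inner \<xi> (\<Phi> (a o\<^sub>L T) \<eta>) = inner \<xi> ((\<theta> a o\<^sub>L \<Phi> T) \<eta>)"
      using inner_adj_left[of "\<theta> a" \<xi> "\<Phi> T \<eta>"] \<Phi>[OF T, of "adj (\<theta> a) \<xi>" \<eta>]
      by (simp add: \<Phi> bc C_bop' a T q_mod \<theta>_adj[OF a])
  qed
  \<comment> \<open>The right module property is the adjoint of the left one.\<close>
  have modr: "\<Phi> (T o\<^sub>L a) = \<Phi> T o\<^sub>L \<theta> a" if a: "a \<in> C" and T: "T \<in> bop V" for a T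
  proof -
    have "\<Phi> (adj (adj a o\<^sub>L adj T)) = adj (\<theta> (adj a) o\<^sub>L \<Phi> (adj T))"
      using a T by (simp add: \<Phi>_adj bc C_adj C_bop' bop_adj[OF V] modl)
    then show ?thesis by (simp add: adj_compose \<Phi>_adj[OF T] \<theta>_adj[OF a])
  qed
  show thesis
  proof (rule that[of \<Phi>])
    show "\<Phi> a = \<theta> a" if "a \<in> C" for a
      by (rule eqI) (simp add: \<Phi> C_bop' that q_C)
    show "\<Phi> (S + T) = \<Phi> S + \<Phi> T" if "S \<in> bop V" "T \<in> bop V" for S T
      by (rule eqI) (simp add: \<Phi> bc that q_add blinfun.add_left inner_add_right)
    show "\<Phi> T \<in> bop W" if T: "T \<in> bop V" for T
    proof (rule bop_intro[OF clin[OF T]])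
      have l: "\<Phi> T = bop_id W o\<^sub>L \<Phi> T" using modl[OF pC T] by (simp add: pT[OF T] \<theta>p)
      show "\<Phi> T x \<in> W" for x
        using bopD(2)[OF bop_id_in_bop[OF W]] by (subst l) simp
      have r: "\<Phi> T = \<Phi> T o\<^sub>L bop_id W"
        using modr[OF pC T] bop_comp_id(1)[OF V T] by (simp add: p_def \<theta>_id)
      show "\<Phi> T x = 0" if "\<And>v. v \<in> W \<Longrightarrow> cinner v x = 0" for x
        using bopD(3)[OF bop_id_in_bop[OF W] that] by (subst r) simp
    qed
    show "norm (\<Phi> T) \<le> norm T" if T: "T \<in> bop V" for T
    proof (rule norm_blinfun_bound)
      fix x
      have "norm (\<Phi> T x) * norm (\<Phi> T x) = q T (\<Phi> T x) x"
        by (simp add: \<Phi>[OF T, symmetric] power2_eq_square[symmetric] power2_norm_eq_inner)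
      also have "\<dots> \<le> norm (\<Phi> T x) * (norm T * norm x)" using q_bound[OF T, of "\<Phi> T x" x] by simp
      finally show "norm (\<Phi> T x) \<le> norm T * norm x" by (cases "\<Phi> T x = 0") auto
    qed simp
    show "completely_positive (bop V) \<Phi>"
      unfolding completely_positive_def
    proof (intro allI impI, elim conjE)
      fix n and A :: "nat \<Rightarrow> nat \<Rightarrow> 'a \<Rightarrow>\<^sub>L 'a"
      assume "\<forall>i<n. \<forall>j<n. A i j \<in> bop V" and pA: "pos_matrix n A"
      then have A: "A i j \<in> bop V" if "i < n" "j < n" for i j using that by blast
      \<comment> \<open>\<open>pos_matrix\<close> asks for a real and nonnegative complex sum. Its
        vanishing imaginary part is recorded as the vanishing real form of i A, so that i A and -i A
        are both positive for q, and the image sum is real as well.\<close>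
      have re: "0 \<le> (\<Sum>i<n. \<Sum>j<n. inner (x i) (A i j (x j)))"
        and im: "(\<Sum>i<n. \<Sum>j<n. inner (x i) ((\<i> *\<^sub>C A i j) (x j))) = 0" for x
      proof -
        let ?s = "\<Sum>i<n. \<Sum>j<n. cinner (x i) (A i j (x j))"
        have s: "?s \<in> \<real>" "0 \<le> Re ?s" using pA unfolding pos_matrix_def Let_def by auto
        show "0 \<le> (\<Sum>i<n. \<Sum>j<n. inner (x i) (A i j (x j)))" using s(2) by (simp add: Re_cinner)
        have "(\<Sum>i<n. \<Sum>j<n. inner (x i) ((\<i> *\<^sub>C A i j) (x j))) = Re (\<i> * ?s)"
          by (simp add: Re_cinner[symmetric] cinner_scaleC_right sum_distrib_left sum_negf)
        then show "(\<Sum>i<n. \<Sum>j<n. inner (x i) ((\<i> *\<^sub>C A i j) (x j))) = 0"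
          using s(1) by (simp add: complex_is_Real_iff)
      qed
      show "pos_matrix n (\<lambda>i j. \<Phi> (A i j))"
        unfolding pos_matrix_def Let_def
      proof (intro allI conjI)
        fix x :: "nat \<Rightarrow> 'b"
        let ?s = "\<Sum>i<n. \<Sum>j<n. cinner (x i) (\<Phi> (A i j) (x j))"
        have "Re ?s = (\<Sum>i<n. \<Sum>j<n. q (A i j) (x i) (x j))" by (simp add: Re_cinner \<Phi> A)
        also have "\<dots> \<ge> 0" by (rule q_pos[OF A re])
        finally show "0 \<le> Re ?s" .
        have iA: "\<i> *\<^sub>C A i j \<in> bop V" if "i < n" "j < n" for i j by (intro bc A that)
        have "0 \<le> (\<Sum>i<n. \<Sum>j<n. q (\<i> *\<^sub>C A i j) (x i) (x j))"
          by (rule q_pos[OF iA]) (simp_all only: im order_refl)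
        moreover have "0 \<le> (\<Sum>i<n. \<Sum>j<n. q (- (\<i> *\<^sub>C A i j)) (x i) (x j))"
        proof (rule q_pos)
          show "0 \<le> (\<Sum>i<n. \<Sum>j<n. inner (y i) ((- (\<i> *\<^sub>C A i j)) (y j)))" for y
            using im[of y] by (simp add: blinfun.minus_left sum_negf)
        qed (intro minusB iA)
        then have "0 \<le> - (\<Sum>i<n. \<Sum>j<n. q (\<i> *\<^sub>C A i j) (x i) (x j))"
          by (simp add: q_minus iA sum_negf)
        ultimately have z: "(\<Sum>i<n. \<Sum>j<n. q (\<i> *\<^sub>C A i j) (x i) (x j)) = 0" by simp
        have "Im ?s = - Re (\<i> * ?s)" by simp
        also have "Re (\<i> * ?s) = (\<Sum>i<n. \<Sum>j<n. inner (x i) (\<Phi> (\<i> *\<^sub>C A i j) (x j)))"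
          by (simp add: Re_cinner[symmetric] cinner_scaleC_right \<Phi>_scaleC A sum_distrib_left sum_negf)
        also have "\<dots> = 0" using z by (simp add: \<Phi> iA)
        finally show "?s \<in> \<real>" by (simp add: complex_is_Real_iff)
      qed
    qed
  qed (use \<Phi>_scaleC modl modr in auto)
qed

end

section \<open>Equivariant maps\<close>

text \<open>Equivariance is the bimodule property applied to \<rho>(g) on the left and to
  \<rho>(g^-1) on the right. Contractivity is kept for the later passage to block-diagonal
  operators.\<close>

lemma weakly_contained_ex_G_map:
  assumes G: "group G" and \<rho>: "unitary_rep G V \<rho>" and \<pi>: "unitary_rep G W \<pi>"
    and wc: "weakly_contained G \<pi> \<rho>"
  obtains \<Phi> where "G_map G V \<rho> (bop V) W \<pi> (bop W) \<Phi>" "\<And>T. T \<in> bop V \<Longrightarrow> norm (\<Phi> T) \<le> norm T"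
proof -
  interpret G: group G by (rule G)
  obtain \<theta> where "cstar_hom V W (cstar_rep G \<rho>) \<theta>" and g: "\<And>g. g \<in> carrier G \<Longrightarrow> \<theta> (\<rho> g) = \<pi> g"
    using weakly_contained_cstar_hom[OF assms] by blast
  then interpret cstar_hom V W "cstar_rep G \<rho>" \<theta> by simp
  note u = unitary_repD[OF G \<rho>]
  obtain \<Phi> where P: "\<And>T. T \<in> bop V \<Longrightarrow> \<Phi> T \<in> bop W"
    "\<And>S T. S \<in> bop V \<Longrightarrow> T \<in> bop V \<Longrightarrow> \<Phi> (S + T) = \<Phi> S + \<Phi> T"
    "\<And>a T. T \<in> bop V \<Longrightarrow> \<Phi> (a *\<^sub>C T) = a *\<^sub>C \<Phi> T"
    "\<And>a. a \<in> cstar_rep G \<rho> \<Longrightarrow> \<Phi> a = \<theta> a"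
    "\<And>T. T \<in> bop V \<Longrightarrow> norm (\<Phi> T) \<le> norm T"
    "completely_positive (bop V) \<Phi>"
    "\<And>a T. a \<in> cstar_rep G \<rho> \<Longrightarrow> T \<in> bop V \<Longrightarrow> \<Phi> (a o\<^sub>L T) = \<theta> a o\<^sub>L \<Phi> T"
    "\<And>a T. a \<in> cstar_rep G \<rho> \<Longrightarrow> T \<in> bop V \<Longrightarrow> \<Phi> (T o\<^sub>L a) = \<Phi> T o\<^sub>L \<theta> a"
    using ucp_extension by blast
  have "G_map G V \<rho> (bop V) W \<pi> (bop W) \<Phi>"
    unfolding G_map_def conj_act_def
    using P(1-3,6) cstar_rep_props(2)[OF G \<rho>]
    by (auto simp: P(4)[OF C_id] \<theta>_id P(7,8) g bop_closed[OF V] u(2))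
  then show thesis using P(5) by (rule that)
qed

lemma G_map_compose:
  assumes \<Phi>: "G_map G V \<pi> E W \<rho> F \<Phi>" and \<Psi>: "G_map G W \<rho> F U \<kappa> D \<Psi>"
  shows "G_map G V \<pi> E U \<kappa> D (\<lambda>T. \<Psi> (\<Phi> T))"
proof -
  have im: "\<Phi> T \<in> F" if "T \<in> E" for T using \<Phi> that by (auto simp: G_map_def)
  have "completely_positive E (\<lambda>T. \<Psi> (\<Phi> T))"
    unfolding completely_positive_def
  proof (intro allI impI, elim conjE)
    fix n A assume A: "\<forall>i<n. \<forall>j<n. A i j \<in> E" "pos_matrix n A"
    then have "pos_matrix n (\<lambda>i j. \<Phi> (A i j))"
      using \<Phi> by (simp add: G_map_def completely_positive_def)
    moreover have "\<forall>i<n. \<forall>j<n. \<Phi> (A i j) \<in> F" using A im by blast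
    ultimately show "pos_matrix n (\<lambda>i j. \<Psi> (\<Phi> (A i j)))"
      using \<Psi> by (simp add: G_map_def completely_positive_def)
  qed
  then show ?thesis using \<Phi> \<Psi> im unfolding G_map_def by auto
qed

lemma G_map_restrict:
  assumes "G_map G V \<pi> E W \<rho> F \<Phi>" "E' \<subseteq> E" "\<Phi> ` E' \<subseteq> F'"
  shows "G_map G V \<pi> E' W \<rho> F' \<Phi>"
proof -
  have "completely_positive E' \<Phi>"
    using assms(1,2) unfolding G_map_def completely_positive_def by (meson subsetD)
  then show ?thesis using assms unfolding G_map_def by (simp add: subset_iff)
qed

section \<open>Compressions, direct sums of operators and positivity\<close>

lemma has_sum_finite_sum:
  fixes f :: "'k \<Rightarrow> 'i \<Rightarrow> 'a::{comm_monoid_add,topological_comm_monoid_add}"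
  assumes "\<And>k. k \<in> K \<Longrightarrow> (f k has_sum s k) A"
  shows "((\<lambda>i. \<Sum>k\<in>K. f k i) has_sum (\<Sum>k\<in>K. s k)) A"
  using assms by (induction K rule: infinite_finite_induct) (auto intro: has_sum_add)

text \<open>It suffices to evaluate the form at the vectors J x_i. With J a coordinate embedding
  this treats diagonal blocks, with J the flip of tensor factors it treats ampliations.\<close>

lemma pos_matrix_compress:
  assumes "pos_matrix n A" and J: "clin J"
  shows "pos_matrix n (\<lambda>i j. adj J o\<^sub>L A i j o\<^sub>L J)"
proof -
  have "(\<Sum>i<n. \<Sum>j<n. cinner (x i) ((adj J o\<^sub>L A i j o\<^sub>L J) (x j))) =
      (\<Sum>i<n. \<Sum>j<n. cinner (J (x i)) (A i j (J (x j))))" for x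
    by (simp add: cinner_adj_right[OF J])
  then show ?thesis
    using assms(1)[unfolded pos_matrix_def Let_def, rule_format, of "\<lambda>i. J (_ i)"]
    unfolding pos_matrix_def Let_def by simp
qed

text \<open>The direct sum of the operators D i. It has this meaning only for a uniformly bounded
  family, since otherwise the coordinate function may fail to be square summable.\<close>

definition diag_op :: "('i \<Rightarrow> 'a::chilbert_space \<Rightarrow>\<^sub>L 'b::chilbert_space) \<Rightarrow> ('i, 'a) ell2 \<Rightarrow>\<^sub>L ('i, 'b) ell2" where
  "diag_op D = Blinfun (\<lambda>f. Abs_ell2 (\<lambda>i. blinfun_apply (D i) (ell2_apply f i)))"

lemma square_norm_blinfun_le:
  assumes "norm D \<le> K"
  shows "(norm (blinfun_apply D x))\<^sup>2 \<le> K\<^sup>2 * (norm x)\<^sup>2"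
proof -
  have "norm (D x) \<le> K * norm x"
    using norm_blinfun[of D x] mult_right_mono[OF assms, of "norm x"] by simp
  then have "(norm (D x))\<^sup>2 \<le> (K * norm x)\<^sup>2" by (rule power_mono) simp
  then show ?thesis by (simp add: power_mult_distrib)
qed

lemma
  assumes K: "\<And>i. norm (D i) \<le> K"
  shows ell2_apply_diag_op: "ell2_apply (diag_op D f) i = blinfun_apply (D i) (ell2_apply f i)"
    and norm_diag_op: "norm (diag_op D) \<le> K"
proof -
  \<comment> \<open>Types are inhabited, so there is at least one index at which the bound can be
    evaluated.\<close>
  have K0: "0 \<le> K" using K[of undefined] norm_ge_zero order_trans by blast
  define h where "h f = Abs_ell2 (\<lambda>i. blinfun_apply (D i) (ell2_apply f i))" for f
  have summ: "(\<lambda>i. (norm (D i (ell2_apply f i)))\<^sup>2) summable_on UNIV" for f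
    by (rule summable_on_comparison_test[OF summable_on_cmult_right[OF ell2_summable[of f], of "K\<^sup>2"]])
      (auto intro: square_norm_blinfun_le K)
  have h: "ell2_apply (h f) i = D i (ell2_apply f i)" for f i
    unfolding h_def by (subst Abs_ell2_inverse) (auto intro: summ)
  have nh: "norm (h f) \<le> K * norm f" for f
  proof (rule power2_le_imp_le)
    have "(norm (h f))\<^sup>2 \<le> (\<Sum>\<^sub>\<infinity>i. K\<^sup>2 * (norm (ell2_apply f i))\<^sup>2)"
      unfolding norm_ell2_power2[of "h f"] h
      by (intro infsum_mono summ summable_on_cmult_right ell2_summable square_norm_blinfun_le K)
    also have "\<dots> = (K * norm f)\<^sup>2"
      by (simp add: infsum_cmult_right' norm_ell2_power2 power_mult_distrib)
    finally show "(norm (h f))\<^sup>2 \<le> (K * norm f)\<^sup>2" .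
  qed (simp add: K0)
  have "bounded_linear h"
    by (rule bounded_linear_intro[where K = K])
      (auto intro!: ell2_eqI simp: h blinfun.add_right blinfun.scaleR_right nh mult.commute[of _ K])
  then have app: "blinfun_apply (diag_op D) = h"
    unfolding diag_op_def h_def[symmetric] by (simp add: bounded_linear_Blinfun_apply)
  show "ell2_apply (diag_op D f) i = blinfun_apply (D i) (ell2_apply f i)"
    by (simp add: app h)
  show "norm (diag_op D) \<le> K" by (rule norm_blinfun_bound) (auto simp: app nh K0)
qed

lemma clin_diag_op:
  assumes "\<And>i. norm (D i) \<le> K" "\<And>i. clin (D i)"
  shows "clin (diag_op D)"
  unfolding clin_def by (auto intro!: ell2_eqI simp: ell2_apply_diag_op[OF assms(1)] clinD[OF assms(2)])

text \<open>The quadratic form of the direct sum is the convergent sum over c of the forms of the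
  matrices at c, and each of these is real and nonnegative. The bounds may depend on the matrix
  position but not on c.\<close>

lemma pos_matrix_diag_op:
  assumes K: "\<And>i j c. i < n \<Longrightarrow> j < n \<Longrightarrow> norm (A i j c) \<le> K i j"
    and pos: "\<And>c. pos_matrix n (\<lambda>i j. A i j c)"
  shows "pos_matrix n (\<lambda>i j. diag_op (A i j))"
  unfolding pos_matrix_def Let_def
proof (intro allI)
  fix x :: "nat \<Rightarrow> ('a, 'b) ell2"
  let ?s = "\<Sum>i<n. \<Sum>j<n. cinner (x i) (diag_op (A i j) (x j))"
  let ?t = "\<lambda>c. \<Sum>i<n. \<Sum>j<n. cinner (ell2_apply (x i) c) (A i j c (ell2_apply (x j) c))"
  have hs: "(?t has_sum ?s) UNIV"
  proof (intro has_sum_finite_sum)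
    fix i j assume ij: "i \<in> {..<n}" "j \<in> {..<n}"
    show "((\<lambda>c. cinner (ell2_apply (x i) c) (A i j c (ell2_apply (x j) c))) has_sum
        cinner (x i) (diag_op (A i j) (x j))) UNIV"
      using cinner_ell2_has_sum[of "x i" "diag_op (A i j) (x j)"]
        ell2_apply_diag_op[of "A i j" "K i j" "x j", OF K] ij by simp
  qed
  have t: "?t c \<in> \<real> \<and> 0 \<le> Re (?t c)" for c
    using pos[of c, unfolded pos_matrix_def Let_def, THEN spec, of "\<lambda>i. ell2_apply (x i) c"] .
  have re: "0 \<le> Re ?s" by (rule has_sum_nonneg[OF has_sum_Re[OF hs]]) (use t in blast)
  have "((\<lambda>c. Im (?t c)) has_sum Im ?s) UNIV" by (rule has_sum_Im[OF hs])
  moreover have "Im (?t c) = 0" for c using t[of c] by (simp only: complex_is_Real_iff)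
  ultimately have "((\<lambda>c::'a. 0) has_sum Im ?s) UNIV" by (simp only:)
  then have "Im ?s = 0" by (rule has_sum_unique) simp
  then show "?s \<in> \<real> \<and> 0 \<le> Re ?s" using re by (simp add: complex_is_Real_iff)
qed

section \<open>Ampliation to a tensor product\<close>

text \<open>Agreement spreads to the closed span by density, and on the orthogonal complement both
  operators vanish. This is the uniqueness behind the definite description in
  \<open>tensor_rep\<close>.\<close>

lemma bop_eq_on_generators:
  fixes X :: "'a::chilbert_space set"
  assumes S: "S \<in> bop (closure (cspan X))" and T: "T \<in> bop (closure (cspan X))"
    and eq: "\<And>x. x \<in> X \<Longrightarrow> blinfun_apply S x = blinfun_apply T x"
  shows "S = T"
proof -
  have "closure (cspan X) \<subseteq> {u. blinfun_apply (S - T) u = 0}"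
    by (rule closure_cspan_least[OF closed_subspace_kernel[OF blinfun.bounded_linear_right]])
      (simp add: blinfun.diff_left bopD(4)[OF S] bopD(4)[OF T] eq)
  then show ?thesis
    by (intro bop_eqI[OF hilbert_closure_cspan S T]) (auto simp: blinfun.diff_left)
qed

text \<open>The elementary tensors written as an image of V \<times> W, the shape in which
  \<open>gram_isometry\<close> expects its generators.\<close>

definition tensors :: "'a::chilbert_space set \<Rightarrow> 'b::chilbert_space set \<Rightarrow> ('a, 'b) ell2 set" where
  "tensors V W = (\<lambda>(v, w). tensor V v w) ` (V \<times> W)"

lemma tensor_space_eq: "tensor_space V W = closure (cspan (tensors V W))"
proof -
  have "{tensor V v w | v w. v \<in> V \<and> w \<in> W} = tensors V W" by (auto simp: tensors_def)
  then show ?thesis by (simp add: tensor_space_def)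
qed

lemma hilbert_tensor_space: "hilbert (tensor_space V W)"
  unfolding tensor_space_eq by (rule hilbert_closure_cspan)

lemma tensor_in_tensor_space: "v \<in> V \<Longrightarrow> w \<in> W \<Longrightarrow> tensor V v w \<in> tensor_space V W"
  unfolding tensor_space_eq using closure_cspan_superset by (fastforce simp: tensors_def)

lemma bop_tensor_eqI:
  assumes "S \<in> bop (tensor_space V W)" "T \<in> bop (tensor_space V W)"
    "\<And>v w. v \<in> V \<Longrightarrow> w \<in> W \<Longrightarrow> blinfun_apply S (tensor V v w) = blinfun_apply T (tensor V v w)"
  shows "S = T"
  using assms unfolding tensor_space_eq by (intro bop_eq_on_generators) (auto simp: tensors_def)

text \<open>The tensors of v, w and of S v, T w have the same Gram kernel because S and T are
  isometric, and the same set of values because they are onto. The Gram isometry therefore maps the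
  tensor space onto itself.\<close>

lemma tensor_unitary:
  assumes V: "hilbert V" and W: "hilbert W" and S: "unitary_on V S" and T: "unitary_on W T"
  obtains U where "unitary_on (tensor_space V W) U"
    "\<And>v w. v \<in> V \<Longrightarrow> w \<in> W \<Longrightarrow>
      blinfun_apply U (tensor V v w) = tensor V (S v) (T w)"
proof -
  have SV: "S v \<in> V" and TW: "w \<in> W \<Longrightarrow> T w \<in> W" for v w
    using S T by (auto simp: unitary_on_def dest: bopD(2))
  let ?e = "\<lambda>(v, w). tensor V v w"
  let ?e' = "\<lambda>(v, w). tensor V (S v) (T w)"
  have gram: "cinner (?e x) (?e y) = cinner (?e' x) (?e' y)" if "x \<in> V \<times> W" "y \<in> V \<times> W" for x y
    using that S T SV unfolding unitary_on_def by (auto simp: cinner_tensor[OF V])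
  have im: "?e' ` (V \<times> W) = tensors V W"
  proof
    show "?e' ` (V \<times> W) \<subseteq> tensors V W" using SV TW by (auto simp: tensors_def)
    show "tensors V W \<subseteq> ?e' ` (V \<times> W)"
    proof
      fix t assume "t \<in> tensors V W"
      then obtain v w where vw: "v \<in> V" "w \<in> W" "t = tensor V v w" by (auto simp: tensors_def)
      have "blinfun_apply S ` V = V" "blinfun_apply T ` W = W" using S T by (auto simp: unitary_on_def)
      with vw(1,2) obtain v' w' where "v' \<in> V" "w' \<in> W" "v = S v'" "w = T w'" by blast
      then show "t \<in> ?e' ` (V \<times> W)" using vw(3) by (intro image_eqI[of _ _ "(v', w')"]) auto
    qed
  qed
  obtain U where U: "clin U" "\<And>x. x \<in> V \<times> W \<Longrightarrow> blinfun_apply U (?e x) = ?e' x"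
    "\<And>u v. u \<in> tensor_space V W \<Longrightarrow> v \<in> tensor_space V W \<Longrightarrow>
      cinner (blinfun_apply U u) (blinfun_apply U v) = cinner u v"
    "blinfun_apply U ` tensor_space V W = tensor_space V W"
    "\<And>u. blinfun_apply U u \<in> tensor_space V W"
    "\<And>u. (\<And>v. v \<in> tensor_space V W \<Longrightarrow> cinner v u = 0) \<Longrightarrow> blinfun_apply U u = 0"
    by (rule gram_isometry[of "V \<times> W" ?e ?e', OF gram, folded tensors_def, unfolded im, folded tensor_space_eq])
      (assumption, assumption, rule that, assumption+, blast)
  show thesis
  proof (rule that[of U])
    show "unitary_on (tensor_space V W) U"
      using U bop_intro[OF U(1,5,6)] by (auto simp: unitary_on_def)
    show "U (tensor V v w) = tensor V (S v) (T w)" if "v \<in> V" "w \<in> W" for v w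
      using U(2)[of "(v, w)"] that by simp
  qed
qed

lemma tensor_rep:
  fixes G (structure)
  assumes G: "group G" and \<sigma>: "unitary_rep G V \<sigma>" and \<tau>: "unitary_rep G W \<tau>"
  shows unitary_rep_tensor_rep: "unitary_rep G (tensor_space V W) (tensor_rep V W \<sigma> \<tau>)"
    and tensor_rep_apply: "g \<in> carrier G \<Longrightarrow> v \<in> V \<Longrightarrow> w \<in> W \<Longrightarrow>
      tensor_rep V W \<sigma> \<tau> g (tensor V v w) =
      tensor V (\<sigma> g v) (\<tau> g w)"
proof -
  interpret group G by (rule G)
  note s = unitary_repD[OF G \<sigma>] and t = unitary_repD[OF G \<tau>]
  have main: "unitary_on (tensor_space V W) (tensor_rep V W \<sigma> \<tau> g) \<and> (\<forall>v\<in>V. \<forall>w\<in>W.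
      tensor_rep V W \<sigma> \<tau> g (tensor V v w) =
      tensor V (\<sigma> g v) (\<tau> g w))" if g: "g \<in> carrier G" for g
  proof -
    have "unitary_on V (\<sigma> g)" "unitary_on W (\<tau> g)" using \<sigma> \<tau> g by (auto simp: unitary_rep_def)
    from tensor_unitary[OF s(1) t(1) this] obtain U where U: "unitary_on (tensor_space V W) U"
      "\<And>v w. v \<in> V \<Longrightarrow> w \<in> W \<Longrightarrow> blinfun_apply U (tensor V v w) =
        tensor V (\<sigma> g v) (\<tau> g w)" by blast
    have "tensor_rep V W \<sigma> \<tau> g = U"
      unfolding tensor_rep_def
    proof (rule the_equality)
      show "U \<in> bop (tensor_space V W) \<and> (\<forall>v\<in>V. \<forall>w\<in>W. blinfun_apply U (tensor V v w) =
          tensor V (\<sigma> g v) (\<tau> g w))"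
        using U by (auto simp: unitary_on_def)
      then show "T = U" if "T \<in> bop (tensor_space V W) \<and> (\<forall>v\<in>V. \<forall>w\<in>W. blinfun_apply T (tensor V v w) =
          tensor V (\<sigma> g v) (\<tau> g w))" for T
        using that by (intro bop_tensor_eqI[of _ V W]) auto
    qed
    then show ?thesis using U by simp
  qed
  show app: "tensor_rep V W \<sigma> \<tau> g (tensor V v w) =
      tensor V (\<sigma> g v) (\<tau> g w)" if "g \<in> carrier G" "v \<in> V" "w \<in> W" for g v w
    using main that by blast
  have bop: "tensor_rep V W \<sigma> \<tau> g \<in> bop (tensor_space V W)" if "g \<in> carrier G" for g
    using main[OF that] by (simp add: unitary_on_def)
  show "unitary_rep G (tensor_space V W) (tensor_rep V W \<sigma> \<tau>)"
    unfolding unitary_rep_def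
  proof (intro conjI ballI hilbert_tensor_space)
    show "unitary_on (tensor_space V W) (tensor_rep V W \<sigma> \<tau> g)" if "g \<in> carrier G" for g
      using main[OF that] by simp
    fix g h assume gh: "g \<in> carrier G" "h \<in> carrier G"
    show "tensor_rep V W \<sigma> \<tau> (g \<otimes> h) = tensor_rep V W \<sigma> \<tau> g o\<^sub>L tensor_rep V W \<sigma> \<tau> h"
      using gh s t
      by (intro bop_tensor_eqI[of _ V W] bop bop_closed[OF hilbert_tensor_space])
        (simp_all add: app bopD(2)[OF s(2)] bopD(2)[OF t(2)])
  qed
qed

text \<open>T \<otimes> 1 is equivariant because \<tau>(g) \<tau>(g^-1) cancels in the second
  factor. Writing it as J* diag(T) J makes complete positivity and the bound by the squared norm of
  J immediate.\<close>

lemma ampliation_G_map: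
  fixes G (structure) and V :: "'a::chilbert_space set" and W :: "'b::chilbert_space set"
  assumes G: "group G" and \<sigma>: "unitary_rep G V \<sigma>" and \<tau>: "unitary_rep G W \<tau>"
  obtains \<alpha> K where
    "G_map G V \<sigma> (bop V) (tensor_space V W) (tensor_rep V W \<sigma> \<tau>) (bop (tensor_space V W)) \<alpha>"
    "\<And>T. T \<in> bop V \<Longrightarrow> norm (\<alpha> T) \<le> K * norm T"
proof -
  interpret group G by (rule G)
  note s = unitary_repD[OF G \<sigma>] and t = unitary_repD[OF G \<tau>]
  note V = s(1) and W = t(1)
  define Z where "Z = tensor_space V W"
  have Z: "hilbert Z" unfolding Z_def by (rule hilbert_tensor_space)
  let ?e = "\<lambda>(v, w). tensor V v w"
  let ?e' = "\<lambda>(v, w). tensor W w v"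
  \<comment> \<open>In the flipped picture \<open>W \<otimes> V\<close>, an operator on \<open>V\<close> acts coordinatewise.\<close>
  have gram: "cinner (?e x) (?e y) = cinner (?e' x) (?e' y)" if "x \<in> V \<times> W" "y \<in> V \<times> W" for x y
    using that by (auto simp: cinner_tensor[OF V] cinner_tensor[OF W])
  obtain J :: "('a, 'b) ell2 \<Rightarrow>\<^sub>L ('b, 'a) ell2" where
    J: "clin J" "\<And>x. x \<in> V \<times> W \<Longrightarrow> blinfun_apply J (?e x) = ?e' x"
    "\<And>u v. u \<in> Z \<Longrightarrow> v \<in> Z \<Longrightarrow> cinner (blinfun_apply J u) (blinfun_apply J v) = cinner u v"
    "\<And>u. (\<And>v. v \<in> Z \<Longrightarrow> cinner v u = 0) \<Longrightarrow> blinfun_apply J u = 0"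
    by (rule gram_isometry[of "V \<times> W" ?e ?e', OF gram, folded tensors_def, folded tensor_space_eq, folded Z_def])
      (assumption, assumption, rule that, assumption+, blast)
  have Je: "J (tensor V v w) = tensor W w v" if "v \<in> V" "w \<in> W" for v w
    using J(2)[of "(v, w)"] that by simp
  have JP: "J (bop_id Z x) = J x" for x
  proof -
    have "J (x - bop_id Z x) = 0" by (rule J(4)) (simp add: cinner_diff cinner_bop_id[OF Z])
    then show ?thesis by (simp add: blinfun.diff_right)
  qed
  \<comment> \<open>J annihilates the orthogonal complement of Z, so its adjoint takes values in
    Z.\<close>
  have adjJ: "adj J y \<in> Z" for y
  proof -
    have "adj J y = bop_id Z (adj J y)"
      by (rule vector_eq_ldot[THEN iffD1]) (simp add: inner_bop_id[OF Z, symmetric] inner_adj_right JP)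
    then show ?thesis by (metis bopD(2) bop_id_in_bop Z)
  qed
  have JJ: "adj J (J u) = u" if "u \<in> Z" for u
  proof (rule hilbert_riesz_unique[OF Z adjJ that])
    show "inner w (adj J (J u)) = inner w u" if "w \<in> Z" for w
      using J(3)[OF that \<open>u \<in> Z\<close>] by (metis inner_adj_right Re_cinner)
  qed
  define \<alpha> where "\<alpha> T = adj J o\<^sub>L diag_op (\<lambda>_. T) o\<^sub>L J" for T :: "'a \<Rightarrow>\<^sub>L 'a"
  have dg: "ell2_apply (diag_op (\<lambda>_. T) f) i = T (ell2_apply f i)" for T :: "'a \<Rightarrow>\<^sub>L 'a" and f :: "('b, 'a) ell2" and i
    by (rule ell2_apply_diag_op[of "\<lambda>_. T" "norm T"]) simp
  have \<alpha>: "\<alpha> T (tensor V v w) = tensor V (T v) w" if T: "T \<in> bop V" and vw: "v \<in> V" "w \<in> W" for T v w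
  proof -
    have "diag_op (\<lambda>_. T) (tensor W w v) = tensor W w (T v)"
      by (rule ell2_eqI) (simp add: dg tensor_apply[OF W vw(2)] bopD(4)[OF T])
    then show ?thesis
      using vw bopD(2)[OF T] JJ[of "tensor V (T v) w"] tensor_in_tensor_space[of "T v" V w W]
      by (simp add: \<alpha>_def Je[OF vw] Z_def) (metis Je)
  qed
  have bop: "\<alpha> T \<in> bop Z" if T: "T \<in> bop V" for T
  proof (rule bop_intro)
    show "clin (\<alpha> T)" unfolding \<alpha>_def
      by (intro clin_compose clin_adj J clin_diag_op[where K = "norm T"] bopD(1)[OF T]) simp
    show "\<alpha> T x \<in> Z" for x by (simp add: \<alpha>_def adjJ)
    show "\<alpha> T x = 0" if "\<And>v. v \<in> Z \<Longrightarrow> cinner v x = 0" for x using J(4)[OF that] by (simp add: \<alpha>_def)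
  qed
  note eqI = bop_tensor_eqI[of _ V W, folded Z_def]
  note tr = tensor_rep_apply[OF G \<sigma> \<tau>]
  note trb = unitary_repD(2)[OF G unitary_rep_tensor_rep[OF G \<sigma> \<tau>], folded Z_def]
  have "G_map G V \<sigma> (bop V) Z (tensor_rep V W \<sigma> \<tau>) (bop Z) \<alpha>"
    unfolding G_map_def
  proof (intro conjI ballI allI)
    show "\<alpha> ` bop V \<subseteq> bop Z" using bop by blast
    show "\<alpha> (S + T) = \<alpha> S + \<alpha> T" for S T
      by (rule blinfun_eqI) (simp add: \<alpha>_def blinfun.add_left blinfun.add_right[symmetric],
        rule arg_cong[of _ _ "blinfun_apply (adj J)"], rule ell2_eqI, simp add: dg blinfun.add_left)
    show "\<alpha> (a *\<^sub>C T) = a *\<^sub>C \<alpha> T" for a T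
      by (rule blinfun_eqI) (simp add: \<alpha>_def clinD[OF clin_adj[OF J(1)], symmetric],
        rule arg_cong[of _ _ "blinfun_apply (adj J)"], rule ell2_eqI, simp add: dg)
    show "\<alpha> (bop_id V) = bop_id Z"
      by (rule eqI[OF bop[OF bop_id_in_bop[OF V]] bop_id_in_bop[OF Z]])
        (simp add: \<alpha> bop_id_in_bop[OF V] bop_id_apply[OF V] bop_id_apply[OF Z] Z_def
          bop_id_apply[OF hilbert_tensor_space] tensor_in_tensor_space)
    show "completely_positive (bop V) \<alpha>"
      unfolding completely_positive_def \<alpha>_def
    proof (intro allI impI pos_matrix_compress J)
      fix n A assume A: "(\<forall>i<n. \<forall>j<n. A i j \<in> bop V) \<and> pos_matrix n A"
      show "pos_matrix n (\<lambda>i j. diag_op (\<lambda>_. A i j))"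
        by (rule pos_matrix_diag_op[where K = "\<lambda>i j. norm (A i j)"]) (use A in auto)
    qed
    fix g T assume g: "g \<in> carrier G" and T: "T \<in> bop V"
    have gi: "inv g \<in> carrier G" using g by simp
    have cT: "conj_act G \<sigma> g T \<in> bop V"
      unfolding conj_act_def by (intro bop_closed[OF V] s T g gi)
    show "\<alpha> (conj_act G \<sigma> g T) = conj_act G (tensor_rep V W \<sigma> \<tau>) g (\<alpha> T)"
    proof (rule eqI[OF bop[OF cT]])
      show "conj_act G (tensor_rep V W \<sigma> \<tau>) g (\<alpha> T) \<in> bop Z"
        unfolding conj_act_def by (intro bop_closed[OF Z] trb bop T g gi)
      fix v w assume vw: "v \<in> V" "w \<in> W"
      have "\<tau> g (\<tau> (inv g) w) = w"
        using arg_cong[OF t(5)[OF g], of "\<lambda>R. blinfun_apply R w"] by (simp add: bop_id_apply[OF W vw(2)])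
      then show "\<alpha> (conj_act G \<sigma> g T) (tensor V v w) = conj_act G (tensor_rep V W \<sigma> \<tau>) g (\<alpha> T) (tensor V v w)"
        using vw unfolding \<alpha>[OF cT vw]
        by (simp add: conj_act_def tr g gi \<alpha>[OF T] bopD(2)[OF s(2)[OF gi]]
            bopD(2)[OF t(2)[OF gi]] bopD(2)[OF T])
    qed
  qed
  moreover have "norm (\<alpha> T) \<le> (norm J * norm J) * norm T" for T
  proof -
    have "norm (\<alpha> T) \<le> norm (adj J o\<^sub>L diag_op (\<lambda>_. T)) * norm J"
      unfolding \<alpha>_def by (rule norm_blinfun_compose)
    also have "\<dots> \<le> (norm (adj J) * norm (diag_op (\<lambda>_::'b. T))) * norm J"
      by (intro mult_right_mono norm_blinfun_compose) auto
    also have "\<dots> \<le> (norm J * norm T) * norm J"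
      by (intro mult_right_mono mult_mono norm_diag_op) auto
    finally show ?thesis by (simp add: mult_ac)
  qed
  ultimately show thesis using that unfolding Z_def by blast
qed

section \<open>Induced representations\<close>

text \<open>The cocycle of the section s = \<open>coset_rep\<close>, namely s(c)^-1 g s(g^-1 c),
  that twists the translation of cosets in the induced representation.\<close>

definition coset_shift :: "('g, 'm) monoid_scheme \<Rightarrow> 'g \<Rightarrow> 'g set \<Rightarrow> 'g" where
  "coset_shift G g c =
    inv\<^bsub>G\<^esub> (coset_rep c) \<otimes>\<^bsub>G\<^esub> g \<otimes>\<^bsub>G\<^esub> coset_rep (inv\<^bsub>G\<^esub> g <#\<^bsub>G\<^esub> c)"

lemma has_sum_extend_zero:
  assumes "(f has_sum s) A" "\<And>x. x \<in> A \<Longrightarrow> g x = f x" "\<And>x. x \<notin> A \<Longrightarrow> g x = 0"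
  shows "(g has_sum s) UNIV"
proof -
  have "(f has_sum s) A \<longleftrightarrow> (g has_sum s) UNIV"
    by (rule has_sum_cong_neutral) (use assms(2,3) in auto)
  then show ?thesis using assms(1) by simp
qed

lemma has_sum_restrict_support:
  assumes "(f has_sum s) UNIV" "\<And>x. x \<notin> A \<Longrightarrow> f x = 0"
  shows "(f has_sum s) A"
proof -
  have "(f has_sum s) A \<longleftrightarrow> (f has_sum s) UNIV"
    by (rule has_sum_cong_neutral) (use assms(2) in auto)
  then show ?thesis using assms(1) by simp
qed

context group begin

lemma lcosets_translate:
  assumes L: "subgroup L G" and c: "c \<in> lcosets L"
  shows "g \<in> carrier G \<Longrightarrow> g <# c \<in> lcosets L"
    and "g \<in> carrier G \<Longrightarrow> h \<in> carrier G \<Longrightarrow> g <# (h <# c) = (g \<otimes> h) <# c"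
    and "\<one> <# c = c"
    and "coset_rep c \<in> carrier G"
    and "coset_rep c \<in> c"
proof -
  have Ls: "L \<subseteq> carrier G" using L by (rule subgroup.subset)
  obtain a where a: "a \<in> carrier G" "c = a <# L" using c unfolding LCOSETS_def by auto
  have cs: "c \<subseteq> carrier G" by (rule subgroup.lcosets_carrier[OF L is_group c])
  show "g \<in> carrier G \<Longrightarrow> g <# c \<in> lcosets L"
    using a by (auto simp: lcos_m_assoc[OF Ls] LCOSETS_def)
  show "g \<in> carrier G \<Longrightarrow> h \<in> carrier G \<Longrightarrow> g <# (h <# c) = (g \<otimes> h) <# c"
    by (rule lcos_m_assoc[OF cs])
  show "\<one> <# c = c" by (rule lcos_mult_one[OF cs])
  have "a \<in> c" using lcos_self[OF a(1) L] a(2) by simp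
  then show "coset_rep c \<in> c" unfolding coset_rep_def by (rule someI)
  then show "coset_rep c \<in> carrier G" using cs by blast
qed

lemma coset_shift_mem:
  assumes L: "subgroup L G" and c: "c \<in> lcosets L" and g: "g \<in> carrier G"
  shows "coset_shift G g c \<in> L"
proof -
  note t = lcosets_translate[OF L]
  obtain a where a: "a \<in> carrier G" "c = a <# L" using c unfolding LCOSETS_def by auto
  have crep: "c = coset_rep c <# L"
    using l_repr_independence[OF _ a(1) L, of "coset_rep c"] t(5)[OF c] a(2) by simp
  have d: "inv g <# c \<in> lcosets L" using t(1)[OF c] g by simp
  \<comment> \<open>The representative of g^-1 c is g^-1 x with x in c. Thus the shift is s(c)^-1 x,
    a quotient of two elements of the same left coset.\<close>
  obtain x where x: "x \<in> c" "coset_rep (inv g <# c) = inv g \<otimes> x"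
    using t(5)[OF d] unfolding l_coset_def by auto
  have xc: "x \<in> carrier G" using x(1) subgroup.lcosets_carrier[OF L is_group c] by blast
  have "coset_shift G g c = inv (coset_rep c) \<otimes> x"
    unfolding coset_shift_def x(2) using g xc t(4)[OF c] m_assoc[of g "inv g" x, symmetric]
    by (simp add: m_assoc)
  also have "\<dots> \<in> L"
    by (rule subgroup.lcos_module_imp[OF L is_group t(4)[OF c]]) (use x(1) crep in simp)
  finally show ?thesis .
qed

text \<open>The cocycle identity, by cancellation of s(g^-1 c) against its inverse. It is what makes
  the induced operators multiplicative.\<close>

lemma coset_shift_mult:
  assumes L: "subgroup L G" and c: "c \<in> lcosets L" and g: "g \<in> carrier G" and h: "h \<in> carrier G"
  shows "coset_shift G (g \<otimes> h) c = coset_shift G g c \<otimes> coset_shift G h (inv g <# c)"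
proof -
  note t = lcosets_translate[OF L]
  have d: "inv g <# c \<in> lcosets L" using t(1)[OF c] g by simp
  have e: "inv h <# (inv g <# c) \<in> lcosets L" using t(1)[OF d] h by simp
  have "inv (g \<otimes> h) <# c = inv h <# (inv g <# c)"
    using g h t(2)[OF c] by (simp add: inv_mult_group)
  moreover have "x \<otimes> (inv x \<otimes> y) = y" if "x \<in> carrier G" "y \<in> carrier G" for x y
    using that by (simp add: m_assoc[symmetric])
  ultimately show ?thesis
    using g h t(4)[OF c] t(4)[OF d] t(4)[OF e] by (simp add: coset_shift_def m_assoc)
qed

lemma coset_shift_one:
  assumes "subgroup L G" "c \<in> lcosets L"
  shows "coset_shift G \<one> c = \<one>"
  using lcosets_translate[OF assms] by (simp add: coset_shift_def)

lemma coset_shift_inv: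
  assumes L: "subgroup L G" and c: "c \<in> lcosets L" and g: "g \<in> carrier G"
  shows "coset_shift G (inv g) (inv g <# c) = inv (coset_shift G g c)"
proof -
  note t = lcosets_translate[OF L]
  have d: "inv g <# c \<in> lcosets L" using t(1)[OF c] g by simp
  have s: "coset_shift G g c \<in> carrier G" "coset_shift G (inv g) (inv g <# c) \<in> carrier G"
    using coset_shift_mem[OF L c g] coset_shift_mem[OF L d inv_closed[OF g]] subgroup.subset[OF L] by auto
  have "coset_shift G g c \<otimes> coset_shift G (inv g) (inv g <# c) = \<one>"
    using coset_shift_mult[OF L c g inv_closed[OF g]] coset_shift_one[OF L c] g by simp
  then show ?thesis using s inv_equality inv_comm by metis
qed

lemma bij_betw_lcosets:
  assumes L: "subgroup L G" and g: "g \<in> carrier G"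
  shows "bij_betw (\<lambda>c. g <# c) (lcosets L) (lcosets L)"
proof (rule bij_betw_byWitness[where f' = "\<lambda>c. inv g <# c"])
  note t = lcosets_translate[OF L]
  show "\<forall>c\<in>lcosets L. inv g <# (g <# c) = c" "\<forall>c\<in>lcosets L. g <# (inv g <# c) = c"
    using g by (auto simp: t(2,3))
  show "(\<lambda>c. g <# c) ` (lcosets L) \<subseteq> (lcosets L)" "(\<lambda>c. inv g <# c) ` (lcosets L) \<subseteq> (lcosets L)"
    using g t(1) by auto
qed

end

section \<open>The Hilbert space of an induced representation and its operators\<close>

lemma ell2_single_le: "norm (single i x) \<le> norm x"
  for i :: 'i and x :: "'a::chilbert_space"
proof -
  have "norm (sproj i :: ('i, 'a) ell2 \<Rightarrow>\<^sub>L 'a) \<le> 1"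
    by (rule norm_blinfun_bound) (auto simp: norm_ell2_apply_le)
  then have "norm (single i :: 'a \<Rightarrow>\<^sub>L ('i, 'a) ell2) \<le> 1" 
    by (simp only: norm_adj adj_single(2)[symmetric])
  then have "norm (single i :: 'a \<Rightarrow>\<^sub>L ('i, 'a) ell2) * norm x \<le> 1 * norm x" by (intro mult_right_mono) auto
  with norm_blinfun[of "single i" x] show ?thesis by linarith
qed

lemma hilbert_ind_space:
  assumes V: "hilbert V" shows "hilbert (ind_space G L V)"
proof -
  have eq: "ind_space G L V = (\<Inter>c\<in>lcosets\<^bsub>G\<^esub> L. blinfun_apply (sproj c) -` V) \<inter>
      (\<Inter>c\<in>- (lcosets\<^bsub>G\<^esub> L). {f. sproj c f = 0})"
    by (auto simp: ind_space_def)
  have cV: "closed_subspace V" using V by (simp add: hilbert_iff)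
  have "closed_subspace (\<Inter>c\<in>lcosets\<^bsub>G\<^esub> L. blinfun_apply (sproj c) -` V)"
    by (intro closed_subspace_INT closed_subspace_vimage blinfun.bounded_linear_right cV)
  moreover have "closed_subspace (\<Inter>c\<in>- (lcosets\<^bsub>G\<^esub> L). {f. sproj c f = 0})"
    by (intro closed_subspace_INT closed_subspace_kernel blinfun.bounded_linear_right)
  ultimately have "closed_subspace (ind_space G L V)"
    unfolding eq by (auto simp: closed_subspace_def intro!: subspace_inter closed_Int)
  moreover have "a *\<^sub>C f \<in> ind_space G L V" if "f \<in> ind_space G L V" for a f
    using that hilbertD(3)[OF V] by (auto simp: ind_space_def scaleC_simps)
  ultimately show ?thesis by (simp add: hilbert_iff)
qed

lemma ind_space_coord: "hilbert V \<Longrightarrow> f \<in> ind_space G L V \<Longrightarrow> ell2_apply f c \<in> V"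
  using hilbertD(4)[of V] by (cases "c \<in> lcosets\<^bsub>G\<^esub> L") (auto simp: ind_space_def)

lemma single_in_ind_space:
  "hilbert V \<Longrightarrow> c \<in> lcosets\<^bsub>G\<^esub> L \<Longrightarrow> v \<in> V \<Longrightarrow> single c v \<in> ind_space G L V"
  using hilbertD(4)[of V] by (auto simp: ind_space_def)

lemma ind_space_orth:
  assumes "hilbert V" "c \<in> lcosets\<^bsub>G\<^esub> L" "\<And>h. h \<in> ind_space G L V \<Longrightarrow> cinner h f = 0" "v \<in> V"
  shows "cinner v (ell2_apply f c) = 0"
  using assms(3)[OF single_in_ind_space[OF assms(1,2,4)]] by (simp add: cinner_single)

text \<open>The setting is instantiated twice, with \<sigma> and with the restriction of \<pi> to
  the subgroup.\<close>

locale induction_data =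
  fixes G :: "('g, 'm) monoid_scheme" (structure) and L :: "'g set"
    and V :: "'a::chilbert_space set" and \<sigma> :: "'g \<Rightarrow> 'a \<Rightarrow>\<^sub>L 'a"
  assumes G: "group G" and L: "subgroup L G" and \<sigma>: "unitary_rep (G\<lparr>carrier := L\<rparr>) V \<sigma>"
begin

sublocale group G by (rule G)

lemma group_L: "group (G\<lparr>carrier := L\<rparr>)" by (rule subgroup_imp_group[OF L])

lemma inv_L: "l \<in> L \<Longrightarrow> inv\<^bsub>G\<lparr>carrier := L\<rparr>\<^esub> l = inv l" by (rule m_inv_consistent[OF L])

lemma sigma:
  shows hilbert_V: "hilbert V" and sigma_bop: "l \<in> L \<Longrightarrow> \<sigma> l \<in> bop V"
    and sigma_mult: "l \<in> L \<Longrightarrow> m \<in> L \<Longrightarrow> \<sigma> (l \<otimes> m) = \<sigma> l o\<^sub>L \<sigma> m"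
    and sigma_one: "\<sigma> \<one> = bop_id V"
  using unitary_repD[OF group_L \<sigma>] by auto

lemma sigma_iso: "l \<in> L \<Longrightarrow> x \<in> V \<Longrightarrow> y \<in> V \<Longrightarrow> cinner (\<sigma> l x) (\<sigma> l y) = cinner x y"
  using \<sigma> by (simp add: unitary_rep_def unitary_on_def)

text \<open>On the ambient space \<sigma>(l) is a partial isometry: first the projection onto V,
  then an isometry.\<close>

lemma norm_sigma_le: "l \<in> L \<Longrightarrow> norm (\<sigma> l x) \<le> norm x"
proof -
  assume l: "l \<in> L"
  have P: "bop_id V x \<in> V" by (rule bopD(2)[OF bop_id_in_bop[OF hilbert_V]])
  have "complex_of_real ((norm (\<sigma> l (bop_id V x)))\<^sup>2) = complex_of_real ((norm (bop_id V x))\<^sup>2)"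
    using sigma_iso[OF l P P] by (simp only: cinner_same)
  then have "norm (\<sigma> l (bop_id V x)) = norm (bop_id V x)"
    by (simp only: of_real_eq_iff) (simp add: power2_eq_iff_nonneg)
  then show ?thesis
    using norm_bop_id_le[OF hilbert_V, of x] by (simp add: bop_comp_id(3)[OF hilbert_V sigma_bop[OF l]])
qed

lemma ind_fun_eq:
  "ind_fun G L \<sigma> g f c =
    (if c \<in> lcosets L then \<sigma> (coset_shift G g c) (f (inv g <# c)) else 0)"
  by (simp add: ind_fun_def coset_shift_def Let_def)

text \<open>Translation permutes the cosets and each \<sigma>(l) is a contraction, so the
  transformed function is square summable with norm at most that of f. This validates both
  abstractions in \<open>ind_rep\<close>.\<close>

lemma ell2_apply_ind_rep:
  assumes g: "g \<in> carrier G"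
  shows "ell2_apply (ind_rep G L \<sigma> g f) c =
    (if c \<in> lcosets L then \<sigma> (coset_shift G g c) (ell2_apply f (inv g <# c)) else 0)"
proof -
  let ?N = "\<lambda>f c. if c \<in> lcosets L then (norm (ell2_apply f (inv g <# c)))\<^sup>2 else 0"
  have N: "(?N f has_sum (\<Sum>\<^sub>\<infinity>c\<in>lcosets L. (norm (ell2_apply f c))\<^sup>2)) UNIV"
    and S: "(\<Sum>\<^sub>\<infinity>c\<in>lcosets L. (norm (ell2_apply f c))\<^sup>2) \<le> (norm f)\<^sup>2" for f :: "('g set, 'a) ell2"
  proof -
    have sA: "(\<lambda>c. (norm (ell2_apply f c))\<^sup>2) summable_on lcosets L"
      by (rule summable_on_subset_banach[OF ell2_summable]) simp
    have "((\<lambda>c. (norm (ell2_apply f (inv g <# c)))\<^sup>2) has_sum (\<Sum>\<^sub>\<infinity>c\<in>lcosets L. (norm (ell2_apply f c))\<^sup>2)) (lcosets L)"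
      using has_sum_infsum[OF sA]
      by (subst has_sum_reindex_bij_betw[OF bij_betw_lcosets[OF L inv_closed[OF g]]])
    then show "(?N f has_sum (\<Sum>\<^sub>\<infinity>c\<in>lcosets L. (norm (ell2_apply f c))\<^sup>2)) UNIV"
      by (rule has_sum_extend_zero) auto
    show "(\<Sum>\<^sub>\<infinity>c\<in>lcosets L. (norm (ell2_apply f c))\<^sup>2) \<le> (norm f)\<^sup>2"
      unfolding norm_ell2_power2 by (rule infsum_mono_neutral) (auto simp: sA ell2_summable)
  qed
  have le: "(norm (ind_fun G L \<sigma> g (ell2_apply f) c))\<^sup>2 \<le> ?N f c" for f c
    by (auto simp: ind_fun_eq intro!: power_mono norm_sigma_le coset_shift_mem[OF L _ g])
  have summ: "(\<lambda>c. (norm (ind_fun G L \<sigma> g (ell2_apply f) c))\<^sup>2) summable_on UNIV" for f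
    by (rule summable_on_comparison_test[OF has_sum_imp_summable[OF N[of f]]]) (auto simp: le)
  define h where "h f = Abs_ell2 (ind_fun G L \<sigma> g (ell2_apply f))" for f
  have h: "ell2_apply (h f) = ind_fun G L \<sigma> g (ell2_apply f)" for f
    unfolding h_def by (rule Abs_ell2_inverse) (simp add: summ)
  have nh: "norm (h f) \<le> norm f" for f
  proof (rule power2_le_imp_le)
    have "(norm (h f))\<^sup>2 \<le> (\<Sum>\<^sub>\<infinity>c. ?N f c)"
      unfolding norm_ell2_power2[of "h f"] h
      by (rule infsum_mono[OF summ has_sum_imp_summable[OF N] le])
    also have "\<dots> \<le> (norm f)\<^sup>2" using infsumI[OF N[of f]] S[of f] by simp
    finally show "(norm (h f))\<^sup>2 \<le> (norm f)\<^sup>2" .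
  qed simp
  have "bounded_linear h"
    by (rule bounded_linear_intro[where K = 1])
      (auto intro!: ell2_eqI simp: h ind_fun_eq blinfun.add_right blinfun.scaleR_right nh)
  then have "blinfun_apply (ind_rep G L \<sigma> g) = h"
    unfolding ind_rep_def h_def[symmetric] by (rule bounded_linear_Blinfun_apply)
  then show ?thesis by (simp add: h ind_fun_eq)
qed

lemma ind_rep_bop:
  assumes g: "g \<in> carrier G"
  shows "ind_rep G L \<sigma> g \<in> bop (ind_space G L V)"
proof (rule bop_intro)
  note app = ell2_apply_ind_rep[OF g]
  have sb: "\<sigma> (coset_shift G g c) \<in> bop V" if "c \<in> lcosets L" for c
    by (intro sigma_bop coset_shift_mem[OF L that g])
  show "clin (ind_rep G L \<sigma> g)"
    unfolding clin_def by (auto intro!: ell2_eqI simp: app bopD(4)[OF sb] scaleC_simps)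
  show "ind_rep G L \<sigma> g f \<in> ind_space G L V" for f
    by (auto simp: ind_space_def app intro: bopD(2)[OF sb])
  fix f assume f: "\<And>v. v \<in> ind_space G L V \<Longrightarrow> cinner v f = 0"
  show "ind_rep G L \<sigma> g f = 0"
  proof (rule ell2_eqI)
    fix c
    show "ell2_apply (ind_rep G L \<sigma> g f) c = ell2_apply 0 c"
    proof (cases "c \<in> lcosets L")
      case True
      have "inv g <# c \<in> lcosets L" using lcosets_translate(1)[OF L True] g by simp
      then have "\<sigma> (coset_shift G g c) (ell2_apply f (inv g <# c)) = 0"
        by (intro bopD(3)[OF sb[OF True]] ind_space_orth[OF hilbert_V _ f])
      then show ?thesis using True by (simp add: app)
    qed (simp add: app)
  qed
qed

lemma unitary_rep_ind_rep: "unitary_rep G (ind_space G L V) (ind_rep G L \<sigma>)"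
proof -
  let ?H = "ind_space G L V" and ?\<rho> = "ind_rep G L \<sigma>"
  note t = lcosets_translate[OF L]
  have mult: "?\<rho> (g \<otimes> h) = ?\<rho> g o\<^sub>L ?\<rho> h" if g: "g \<in> carrier G" and h: "h \<in> carrier G" for g h
  proof (rule blinfun_eqI, rule ell2_eqI)
    fix f c
    show "ell2_apply (?\<rho> (g \<otimes> h) f) c = ell2_apply ((?\<rho> g o\<^sub>L ?\<rho> h) f) c"
    proof (cases "c \<in> lcosets L")
      case True
      have d: "inv g <# c \<in> lcosets L" using t(1)[OF True] g by simp
      have "inv (g \<otimes> h) <# c = inv h <# (inv g <# c)"
        using g h t(2)[OF True] by (simp add: inv_mult_group)
      then show ?thesis
        using True d g h
        by (simp add: ell2_apply_ind_rep coset_shift_mult[OF L] sigma_mult coset_shift_mem[OF L])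
    qed (use g h in \<open>simp add: ell2_apply_ind_rep\<close>)
  qed
  have one: "?\<rho> \<one> f = f" if f: "f \<in> ?H" for f
  proof (rule ell2_eqI)
    fix c show "ell2_apply (?\<rho> \<one> f) c = ell2_apply f c"
      using f ind_space_coord[OF hilbert_V f, of c]
      by (auto simp: ell2_apply_ind_rep coset_shift_one[OF L] sigma_one t(3) bop_id_apply[OF hilbert_V] ind_space_def)
  qed
  have unit: "unitary_on ?H (?\<rho> g)" if g: "g \<in> carrier G" for g
    unfolding unitary_on_def
  proof (intro conjI ballI)
    have gi: "inv g \<in> carrier G" using g by simp
    show "?\<rho> g \<in> bop ?H" by (rule ind_rep_bop[OF g])
    show "?\<rho> g ` ?H = ?H"
    proof
      show "?\<rho> g ` ?H \<subseteq> ?H" using bopD(2)[OF ind_rep_bop[OF g]] by blast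
      show "?H \<subseteq> ?\<rho> g ` ?H"
      proof
        fix f assume f: "f \<in> ?H"
        have "f = ?\<rho> g (?\<rho> (inv g) f)"
          using mult[OF g gi] one[OF f] g by (metis blinfun_apply_blinfun_compose r_inv)
        then show "f \<in> ?\<rho> g ` ?H" using bopD(2)[OF ind_rep_bop[OF gi]] by blast
      qed
    qed
    fix f f' assume f: "f \<in> ?H" "f' \<in> ?H"
    let ?k = "\<lambda>c. cinner (ell2_apply f c) (ell2_apply f' c)"
    have "(?k has_sum cinner f f') (lcosets L)"
      by (rule has_sum_restrict_support[OF cinner_ell2_has_sum]) (use f in \<open>simp add: ind_space_def\<close>)
    \<comment> \<open>The inner product is a sum over cosets, reindexed by translation; on each
      summand the operator \<sigma>(l) then preserves inner products of vectors of V.\<close>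
    then have "((\<lambda>c. ?k (inv g <# c)) has_sum cinner f f') (lcosets L)"
      by (subst has_sum_reindex_bij_betw[OF bij_betw_lcosets[OF L gi]])
    then have "((\<lambda>c. cinner (ell2_apply (?\<rho> g f) c) (ell2_apply (?\<rho> g f') c)) has_sum cinner f f') UNIV"
      by (rule has_sum_extend_zero)
        (use f in \<open>auto simp: ell2_apply_ind_rep[OF g] sigma_iso coset_shift_mem[OF L _ g] ind_space_coord[OF hilbert_V]\<close>)
    then show "cinner (?\<rho> g f) (?\<rho> g f') = cinner f f'"
      using cinner_ell2_has_sum has_sum_unique by blast
  qed
  show ?thesis
    unfolding unitary_rep_def using hilbert_ind_space[OF hilbert_V] unit mult by blast
qed

text \<open>The operator of g^-1 moves block c to block g^-1 c with a twist from L. This computes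
  the diagonal blocks of a conjugated operator.\<close>

lemma ind_rep_inv_single:
  assumes g: "g \<in> carrier G" and c: "c \<in> lcosets L"
  shows "ind_rep G L \<sigma> (inv g) (single c x) =
    single (inv g <# c) (blinfun_apply (\<sigma> (inv (coset_shift G g c))) x)"
proof (rule ell2_eqI)
  fix e
  note t = lcosets_translate[OF L]
  have gi: "inv g \<in> carrier G" using g by simp
  have d: "inv g <# c \<in> lcosets L" using t(1)[OF c gi] .
  have iff: "g <# e = c \<longleftrightarrow> e = inv g <# c" if "e \<in> lcosets L" for e
    using that c g by (auto simp: t(2,3))
  show "ell2_apply (ind_rep G L \<sigma> (inv g) (single c x)) e =
      ell2_apply (single (inv g <# c) (\<sigma> (inv (coset_shift G g c)) x)) e"
    using d iff[of e] coset_shift_inv[OF L c g] g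
    by (cases "e \<in> lcosets L") (auto simp: ell2_apply_ind_rep[OF gi] blinfun.zero_right)
qed

end

section \<open>Block-diagonal induction of equivariant maps\<close>

text \<open>An equivariant map of the subgroup commutes with conjugation, but is not a bimodule map for the
  operators of the representation; hence it can only be applied to the diagonal blocks.\<close>

lemma induced_G_map:
  fixes G :: "('g, 'm) monoid_scheme" (structure) and V :: "'a::chilbert_space set" and W :: "'b::chilbert_space set"
  assumes G: "group G" and L: "subgroup L G"
    and \<sigma>: "unitary_rep (G\<lparr>carrier := L\<rparr>) V \<sigma>" and \<pi>: "unitary_rep (G\<lparr>carrier := L\<rparr>) W \<pi>"
    and \<Psi>: "G_map (G\<lparr>carrier := L\<rparr>) V \<sigma> (bop V) W \<pi> (bop W) \<Psi>"
    and bound: "\<And>T. T \<in> bop V \<Longrightarrow> norm (\<Psi> T) \<le> K * norm T"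
  shows "G_map G (ind_space G L V) (ind_rep G L \<sigma>) (bop (ind_space G L V))
    (ind_space G L W) (ind_rep G L \<pi>) (bop (ind_space G L W))
    (\<lambda>T. diag_op (\<lambda>c. \<Psi> (sproj c o\<^sub>L T o\<^sub>L single c)))"
proof -
  interpret s: induction_data G L V \<sigma> by (intro induction_data.intro assms)
  interpret p: induction_data G L W \<pi> by (intro induction_data.intro assms)
  let ?V = "ind_space G L V" and ?W = "ind_space G L W"
  have hV: "hilbert ?V" and hW: "hilbert ?W"
    by (rule hilbert_ind_space[OF s.hilbert_V], rule hilbert_ind_space[OF p.hilbert_V])
  define b where "b c T = sproj c o\<^sub>L T o\<^sub>L single c"
    for c and T :: "('g set, 'a) ell2 \<Rightarrow>\<^sub>L ('g set, 'a) ell2"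
  have \<Psi>_bop: "\<Psi> T \<in> bop W" if "T \<in> bop V" for T using \<Psi> that by (auto simp: G_map_def)
  have \<Psi>_add: "\<Psi> (S + T) = \<Psi> S + \<Psi> T" if "S \<in> bop V" "T \<in> bop V" for S T
    using \<Psi> that by (simp add: G_map_def)
  have \<Psi>_scaleC: "\<Psi> (a *\<^sub>C T) = a *\<^sub>C \<Psi> T" if "T \<in> bop V" for a T
    using \<Psi> that by (simp add: G_map_def)
  have \<Psi>_zero: "\<Psi> 0 = 0"
  proof -
    have "norm (\<Psi> 0) \<le> 0" using bound[OF bop_closed(5)[OF s.hilbert_V]] by simp
    then show ?thesis by simp
  qed
  have b_bop: "b c T \<in> bop V" if T: "T \<in> bop ?V" for c T
  proof (rule bop_intro)
    show "clin (b c T)" unfolding b_def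
      by (intro clin_compose clin_sproj clin_single bopD(1)[OF T])
    show "b c T x \<in> V" for x
      using ind_space_coord[OF s.hilbert_V bopD(2)[OF T]] by (simp add: b_def)
    fix x assume x: "\<And>v. v \<in> V \<Longrightarrow> cinner v x = 0"
    have "T (single c x) = 0"
      by (rule bopD(3)[OF T]) (simp add: cinner_single x ind_space_coord[OF s.hilbert_V])
    then show "b c T x = 0" by (simp add: b_def)
  qed
  \<comment> \<open>Indices that are not cosets contribute zero blocks; with \<Psi>(0) = 0 this
    keeps \<delta> T within the operators on the induced space.\<close>
  have b_out: "b c T = 0" if "T \<in> bop ?V" "c \<notin> lcosets L" for c T
    using bopD(2)[OF that(1)] that(2) by (intro blinfun_eqI) (simp add: b_def ind_space_def)
  have b_norm: "norm (b c T) \<le> norm T" for c T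
  proof (rule norm_blinfun_bound)
    fix x
    have "norm (b c T x) \<le> norm (T (single c x))" by (simp add: b_def norm_ell2_apply_le)
    also have "\<dots> \<le> norm T * norm (single c x)" by (rule norm_blinfun)
    also have "\<dots> \<le> norm T * norm x" by (intro mult_left_mono ell2_single_le) auto
    finally show "norm (b c T x) \<le> norm T * norm x" .
  qed simp
  \<comment> \<open>The sign of K is unspecified, hence the absolute value when the norm of a block
    is estimated by that of T.\<close>
  have \<Psi>b: "norm (\<Psi> (b c T)) \<le> \<bar>K\<bar> * norm T" if "T \<in> bop ?V" for c T
  proof -
    have "norm (\<Psi> (b c T)) \<le> K * norm (b c T)" by (rule bound[OF b_bop[OF that]])
    also have "\<dots> \<le> \<bar>K\<bar> * norm (b c T)" by (intro mult_right_mono) auto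
    also have "\<dots> \<le> \<bar>K\<bar> * norm T" by (intro mult_left_mono b_norm) auto
    finally show ?thesis .
  qed
  define \<delta> where "\<delta> T = diag_op (\<lambda>c. \<Psi> (b c T))" for T
  have \<delta>: "ell2_apply (\<delta> T f) c = \<Psi> (b c T) (ell2_apply f c)" if "T \<in> bop ?V" for T f c
    unfolding \<delta>_def by (rule ell2_apply_diag_op[OF \<Psi>b[OF that]])
  have \<delta>_bop: "\<delta> T \<in> bop ?W" if T: "T \<in> bop ?V" for T
  proof (rule bop_intro)
    show "clin (\<delta> T)" unfolding \<delta>_def
      by (rule clin_diag_op[OF \<Psi>b[OF T] bopD(1)[OF \<Psi>_bop[OF b_bop[OF T]]]])
    show "\<delta> T f \<in> ?W" for f
      using bopD(2)[OF \<Psi>_bop[OF b_bop[OF T]]] by (auto simp: ind_space_def \<delta>[OF T] b_out[OF T] \<Psi>_zero)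
    fix f assume f: "\<And>v. v \<in> ?W \<Longrightarrow> cinner v f = 0"
    show "\<delta> T f = 0"
    proof (rule ell2_eqI)
      fix c
      show "ell2_apply (\<delta> T f) c = ell2_apply 0 c"
      proof (cases "c \<in> lcosets L")
        case True
        then have "\<Psi> (b c T) (ell2_apply f c) = 0"
          by (intro bopD(3)[OF \<Psi>_bop[OF b_bop[OF T]]] ind_space_orth[OF p.hilbert_V _ f])
        then show ?thesis by (simp add: \<delta>[OF T])
      qed (simp add: \<delta>[OF T] b_out[OF T] \<Psi>_zero)
    qed
  qed
  have "G_map G ?V (ind_rep G L \<sigma>) (bop ?V) ?W (ind_rep G L \<pi>) (bop ?W) \<delta>"
    unfolding G_map_def
  proof (intro conjI ballI allI)
    show "\<delta> ` bop ?V \<subseteq> bop ?W" using \<delta>_bop by blast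
    fix S T assume S: "S \<in> bop ?V" and T: "T \<in> bop ?V"
    have "b c (S + T) = b c S + b c T" for c
      by (rule blinfun_eqI) (simp add: b_def blinfun.add_left)
    then show "\<delta> (S + T) = \<delta> S + \<delta> T"
      by (intro blinfun_eqI ell2_eqI)
        (simp add: \<delta> bop_closed[OF hV] S T \<Psi>_add b_bop blinfun.add_left)
  next
    fix a T assume T: "T \<in> bop ?V"
    have "b c (a *\<^sub>C T) = a *\<^sub>C b c T" for c
      by (rule blinfun_eqI) (simp add: b_def)
    then show "\<delta> (a *\<^sub>C T) = a *\<^sub>C \<delta> T"
      by (intro blinfun_eqI ell2_eqI)
        (simp add: \<delta> bop_closed[OF hV] T \<Psi>_scaleC b_bop)
  next
    note idV = bop_id_in_bop[OF hV]
    have bid: "b c (bop_id ?V) = bop_id V" if c: "c \<in> lcosets L" for c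
    proof (rule bop_eqI[OF s.hilbert_V b_bop[OF idV] bop_id_in_bop[OF s.hilbert_V]])
      fix v w assume "v \<in> V" "w \<in> V"
      then show "cinner v (b c (bop_id ?V) w) = cinner v (bop_id V w)"
        using c by (simp add: b_def bop_id_apply[OF hV] bop_id_apply[OF s.hilbert_V] single_in_ind_space[OF s.hilbert_V])
    qed
    have \<Psi>id: "\<Psi> (bop_id V) = bop_id W" using \<Psi> by (simp add: G_map_def)
    show "\<delta> (bop_id ?V) = bop_id ?W"
    proof (rule bop_eqI[OF hW \<delta>_bop[OF idV] bop_id_in_bop[OF hW]])
      fix u f assume f: "f \<in> ?W"
      have "\<delta> (bop_id ?V) f = f"
      proof (rule ell2_eqI)
        fix c
        show "ell2_apply (\<delta> (bop_id ?V) f) c = ell2_apply f c"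
          using ind_space_coord[OF p.hilbert_V f, of c] f[unfolded ind_space_def]
          by (cases "c \<in> lcosets L")
            (simp_all add: \<delta>[OF idV] bid \<Psi>id bop_id_apply[OF p.hilbert_V] b_out[OF idV] \<Psi>_zero)
      qed
      then show "cinner u (\<delta> (bop_id ?V) f) = cinner u (bop_id ?W f)"
        by (simp add: bop_id_apply[OF hW f])
    qed
  next
    show "completely_positive (bop ?V) \<delta>"
      unfolding completely_positive_def \<delta>_def
    proof (intro allI impI, elim conjE)
      fix n A assume A: "\<forall>i<n. \<forall>j<n. A i j \<in> bop ?V" and pA: "pos_matrix n A"
      show "pos_matrix n (\<lambda>i j. diag_op (\<lambda>c. \<Psi> (b c (A i j))))"
      proof (rule pos_matrix_diag_op[where K = "\<lambda>i j. \<bar>K\<bar> * norm (A i j)"])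
        show "norm (\<Psi> (b c (A i j))) \<le> \<bar>K\<bar> * norm (A i j)" if "i < n" "j < n" for i j c
          using A that \<Psi>b by blast
        fix c
        have "pos_matrix n (\<lambda>i j. b c (A i j))"
          using pos_matrix_compress[OF pA clin_single, of c] by (simp add: b_def)
        moreover have "\<forall>i<n. \<forall>j<n. b c (A i j) \<in> bop V" using A b_bop by blast
        ultimately show "pos_matrix n (\<lambda>i j. \<Psi> (b c (A i j)))"
          using \<Psi> by (simp add: G_map_def completely_positive_def)
      qed
    qed
  next
    fix g T assume g: "g \<in> carrier G" and T: "T \<in> bop ?V"
    have gi: "inv g \<in> carrier G" using g by simp
    let ?T = "conj_act G (ind_rep G L \<sigma>) g T"
    have T': "?T \<in> bop ?V"
      unfolding conj_act_def by (intro bop_closed[OF hV] s.ind_rep_bop g gi T)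
    show "\<delta> ?T = conj_act G (ind_rep G L \<pi>) g (\<delta> T)"
    proof (rule blinfun_eqI, rule ell2_eqI)
      fix f c
      show "ell2_apply (\<delta> ?T f) c = ell2_apply (conj_act G (ind_rep G L \<pi>) g (\<delta> T) f) c"
      proof (cases "c \<in> lcosets L")
        case c: True
        define d where "d = inv g <# c"
        define l where "l = coset_shift G g c"
        have lL: "l \<in> L" unfolding l_def by (rule s.coset_shift_mem[OF L c g])
        have d: "d \<in> lcosets L" unfolding d_def by (rule s.lcosets_translate(1)[OF L c gi])
        have gd: "g <# d = c"
          using g unfolding d_def by (simp add: s.lcosets_translate(2,3)[OF L c])
        \<comment> \<open>Conjugation by g permutes the diagonal blocks and conjugates the block at
          d by an element l of L. Equivariance of \<Psi> over L alone therefore suffices.\<close>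
        have "b c ?T = conj_act (G\<lparr>carrier := L\<rparr>) \<sigma> l (b d T)"
          by (rule blinfun_eqI)
            (simp add: b_def conj_act_def s.inv_L[OF lL] s.ind_rep_inv_single[OF g c]
              s.ell2_apply_ind_rep[OF g] c flip: d_def l_def)
        then have "\<Psi> (b c ?T) = conj_act (G\<lparr>carrier := L\<rparr>) \<pi> l (\<Psi> (b d T))"
          using \<Psi> lL b_bop[OF T] by (simp add: G_map_def)
        then have "ell2_apply (\<delta> ?T f) c = \<pi> l (\<Psi> (b d T) (\<pi> (inv l) (ell2_apply f c)))"
          unfolding \<delta>[OF T'] by (simp add: conj_act_def s.inv_L[OF lL])
        \<comment> \<open>On the target side the inverse of l arises as the cocycle of g^-1 at
          d.\<close>
        also have "\<dots> = ell2_apply (conj_act G (ind_rep G L \<pi>) g (\<delta> T) f) c"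
          using s.coset_shift_inv[OF L c g, folded d_def l_def] g
          by (simp add: conj_act_def p.ell2_apply_ind_rep[OF g] p.ell2_apply_ind_rep[OF gi] c d gd
              \<delta>[OF T] flip: d_def l_def)
        finally show ?thesis .
      next
        case False
        then show ?thesis
          unfolding \<delta>[OF T'] b_out[OF T' False]
          by (simp add: \<Psi>_zero conj_act_def p.ell2_apply_ind_rep[OF g])
      qed
    qed
  qed
  then show ?thesis unfolding \<delta>_def b_def .
qed

theorem proposition3p25:
  fixes G :: "('g, 'm) monoid_scheme" and L :: "'g set"
    and H\<^sub>\<pi> :: "'a::chilbert_space set" and \<pi> :: "'g \<Rightarrow> 'a \<Rightarrow>\<^sub>L 'a"
    and H\<^sub>\<sigma> :: "'b::chilbert_space set" and \<sigma> :: "'g \<Rightarrow> 'b \<Rightarrow>\<^sub>L 'b"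
    and H\<^sub>\<tau> :: "'c::chilbert_space set" and \<tau> :: "'g \<Rightarrow> 'c \<Rightarrow>\<^sub>L 'c"
    and B\<^sub>\<pi> :: "('a \<Rightarrow>\<^sub>L 'a) set"
    and B\<^sub>i\<^sub>n\<^sub>d :: "(('g set, 'b) ell2 \<Rightarrow>\<^sub>L ('g set, 'b) ell2) set"
  assumes "group G" and "subgroup L G"
    and "unitary_rep G H\<^sub>\<pi> \<pi>"
    and "unitary_rep (G\<lparr>carrier := L\<rparr>) H\<^sub>\<sigma> \<sigma>"
    and "weakly_contained G \<pi> (ind_rep G L \<pi>)"
    and "unitary_rep (G\<lparr>carrier := L\<rparr>) H\<^sub>\<tau> \<tau>"
    and "weakly_contained (G\<lparr>carrier := L\<rparr>) \<pi> (tensor_rep H\<^sub>\<sigma> H\<^sub>\<tau> \<sigma> \<tau>)"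
    and "is_FH_boundary G (ind_space G L H\<^sub>\<sigma>) (ind_rep G L \<sigma>) B\<^sub>i\<^sub>n\<^sub>d"
    and "is_FH_boundary G H\<^sub>\<pi> \<pi> B\<^sub>\<pi>"
  shows "\<exists>\<Phi>. G_map G (ind_space G L H\<^sub>\<sigma>) (ind_rep G L \<sigma>) B\<^sub>i\<^sub>n\<^sub>d H\<^sub>\<pi> \<pi> B\<^sub>\<pi> \<Phi>"
proof -
  interpret group G by (rule assms(1))
  have L: "group (G\<lparr>carrier := L\<rparr>)" by (rule subgroup_imp_group[OF assms(2)])
  have \<pi>L: "unitary_rep (G\<lparr>carrier := L\<rparr>) H\<^sub>\<pi> \<pi>"
    using assms(3) subgroup.subset[OF assms(2)] by (auto simp: unitary_rep_def)
  have ind\<pi>: "unitary_rep G (ind_space G L H\<^sub>\<pi>) (ind_rep G L \<pi>)"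
    by (rule induction_data.unitary_rep_ind_rep) (intro induction_data.intro assms(1,2) \<pi>L)
  obtain \<alpha> K where \<alpha>: "G_map (G\<lparr>carrier := L\<rparr>) H\<^sub>\<sigma> \<sigma> (bop H\<^sub>\<sigma>) (tensor_space H\<^sub>\<sigma> H\<^sub>\<tau>)
      (tensor_rep H\<^sub>\<sigma> H\<^sub>\<tau> \<sigma> \<tau>) (bop (tensor_space H\<^sub>\<sigma> H\<^sub>\<tau>)) \<alpha>"
    and K: "\<And>T. T \<in> bop H\<^sub>\<sigma> \<Longrightarrow> norm (\<alpha> T) \<le> K * norm T"
    using ampliation_G_map[OF L assms(4,6)] by blast
  obtain \<beta> where \<beta>: "G_map (G\<lparr>carrier := L\<rparr>) (tensor_space H\<^sub>\<sigma> H\<^sub>\<tau>) (tensor_rep H\<^sub>\<sigma> H\<^sub>\<tau> \<sigma> \<tau>)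
      (bop (tensor_space H\<^sub>\<sigma> H\<^sub>\<tau>)) H\<^sub>\<pi> \<pi> (bop H\<^sub>\<pi>) \<beta>"
    and \<beta>1: "\<And>T. T \<in> bop (tensor_space H\<^sub>\<sigma> H\<^sub>\<tau>) \<Longrightarrow> norm (\<beta> T) \<le> norm T"
    using weakly_contained_ex_G_map[OF L unitary_rep_tensor_rep[OF L assms(4,6)] \<pi>L assms(7)] by blast
  \<comment> \<open>The ampliation is bounded and the extension contractive, so the images of all
    diagonal blocks are uniformly bounded, as the block-diagonal construction requires.\<close>
  have bound: "norm (\<beta> (\<alpha> T)) \<le> K * norm T" if "T \<in> bop H\<^sub>\<sigma>" for T
  proof -
    have "\<alpha> T \<in> bop (tensor_space H\<^sub>\<sigma> H\<^sub>\<tau>)" using \<alpha> that by (auto simp: G_map_def)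
    then show ?thesis using \<beta>1 K[OF that] order_trans by blast
  qed
  obtain \<gamma> where \<gamma>: "G_map G (ind_space G L H\<^sub>\<pi>) (ind_rep G L \<pi>) (bop (ind_space G L H\<^sub>\<pi>)) H\<^sub>\<pi> \<pi> (bop H\<^sub>\<pi>) \<gamma>"
    using weakly_contained_ex_G_map[OF assms(1) ind\<pi> assms(3,5)] by blast
  obtain \<phi> where \<phi>: "minimal_selfmap G (ind_space G L H\<^sub>\<sigma>) (ind_rep G L \<sigma>) \<phi>"
    "B\<^sub>i\<^sub>n\<^sub>d = \<phi> ` bop (ind_space G L H\<^sub>\<sigma>)"
    using assms(8) unfolding is_FH_boundary_def by blast
  obtain \<psi> where \<psi>: "minimal_selfmap G H\<^sub>\<pi> \<pi> \<psi>" "B\<^sub>\<pi> = \<psi> ` bop H\<^sub>\<pi>"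
    using assms(9) unfolding is_FH_boundary_def by blast
  \<comment> \<open>The boundary is by definition the image of the minimal map, which therefore
    serves as an equivariant map from all of B(H) to its boundary.\<close>
  have \<psi>': "G_map G H\<^sub>\<pi> \<pi> (bop H\<^sub>\<pi>) H\<^sub>\<pi> \<pi> B\<^sub>\<pi> \<psi>"
    using G_map_restrict[of G H\<^sub>\<pi> \<pi> "bop H\<^sub>\<pi>" H\<^sub>\<pi> \<pi> "bop H\<^sub>\<pi>" \<psi> "bop H\<^sub>\<pi>" B\<^sub>\<pi>] \<psi>
    by (simp add: minimal_selfmap_def G_selfmaps_def)
  have sub: "B\<^sub>i\<^sub>n\<^sub>d \<subseteq> bop (ind_space G L H\<^sub>\<sigma>)"
    using \<phi> by (auto simp: minimal_selfmap_def G_selfmaps_def G_map_def)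
  note full = G_map_compose[OF G_map_compose[OF
      induced_G_map[OF assms(1,2,4) \<pi>L G_map_compose[OF \<alpha> \<beta>] bound] \<gamma>] \<psi>']
  have "(\<lambda>T. \<psi> (\<gamma> (diag_op (\<lambda>c. \<beta> (\<alpha> (sproj c o\<^sub>L T o\<^sub>L single c)))))) ` B\<^sub>i\<^sub>n\<^sub>d \<subseteq> B\<^sub>\<pi>"
    using full sub by (auto simp: G_map_def)
  from G_map_restrict[OF full sub this] show ?thesis by blast
qed

end
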